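(* Let $M$ be a Riemannian manifold and $k\ge1$ an integer. The quantity $p\cdot c_k(\|\nabla\cdot\|_p,\|\cdot\|_p)$ is increasing with respect to $p\in[1,\infty)$, where $c_k(\|\nabla\cdot\|_p,\|\cdot\|_p)$ is the $p$-th root of the $k$-th min-max variational eigenvalue of the $p$-Laplacian on $M$.
   Context: $M$ has finite positive volume (the paper's standing assumption that the underlying measure space has finite positive measure). $\mathrm{Bd}$ is the space of bounded measurable functions on $M$ with the supremum norm, functions being identified when equal almost everywhere. For $A\subset\mathrm{Bd}\setminus\{0\}$, $\mathrm{genus}(A)$ is the Krasnoselskii genus: the least $m$ such that there is a continuous $\zeta:A\to\mathbb{S}^{m-1}$ with $\zeta(f)=-\zeta(-f)$ (and $+\infty$ if none exists). Then $$c_k(\|\nabla\cdot\|_p,\|\cdot\|_p)=\inf_{A\subset\mathrm{Bd}\setminus\{0\},\ \mathrm{genus}(A)\ge k}\ \sup_{f\in A}\frac{\|\nabla f\|_p}{\|f\|_p},$$ where $\|\cdot\|_p$ is the $L^p(M)$ norm, $\|\nabla f\|_p$ is the $L^p$ norm of the weak gradient, and $\|\nabla f\|_p=+\infty$ if $f\notin W^{1,p}_0(M)$; here $W_0^{1,p}(M)$ is the closure in $W^{1,p}(M)$ of the smooth functions compactly supported in the interior of $M$ (so the condition is Dirichlet if $M$ has boundary, and $W^{1,p}_0(M)=W^{1,p}(M)$ if $M$ is closed). The $k$-th min-max variational eigenvalue of the $p$-Laplacian is $\big(c_k(\|\nabla\cdot\|_p,\|\cdot\|_p)\big)^p$. "Increasing"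 is in the weak sense. *)

theory Defs
  imports "HOL-Analysis.Analysis" "HOL-Probability.Essential_Supremum"
begin

section \<open>Smooth maps\<close>

text \<open>
  \<open>Ck_on k S f\<close> is the usual notion of a $C^k$ map on an \<^emph>\<open>open\<close> set \<open>S\<close> of a Euclidean space
  (all iterated directional derivatives of order less than \<open>k\<close> are differentiable, those of
  order \<open>k\<close> are continuous); it is only used for open \<open>S\<close>.
\<close>

primrec Ck_on :: "nat \<Rightarrow> 'a::real_normed_vector set \<Rightarrow> ('a \<Rightarrow> 'b::real_normed_vector) \<Rightarrow> bool"
  where
    "Ck_on 0 S f \<longleftrightarrow> continuous_on S f"
  | "Ck_on (Suc k) S f \<longleftrightarrow>
       (\<forall>x\<in>S. f differentiable (at x)) \<and> (\<forall>v. Ck_on k S (\<lambda>x. frechet_derivative f (at x) v))"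

text \<open>On an arbitrary set (in particular on a relatively open subset of a half-space), smooth
  means: locally the restriction of a smooth map defined on an open set.\<close>

definition smooth_on :: "'a::real_normed_vector set \<Rightarrow> ('a \<Rightarrow> 'b::real_normed_vector) \<Rightarrow> bool" where
  "smooth_on S f \<longleftrightarrow>
     (\<forall>x\<in>S. \<exists>U F. open U \<and> x \<in> U \<and> (\<forall>k. Ck_on k U F) \<and> (\<forall>y\<in>S \<inter> U. F y = f y))"

definition test_function :: "(real^'n) set \<Rightarrow> (real^'n \<Rightarrow> real) \<Rightarrow> bool" where
  "test_function S \<psi> \<longleftrightarrow>
     smooth_on UNIV \<psi> \<and> (\<exists>K. compact K \<and> K \<subseteq> S \<and> (\<forall>x. x \<notin> K \<longrightarrow> \<psi> x = 0))"


section \<open>Riemannian manifolds, possibly with boundary\<close>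

text \<open>
  The underlying space is a subset of a second countable Hausdorff space, with the subspace
  topology; it need not be connected, compact or complete. A chart is a pair of its domain and its
  coordinate map. A Riemannian metric is given by its Gram matrices \<open>gram M c x\<close> in each chart \<open>c\<close>
  at the coordinate point \<open>x\<close>. Charts take values in \<open>\<real>\<^sup>n\<close> or in a coordinate half-space; the dimension
  is the cardinality of the index type, hence at least 1.
\<close>

type_synonym ('a, 'n) chart = "'a set \<times> ('a \<Rightarrow> real^'n)"

record ('a, 'n) riemannian =
  points :: "'a set"
  atlas :: "('a, 'n) chart set"
  gram :: "('a, 'n) chart \<Rightarrow> real^'n \<Rightarrow> real^'n^'n"

abbreviation dom :: "('a, 'n) chart \<Rightarrow> 'a set" where
  "dom c \<equiv> fst c"

abbreviation coord :: "('a, 'n) chart \<Rightarrow> 'a \<Rightarrow> real^'n" where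
  "coord c \<equiv> snd c"

abbreviation codom :: "('a, 'n) chart \<Rightarrow> (real^'n) set" where
  "codom c \<equiv> coord c ` dom c"

abbreviation uncoord :: "('a, 'n) chart \<Rightarrow> real^'n \<Rightarrow> 'a" where
  "uncoord c \<equiv> inv_into (dom c) (coord c)"

abbreviation overlap :: "('a, 'n) chart \<Rightarrow> ('a, 'n) chart \<Rightarrow> (real^'n) set" where
  "overlap c d \<equiv> coord c ` (dom c \<inter> dom d)"

abbreviation transition :: "('a, 'n) chart \<Rightarrow> ('a, 'n) chart \<Rightarrow> real^'n \<Rightarrow> real^'n" where
  "transition c d \<equiv> coord d \<circ> uncoord c"

definition smooth_atlas ::
  "'a::{t2_space,second_countable_topology} set \<Rightarrow> ('a, 'n::finite) chart set \<Rightarrow> bool" where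
  "smooth_atlas M \<A> \<longleftrightarrow>
     \<Union> (dom ` \<A>) = M \<and>
     (\<forall>c\<in>\<A>. openin (top_of_set M) (dom c) \<and>
        (open (codom c) \<or> (\<exists>i. openin (top_of_set {x. 0 \<le> x $ i}) (codom c))) \<and>
        homeomorphism (dom c) (codom c) (coord c) (uncoord c)) \<and>
     (\<forall>c\<in>\<A>. \<forall>d\<in>\<A>. smooth_on (overlap c d) (transition c d))"

text \<open>
  The derivative of a transition map at a point of its domain, a relatively open subset of a
  half-space, is unique, so that \<open>D\<close> below always denotes the differential of the coordinate change.
\<close>

definition riemannian_manifold ::
  "('a::{t2_space,second_countable_topology}, 'n::finite) riemannian \<Rightarrow> bool" where
  "riemannian_manifold M \<longleftrightarrow>
     smooth_atlas (points M) (atlas M) \<and>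
     (\<forall>c\<in>atlas M. smooth_on (codom c) (gram M c) \<and>
        (\<forall>x\<in>codom c. transpose (gram M c x) = gram M c x \<and>
           (\<forall>v. v \<noteq> 0 \<longrightarrow> 0 < v \<bullet> (gram M c x *v v)))) \<and>
     (\<forall>c\<in>atlas M. \<forall>d\<in>atlas M. \<forall>x\<in>overlap c d. \<forall>D.
        (transition c d has_derivative D) (at x within overlap c d) \<longrightarrow>
        (\<forall>v w. v \<bullet> (gram M c x *v w) = D v \<bullet> (gram M d (transition c d x) *v D w)))"

definition manifold_interior ::
  "('a::{t2_space,second_countable_topology}, 'n::finite) riemannian \<Rightarrow> 'a set" where
  "manifold_interior M = {p. \<exists>c\<in>atlas M. p \<in> dom c \<and> coord c p \<in> interior (codom c)}"

text \<open>The Riemannian volume is the unique Borel measure with density $\sqrt{\det g}$ with respect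
  to Lebesgue measure in every chart.\<close>

definition riemannian_volume ::
  "('a::{t2_space,second_countable_topology}, 'n::finite) riemannian \<Rightarrow> 'a measure \<Rightarrow> bool" where
  "riemannian_volume M \<mu> \<longleftrightarrow>
     sets \<mu> = sets (restrict_space borel (points M)) \<and>
     (\<forall>c\<in>atlas M. \<forall>E\<in>sets \<mu>. E \<subseteq> dom c \<longrightarrow>
        emeasure \<mu> E = (\<integral>\<^sup>+x\<in>coord c ` E. ennreal (sqrt (det (gram M c x))) \<partial>lborel))"


section \<open>Weak gradients and Sobolev spaces\<close>

text \<open>A vector field assigns to a chart and a point of its domain the components of a tangent
  vector in that chart.\<close>

type_synonym ('a, 'n) vfield = "('a, 'n) chart \<Rightarrow> 'a \<Rightarrow> real^'n"

definition vector_field ::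
  "('a::{t2_space,second_countable_topology}, 'n::finite) riemannian \<Rightarrow> ('a, 'n) vfield \<Rightarrow> bool"
  where
  "vector_field M X \<longleftrightarrow>
     (\<forall>c\<in>atlas M. X c \<in> borel_measurable (restrict_space borel (dom c))) \<and>
     (\<forall>c\<in>atlas M. \<forall>d\<in>atlas M. \<forall>p\<in>dom c \<inter> dom d. \<forall>D.
        (transition c d has_derivative D) (at (coord c p) within overlap c d) \<longrightarrow>
        X d p = D (X c p))"

definition vnorm ::
  "('a::{t2_space,second_countable_topology}, 'n::finite) riemannian \<Rightarrow> ('a, 'n) vfield \<Rightarrow> 'a \<Rightarrow> real"
  where
  "vnorm M X p =
     (let c = (SOME c. c \<in> atlas M \<and> p \<in> dom c)
      in sqrt (X c p \<bullet> (gram M c (coord c p) *v X c p)))"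

text \<open>
  \<open>X\<close> is a weak gradient of \<open>f\<close> if, in the interior of each chart, the components
  $(gX)_i$ of the associated covector field are the weak partial derivatives of \<open>f\<close>.
\<close>

definition weak_gradient ::
  "('a::{t2_space,second_countable_topology}, 'n::finite) riemannian \<Rightarrow> ('a \<Rightarrow> real) \<Rightarrow>
     ('a, 'n) vfield \<Rightarrow> bool" where
  "weak_gradient M f X \<longleftrightarrow>
     vector_field M X \<and>
     (\<forall>c\<in>atlas M.
        let V = interior (codom c);
            f_c = (\<lambda>x. f (uncoord c x));
            df_c = (\<lambda>x. gram M c x *v X c (uncoord c x))
        in (\<forall>K. compact K \<and> K \<subseteq> V \<longrightarrow>
              set_integrable lborel K f_c \<and> set_integrable lborel K df_c) \<and>
           (\<forall>\<psi> i. test_function V \<psi> \<longrightarrow>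
              (LINT x:V|lborel. f_c x * frechet_derivative \<psi> (at x) (axis i 1)) =
              - (LINT x:V|lborel. df_c x $ i * \<psi> x)))"

definition wgrad ::
  "('a::{t2_space,second_countable_topology}, 'n::finite) riemannian \<Rightarrow> ('a \<Rightarrow> real) \<Rightarrow>
     ('a, 'n) vfield" where
  "wgrad M f = (SOME X. weak_gradient M f X)"

definition Lp :: "'a measure \<Rightarrow> real \<Rightarrow> ('a \<Rightarrow> real) set" where
  "Lp \<mu> p = {f \<in> borel_measurable \<mu>. integrable \<mu> (\<lambda>x. \<bar>f x\<bar> powr p)}"

definition Lp_norm :: "'a measure \<Rightarrow> real \<Rightarrow> ('a \<Rightarrow> real) \<Rightarrow> real" where
  "Lp_norm \<mu> p f = (\<integral>x. \<bar>f x\<bar> powr p \<partial>\<mu>) powr (1 / p)"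

definition W1p ::
  "('a::{t2_space,second_countable_topology}, 'n::finite) riemannian \<Rightarrow> 'a measure \<Rightarrow> real \<Rightarrow>
     ('a \<Rightarrow> real) set" where
  "W1p M \<mu> p = {f \<in> Lp \<mu> p. (\<exists>X. weak_gradient M f X) \<and> vnorm M (wgrad M f) \<in> Lp \<mu> p}"

definition W1p_norm ::
  "('a::{t2_space,second_countable_topology}, 'n::finite) riemannian \<Rightarrow> 'a measure \<Rightarrow> real \<Rightarrow>
     ('a \<Rightarrow> real) \<Rightarrow> real" where
  "W1p_norm M \<mu> p f = Lp_norm \<mu> p f + Lp_norm \<mu> p (vnorm M (wgrad M f))"

definition smooth_compact_interior ::
  "('a::{t2_space,second_countable_topology}, 'n::finite) riemannian \<Rightarrow> ('a \<Rightarrow> real) set" where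
  "smooth_compact_interior M =
     {u. (\<forall>c\<in>atlas M. smooth_on (codom c) (u \<circ> uncoord c)) \<and>
         (\<exists>K. compact K \<and> K \<subseteq> manifold_interior M \<and> (\<forall>x\<in>points M - K. u x = 0))}"

definition W1p0 ::
  "('a::{t2_space,second_countable_topology}, 'n::finite) riemannian \<Rightarrow> 'a measure \<Rightarrow> real \<Rightarrow>
     ('a \<Rightarrow> real) set" where
  "W1p0 M \<mu> p =
     {f \<in> W1p M \<mu> p. \<forall>\<epsilon>>0. \<exists>u\<in>smooth_compact_interior M. W1p_norm M \<mu> p (\<lambda>x. f x - u x) < \<epsilon>}"

definition grad_norm ::
  "('a::{t2_space,second_countable_topology}, 'n::finite) riemannian \<Rightarrow> 'a measure \<Rightarrow> real \<Rightarrow>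
     ('a \<Rightarrow> real) \<Rightarrow> ennreal" where
  "grad_norm M \<mu> p f =
     (if f \<in> W1p0 M \<mu> p then ennreal (Lp_norm \<mu> p (vnorm M (wgrad M f))) else \<infinity>)"


section \<open>The space of bounded functions modulo almost everywhere equality\<close>

definition ae_class :: "'a measure \<Rightarrow> ('a \<Rightarrow> real) \<Rightarrow> ('a \<Rightarrow> real) set" where
  "ae_class \<mu> f = {g \<in> borel_measurable \<mu>. AE x in \<mu>. g x = f x}"

definition Bd :: "'a measure \<Rightarrow> ('a \<Rightarrow> real) set set" where
  "Bd \<mu> = ae_class \<mu> ` {f \<in> borel_measurable \<mu>. \<exists>C. \<forall>x\<in>space \<mu>. \<bar>f x\<bar> \<le> C}"

text \<open>The suprema over \<open>F\<close> and \<open>G\<close> only serve to evaluate at representatives: the essential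
  supremum does not depend on them.\<close>

definition Bd_dist :: "'a measure \<Rightarrow> ('a \<Rightarrow> real) set \<Rightarrow> ('a \<Rightarrow> real) set \<Rightarrow> real" where
  "Bd_dist \<mu> F G =
     real_of_ereal (SUP f\<in>F. SUP g\<in>G. esssup \<mu> (\<lambda>x. ereal \<bar>f x - g x\<bar>))"

lemma Metric_space_Bd: "Metric_space (Bd \<mu>) (Bd_dist \<mu>)"
proof -
  define N where "N f g = esssup \<mu> (\<lambda>x. ereal \<bar>f x - g x\<bar>)" for f g :: "'a \<Rightarrow> real"
  have N_commute: "N f g = N g f" for f g
    by (simp add: N_def abs_minus_commute)
  have N_cases: "N f g = -\<infinity> \<or> 0 \<le> N f g" for f g
  proof (cases "N f g \<ge> 0")
    case False
    then have *: "AE x in \<mu>. False"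
      using esssup_AE[of "\<lambda>x. ereal \<bar>f x - g x\<bar>" \<mu>] unfolding N_def
      by (auto simp: not_le elim!: eventually_mono)
        (metis abs_ge_zero ereal_less_eq(5) order.strict_trans1 order_less_irrefl)
    show ?thesis
    proof (cases "(\<lambda>x. ereal \<bar>f x - g x\<bar>) \<in> borel_measurable \<mu>")
      case True
      then have "N f g \<le> -\<infinity>" unfolding N_def
        by (rule esssup_I) (use * in \<open>auto elim: eventually_mono\<close>)
      then show ?thesis by simp
    next
      case F: False
      with False show ?thesis by (simp add: N_def esssup_non_measurable top_ereal_def)
    qed
  qed simp
  define D where "D F G = (SUP f\<in>F. SUP g\<in>G. N f g)" for F G
  have dist_eq: "Bd_dist \<mu> F G = real_of_ereal (D F G)" for F G
    by (simp add: Bd_dist_def D_def N_def)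
  have D_commute: "D F G = D G F" for F G
    unfolding D_def by (subst SUP_commute) (simp add: N_commute)
  have D_nonneg: "0 \<le> real_of_ereal (D F G)" for F G
  proof (cases "\<exists>f\<in>F. \<exists>g\<in>G. 0 \<le> N f g")
    case True
    then have "0 \<le> D F G" unfolding D_def by (meson SUP_upper2)
    then show ?thesis by (rule real_of_ereal_pos)
  next
    case False
    then have "D F G \<le> -\<infinity>" unfolding D_def using N_cases by (intro SUP_least) auto
    then show ?thesis by simp
  qed
  have self: "f \<in> ae_class \<mu> f" if "f \<in> borel_measurable \<mu>" for f
    using that by (simp add: ae_class_def)
  have D_class: "D (ae_class \<mu> f) (ae_class \<mu> g) = N f g"
    if "f \<in> borel_measurable \<mu>" "g \<in> borel_measurable \<mu>" for f g
  proof -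
    have *: "N f' g' = N f g" if f': "f' \<in> ae_class \<mu> f" and g': "g' \<in> ae_class \<mu> g" for f' g'
    proof -
      have [measurable]: "f' \<in> borel_measurable \<mu>" "g' \<in> borel_measurable \<mu>"
        and ae: "AE x in \<mu>. f' x = f x" "AE x in \<mu>. g' x = g x"
        using f' g' by (auto simp: ae_class_def)
      note [measurable] = \<open>f \<in> borel_measurable \<mu>\<close> \<open>g \<in> borel_measurable \<mu>\<close>
      show ?thesis unfolding N_def
        by (rule esssup_AE_cong) (measurable, use ae in eventually_elim, simp)
    qed
    have eq: "(SUP g'\<in>ae_class \<mu> g. N f' g') = N f g" if "f' \<in> ae_class \<mu> f" for f'
      using self[OF \<open>g \<in> _\<close>] *[OF that] by (intro SUP_eq_const) auto
    show ?thesis unfolding D_def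
      by (rule SUP_eq_const) (use self[OF \<open>f \<in> _\<close>] eq in blast)+
  qed
  have N_bdd: "N f g < \<infinity>"
    if "f \<in> borel_measurable \<mu>" "g \<in> borel_measurable \<mu>"
      "\<forall>x\<in>space \<mu>. \<bar>f x\<bar> \<le> C" "\<forall>x\<in>space \<mu>. \<bar>g x\<bar> \<le> C'" for f g C C'
  proof -
    have le: "\<bar>f x - g x\<bar> \<le> C + C'" if "x \<in> space \<mu>" for x
      using bspec[OF \<open>\<forall>x\<in>space \<mu>. \<bar>f x\<bar> \<le> C\<close> that] bspec[OF \<open>\<forall>x\<in>space \<mu>. \<bar>g x\<bar> \<le> C'\<close> that]
      by linarith
    note [measurable] = \<open>f \<in> borel_measurable \<mu>\<close> \<open>g \<in> borel_measurable \<mu>\<close>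
    have "N f g \<le> ereal (C + C')" unfolding N_def
      by (intro esssup_I AE_I2) (auto simp: le)
    then show ?thesis by (auto simp: less_top[symmetric] top_ereal_def)
  qed
  show ?thesis
  proof
    show "0 \<le> Bd_dist \<mu> F G" for F G by (simp add: dist_eq D_nonneg)
    show "Bd_dist \<mu> F G = Bd_dist \<mu> G F" for F G by (simp add: dist_eq D_commute)
    show "Bd_dist \<mu> F G = 0 \<longleftrightarrow> F = G" if FG: "F \<in> Bd \<mu>" "G \<in> Bd \<mu>" for F G
    proof -
      obtain f g C C' where F: "F = ae_class \<mu> f" "f \<in> borel_measurable \<mu>" "\<forall>x\<in>space \<mu>. \<bar>f x\<bar> \<le> C"
        and G: "G = ae_class \<mu> g" "g \<in> borel_measurable \<mu>" "\<forall>x\<in>space \<mu>. \<bar>g x\<bar> \<le> C'"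
        using FG by (auto simp: Bd_def)
      have d: "Bd_dist \<mu> F G = real_of_ereal (N f g)"
        using F G by (simp add: dist_eq D_class)
      show ?thesis
      proof
        assume "Bd_dist \<mu> F G = 0"
        then have "N f g \<le> 0"
          using N_bdd[OF F(2) G(2) F(3) G(3)] unfolding d by (cases "N f g") auto
        then have "AE x in \<mu>. ereal \<bar>f x - g x\<bar> \<le> 0"
          using esssup_AE[of "\<lambda>x. ereal \<bar>f x - g x\<bar>" \<mu>] unfolding N_def
          by (auto elim!: eventually_mono dest: order_trans)
        then have ae: "AE x in \<mu>. f x = g x" by (auto elim!: eventually_mono)
        have "(AE x in \<mu>. u x = f x) \<longleftrightarrow> (AE x in \<mu>. u x = g x)" for u
          using ae by (intro eventually_cong[OF ae]) auto
        then show "F = G" unfolding F(1) G(1) ae_class_def by simp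
      next
        assume "F = G"
        then have "Bd_dist \<mu> F G = real_of_ereal (N f f)"
            using D_class[OF F(2) F(2)] F(1) by (simp add: dist_eq)
        moreover have "N f f \<le> 0" unfolding N_def by (rule esssup_I) auto
        ultimately show "Bd_dist \<mu> F G = 0" using N_cases[of f f] by auto
      qed
    qed
    show "Bd_dist \<mu> F H \<le> Bd_dist \<mu> F G + Bd_dist \<mu> G H"
      if FGH: "F \<in> Bd \<mu>" "G \<in> Bd \<mu>" "H \<in> Bd \<mu>" for F G H
    proof -
      obtain f g h C C' C'' where F: "F = ae_class \<mu> f" "f \<in> borel_measurable \<mu>" "\<forall>x\<in>space \<mu>. \<bar>f x\<bar> \<le> C"
        and G: "G = ae_class \<mu> g" "g \<in> borel_measurable \<mu>" "\<forall>x\<in>space \<mu>. \<bar>g x\<bar> \<le> C'"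
        and H: "H = ae_class \<mu> h" "h \<in> borel_measurable \<mu>" "\<forall>x\<in>space \<mu>. \<bar>h x\<bar> \<le> C''"
        using FGH by (auto simp: Bd_def)
      note [measurable] = F(2) G(2) H(2)
      have "N f h \<le> esssup \<mu> (\<lambda>x. ereal \<bar>f x - g x\<bar> + ereal \<bar>g x - h x\<bar>)"
        unfolding N_def by (rule esssup_mono) auto
      also have "\<dots> \<le> N f g + N g h" unfolding N_def by (rule esssup_add)
      finally have le: "N f h \<le> N f g + N g h" .
      have "N f g < \<infinity>" "N g h < \<infinity>" "N f h < \<infinity>"
        using N_bdd F G H by blast+
      then have "real_of_ereal (N f h) \<le> real_of_ereal (N f g) + real_of_ereal (N g h)"
        using le N_cases[of f h] N_cases[of f g] N_cases[of g h]
        by (cases "N f h"; cases "N f g"; cases "N g h") auto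
      then show ?thesis using F G H by (simp add: dist_eq D_class)
    qed
  qed
qed

definition Bd_topology :: "'a measure \<Rightarrow> ('a \<Rightarrow> real) set topology" where
  "Bd_topology \<mu> = Metric_space.mtopology (Bd \<mu>) (Bd_dist \<mu>)"

definition neg_class :: "('a \<Rightarrow> real) set \<Rightarrow> ('a \<Rightarrow> real) set" where
  "neg_class F = (\<lambda>f x. - f x) ` F"


section \<open>Krasnoselskii genus and the min-max values\<close>

text \<open>The unit sphere of $\mathbb R^m$; it is empty for $m = 0$ and equals
  \<^term>\<open>nsphere n\<close> for $m = n + 1$.\<close>

definition unit_sphere :: "nat \<Rightarrow> (nat \<Rightarrow> real) topology" where
  "unit_sphere m = subtopology (Euclidean_space m) {x. (\<Sum>i<m. x i ^ 2) = 1}"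

definition symmetric_classes :: "('a \<Rightarrow> real) set set \<Rightarrow> bool" where
  "symmetric_classes A \<longleftrightarrow> (\<forall>F\<in>A. neg_class F \<in> A)"

definition genus :: "'a measure \<Rightarrow> ('a \<Rightarrow> real) set set \<Rightarrow> enat" where
  "genus \<mu> A =
     Inf {enat m | m. \<exists>\<zeta>. continuous_map (subtopology (Bd_topology \<mu>) A) (unit_sphere m) \<zeta> \<and>
                          (\<forall>F\<in>A. \<zeta> F = (\<lambda>i. - \<zeta> (neg_class F) i))}"

text \<open>
  The supremum over \<open>\<Union>A\<close> is the supremum over the classes in \<open>A\<close>, evaluated at their
  representatives; the quotient depends on the class only. The genus is defined for sets that
  are symmetric under negation. \<open>minmax_value M \<mu> k p\<close> is the \<open>p\<close>-th root of the \<open>k\<close>-th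
  min-max variational eigenvalue of the \<open>p\<close>-Laplacian (with Dirichlet condition on the boundary).
\<close>

definition minmax_value ::
  "('a::{t2_space,second_countable_topology}, 'n::finite) riemannian \<Rightarrow> 'a measure \<Rightarrow> nat \<Rightarrow>
     real \<Rightarrow> ennreal" where
  "minmax_value M \<mu> k p =
     (INF A \<in> {A. A \<subseteq> Bd \<mu> - {ae_class \<mu> (\<lambda>_. 0)} \<and> symmetric_classes A \<and> enat k \<le> genus \<mu> A}.
        SUP f \<in> \<Union>A. grad_norm M \<mu> p f / ennreal (Lp_norm \<mu> p f))"

end

theory Submission
  imports Defs
begin

text \<open>
  Put \<open>s = q / p\<close> and \<open>spow s x = sgn x * \<bar>x\<bar> powr s\<close>. The map \<open>f \<mapsto> spow s f\<close> is odd and continuous on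
  bounded functions, so the image of a competitor for the \<open>k\<close>-th value at \<open>q\<close> is a competitor at
  \<open>p\<close>. By the chain rule the gradient of \<open>spow s f\<close> is \<open>s * \<bar>f\<bar> powr (s - 1)\<close> times that of \<open>f\<close>, and
  Hoelder's inequality bounds the Rayleigh quotient of \<open>spow s f\<close> at \<open>p\<close> by \<open>q / p\<close> times that of
  \<open>f\<close> at \<open>q\<close>.

  The chain rule needs no mollification on the manifold: \<open>f\<close> is a limit of smooth compactly
  supported \<open>u n\<close>, the derivative of \<open>spow s\<close> agrees on the essential range of \<open>f\<close> with a uniform limit
  of bounded derivatives of smooth functions \<open>\<phi> n\<close>, and \<open>\<phi> n (u n)\<close> converges to \<open>spow s f\<close> together with
  its gradient.
\<close>

text \<open>The exponent \<open>s = q / p\<close> is forced: it gives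
  \<open>\<bar>spow s f\<bar> powr p = \<bar>f\<bar> powr q\<close>, and since
  \<open>(s - 1) * p = q - p\<close>, Hoelder with weights \<open>1 - p / q\<close> and
  \<open>p / q\<close> returns exactly the norms of order \<open>q\<close>. The factor
  \<open>s\<close> of the derivative is then the only loss, whence the normalisation of the min-max
  value by \<open>p\<close>. Two obstacles shape the chain rule. \<open>spow s\<close> need not be
  smooth at 0, and its derivative is unbounded, while the approximants \<open>u n\<close> obey no
  common bound. As \<open>f\<close> itself is essentially bounded, the derivative may be altered
  outside its essential range; a smooth periodic change of variable provides a bounded alteration.
  Finite volume lets convergence at order \<open>q\<close> be used at lower orders.
  \<open>wgrad\<close> picks an arbitrary weak gradient, so identities for its norm rely on
  uniqueness almost everywhere. That calls for the fundamental lemma of the calculus of variations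
  in charts, hence for bump functions, and for integration by parts to see that smooth functions
  have the expected weak gradient.\<close>

section \<open>Calculus of \<open>Ck_on\<close> maps\<close>

lemma frechet_derivative_cong_open:
  assumes "open S" "x \<in> S" "\<And>y. y \<in> S \<Longrightarrow> f y = g y"
  shows "frechet_derivative f (at x) = frechet_derivative g (at x)"
    and "f differentiable (at x) \<longleftrightarrow> g differentiable (at x)"
proof -
  have *: "(f has_derivative D) (at x) \<longleftrightarrow> (g has_derivative D) (at x)" for D
    using has_derivative_transform_within_open[OF _ assms(1,2)] assms(3) by metis
  show "frechet_derivative f (at x) = frechet_derivative g (at x)"
    unfolding frechet_derivative_def * ..
  show "f differentiable (at x) \<longleftrightarrow> g differentiable (at x)"
    unfolding differentiable_def * ..
qed

lemma Ck_on_cong: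
  assumes "open S" "\<And>x. x \<in> S \<Longrightarrow> f x = g x" "Ck_on k S f"
  shows "Ck_on k S g"
  using assms(2,3)
proof (induction k arbitrary: f g)
  case 0
  then show ?case by (simp cong: continuous_on_cong)
next
  case (Suc k)
  have d: "f differentiable (at x) \<longleftrightarrow> g differentiable (at x)"
    "frechet_derivative f (at x) = frechet_derivative g (at x)" if "x \<in> S" for x
    using frechet_derivative_cong_open[OF assms(1) that] Suc.prems(1) by blast+
  have "Ck_on k S (\<lambda>x. frechet_derivative g (at x) v)" for v
    by (rule Suc.IH[of "\<lambda>x. frechet_derivative f (at x) v"]) (use Suc.prems d in auto)
  then show ?case using Suc.prems d by auto
qed

lemma Ck_on_SucD: "Ck_on (Suc k) S f \<Longrightarrow> Ck_on k S f"
proof (induction k arbitrary: f)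
  case 0
  then show ?case
    by (auto intro!: continuous_at_imp_continuous_on differentiable_imp_continuous_within)
next
  case (Suc k)
  from Suc.prems have "\<forall>x\<in>S. f differentiable (at x)"
    and "\<And>v. Ck_on (Suc k) S (\<lambda>x. frechet_derivative f (at x) v)"
    using Ck_on.simps(2)[of "Suc k" S f] by blast+
  then show ?case using Suc.IH by auto
qed

lemma Ck_on_const: "Ck_on k S (\<lambda>_. c)"
proof (induction k arbitrary: c)
  case (Suc k)
  show ?case using Suc[of 0] by (simp add: frechet_derivative_const)
qed simp

text \<open>\<open>Ck_on\<close> is phrased with \<open>frechet_derivative\<close>; this form
  accepts an explicitly given derivative, and the closure rules below start from it.\<close>

lemma Ck_on_SucI:
  assumes "open S" "\<And>x. x \<in> S \<Longrightarrow> (f has_derivative f' x) (at x)" "\<And>v. Ck_on k S (\<lambda>x. f' x v)"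
  shows "Ck_on (Suc k) S f"
proof -
  have "frechet_derivative f (at x) = f' x" if "x \<in> S" for x
    using frechet_derivative_at[OF assms(2)[OF that]] by simp
  then have "Ck_on k S (\<lambda>x. frechet_derivative f (at x) v)" for v
    using Ck_on_cong[OF assms(1) _ assms(3)] by simp
  then show ?thesis using assms(2) by (auto simp: differentiable_def)
qed

lemma Ck_on_SucE:
  assumes "Ck_on (Suc k) S f"
  shows "\<And>x. x \<in> S \<Longrightarrow> (f has_derivative frechet_derivative f (at x)) (at x)"
    and "\<And>v. Ck_on k S (\<lambda>x. frechet_derivative f (at x) v)"
  using assms frechet_derivative_works by auto

lemma Ck_on_bounded_linear:
  assumes "bounded_linear f" "open S"
  shows "Ck_on k S f"
proof (cases k)
  case 0
  then show ?thesis using assms by (simp add: linear_continuous_on)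
next
  case (Suc m)
  show ?thesis unfolding Suc
    by (rule Ck_on_SucI[OF assms(2), where f' = "\<lambda>_. f"])
      (auto intro: bounded_linear_imp_has_derivative assms Ck_on_const)
qed

lemma Ck_on_add:
  assumes "open S" "Ck_on k S f" "Ck_on k S g"
  shows "Ck_on k S (\<lambda>x. f x + g x)"
  using assms(2,3)
proof (induction k arbitrary: f g)
  case 0
  then show ?case by (auto intro: continuous_intros)
next
  case (Suc k)
  show ?case
    by (rule Ck_on_SucI[OF assms(1)], rule has_derivative_add)
      (use Ck_on_SucE[OF Suc.prems(1)] Ck_on_SucE[OF Suc.prems(2)] Suc.IH in auto)
qed

lemma Ck_on_mult:
  fixes f g :: "'a::real_normed_vector \<Rightarrow> real"
  assumes "open S" "Ck_on k S f" "Ck_on k S g"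
  shows "Ck_on k S (\<lambda>x. f x * g x)"
  using assms(2,3)
proof (induction k arbitrary: f g)
  case 0
  then show ?case by (auto intro: continuous_intros)
next
  case (Suc k)
  show ?case
    by (rule Ck_on_SucI[OF assms(1)], rule has_derivative_mult)
      (use Ck_on_SucE[OF Suc.prems(1)] Ck_on_SucE[OF Suc.prems(2)]
        Ck_on_SucD[OF Suc.prems(1)] Ck_on_SucD[OF Suc.prems(2)] in
        \<open>auto intro!: Ck_on_add assms Suc.IH\<close>)
qed

lemma Ck_on_prod:
  fixes f :: "'i \<Rightarrow> 'a::real_normed_vector \<Rightarrow> real"
  assumes "open S" "\<And>i. i \<in> I \<Longrightarrow> Ck_on k S (f i)"
  shows "Ck_on k S (\<lambda>x. \<Prod>i\<in>I. f i x)"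
  using assms(2)
  by (induction I rule: infinite_finite_induct) (auto intro!: Ck_on_const Ck_on_mult assms(1))

text \<open>The derivative of the composite contains the factor \<open>g' (f x)\<close>, again a
  composite, so the induction varies \<open>g\<close> as well as \<open>f\<close>.\<close>

lemma Ck_on_compose:
  fixes g :: "real \<Rightarrow> real" and f :: "'a::real_normed_vector \<Rightarrow> real"
  assumes "open S" "Ck_on k S f" "Ck_on k UNIV g"
  shows "Ck_on k S (\<lambda>x. g (f x))"
  using assms(2,3)
proof (induction k arbitrary: f g)
  case 0
  then show ?case
    using continuous_on_compose2[of UNIV g S f] by auto
next
  case (Suc k)
  define g' where "g' y = frechet_derivative g (at y) 1" for y
  have g': "(g has_derivative (\<lambda>h. h * g' y)) (at y)" for y
  proof -
    have "(g has_derivative frechet_derivative g (at y)) (at y)"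
      using Ck_on_SucE(1)[OF Suc.prems(2)] by simp
    moreover from this interpret bounded_linear "frechet_derivative g (at y)"
      by (rule has_derivative_bounded_linear)
    have "frechet_derivative g (at y) h = h * g' y" for h
      using scaleR[of h 1] by (simp add: g'_def)
    then have "frechet_derivative g (at y) = (\<lambda>h. h * g' y)" by blast
    ultimately show ?thesis by simp
  qed
  show ?case
  proof (rule Ck_on_SucI[OF assms(1)])
    fix x assume "x \<in> S"
    then show "((\<lambda>x. g (f x)) has_derivative (\<lambda>v. frechet_derivative f (at x) v * g' (f x))) (at x)"
      using has_derivative_compose[OF Ck_on_SucE(1)[OF Suc.prems(1)] g'] by simp
  next
    have "Ck_on k UNIV g'"
      unfolding g'_def using Ck_on_SucE(2)[OF Suc.prems(2)] .
    then show "Ck_on k S (\<lambda>x. frechet_derivative f (at x) v * g' (f x))" for v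
      using Ck_on_mult[OF assms(1) Ck_on_SucE(2)[OF Suc.prems(1)]
          Suc.IH[OF Ck_on_SucD[OF Suc.prems(1)]]] by blast
  qed
qed

lemma Ck_on_Suc_realI:
  fixes f g :: "real \<Rightarrow> real"
  assumes "\<And>x. (f has_real_derivative g x) (at x)" "Ck_on k UNIV g"
  shows "Ck_on (Suc k) UNIV f"
  by (rule Ck_on_SucI[where f' = "\<lambda>x v. g x * v"])
    (use assms in \<open>auto simp: has_field_derivative_def intro!: Ck_on_mult Ck_on_const\<close>)

lemma Ck_on_sin_cos: "Ck_on k UNIV (sin :: real \<Rightarrow> real)" "Ck_on k UNIV (cos :: real \<Rightarrow> real)"
proof (induction k)
  case (Suc k)
  show "Ck_on (Suc k) UNIV (sin :: real \<Rightarrow> real)"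
    by (rule Ck_on_Suc_realI[OF DERIV_sin Suc(2)])
  show "Ck_on (Suc k) UNIV (cos :: real \<Rightarrow> real)"
    by (rule Ck_on_Suc_realI[OF DERIV_cos])
      (use Ck_on_mult[OF open_UNIV Ck_on_const[where c = "-1"] Suc(1)] in simp)
qed (auto intro: continuous_intros)

lemma Ck_on_real_polynomial_function:
  fixes f :: "real \<Rightarrow> real"
  assumes "real_polynomial_function f"
  shows "Ck_on k UNIV f"
  using assms
  by induction (auto intro: Ck_on_bounded_linear Ck_on_const Ck_on_add Ck_on_mult)

section \<open>Smooth cutoffs on the line\<close>

text \<open>The case \<open>m = 0\<close> is the classical flat function,
  \<open>exp (- (1/t))\<close> for positive \<open>t\<close> and 0 elsewhere. The extra powers of
  \<open>1/t\<close> close the family under differentiation up to linear combinations, so that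
  smoothness follows by induction for all \<open>m\<close> at once.\<close>

definition flat_exp :: "nat \<Rightarrow> real \<Rightarrow> real" where
  "flat_exp m t = (if t \<le> 0 then 0 else exp (- (1/t)) / t ^ m)"

text \<open>With \<open>y = 1/t\<close> the right-hand limit is the decay of
  \<open>y ^ m / exp y\<close> at infinity; on the left the function vanishes.\<close>

lemma flat_exp_at_right_0: "(flat_exp m \<longlongrightarrow> 0) (at 0)"
proof -
  have "((\<lambda>y::real. y ^ m / exp y) \<longlongrightarrow> 0) at_top"
    by (rule tendsto_power_div_exp_0)
  then have "((\<lambda>t::real. (inverse t) ^ m / exp (inverse t)) \<longlongrightarrow> 0) (at_right 0)"
    by (rule filterlim_compose) (rule filterlim_inverse_at_top_right)
  moreover have "eventually (\<lambda>t. (inverse t) ^ m / exp (inverse t) = flat_exp m t) (at_right 0)"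
    unfolding eventually_at_right_field
    by (intro exI[of _ 1]) (auto simp: flat_exp_def exp_minus field_simps)
  ultimately have r: "(flat_exp m \<longlongrightarrow> 0) (at_right 0)"
    using Lim_transform_eventually by blast
  have "eventually (\<lambda>t. 0 = flat_exp m t) (at_left 0)"
    unfolding eventually_at_left_field by (intro exI[of _ "-1"]) (auto simp: flat_exp_def)
  then have l: "(flat_exp m \<longlongrightarrow> 0) (at_left 0)"
    using Lim_transform_eventually tendsto_const by blast
  from l r show ?thesis by (rule filterlim_split_at_real)
qed

lemma DERIV_flat_exp:
  "(flat_exp m has_real_derivative flat_exp (m + 2) t - real m * flat_exp (m + 1) t) (at t)"
proof (cases "t = 0")
  case True
  \<comment> \<open>The difference quotient at 0 is \<open>flat_exp (m + 1)\<close>, even at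
    \<open>h = 0\<close>, where division by zero yields 0.\<close>
  have "((\<lambda>h. (flat_exp m h - flat_exp m 0) / (h - 0)) \<longlongrightarrow> 0) (at 0)"
    by (rule tendsto_cong[THEN iffD1, OF _ flat_exp_at_right_0[of "m + 1"]])
      (auto simp: flat_exp_def intro!: always_eventually)
  then show ?thesis unfolding True has_field_derivative_iff by (simp add: flat_exp_def)
next
  case False
  show ?thesis
  proof (cases "t < 0")
    case True
    have "((\<lambda>_. 0) has_real_derivative 0) (at t)" by simp
    then have "(flat_exp m has_real_derivative 0) (at t)"
      by (rule has_field_derivative_transform_within_open[where S = "{..<0}"])
        (use True in \<open>auto simp: flat_exp_def\<close>)
    then show ?thesis using True by (simp add: flat_exp_def)
  next
    case F: False
    with False have t: "t > 0" by simp
    have "((\<lambda>t. exp (- (1/t)) / t ^ m) has_real_derivative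
        (exp (- (1/t)) * (1 / t\<^sup>2) * t ^ m - exp (- (1/t)) * (real m * t ^ (m - 1))) / (t ^ m * t ^ m)) (at t)"
      using t by (auto intro!: derivative_eq_intros simp: power2_eq_square field_simps)
    also have "(exp (- (1/t)) * (1 / t\<^sup>2) * t ^ m - exp (- (1/t)) * (real m * t ^ (m - 1))) / (t ^ m * t ^ m)
      = flat_exp (m + 2) t - real m * flat_exp (m + 1) t"
      using t by (cases m) (auto simp: flat_exp_def field_simps power2_eq_square)
    finally show ?thesis
      by (rule has_field_derivative_transform_within_open[where S = "{0<..}"])
        (use t in \<open>auto simp: flat_exp_def\<close>)
  qed
qed

lemma Ck_on_flat_exp: "Ck_on k UNIV (flat_exp m)"
proof (induction k arbitrary: m)
  case 0
  then show ?case
    using DERIV_flat_exp by (auto intro!: continuous_at_imp_continuous_on DERIV_isCont)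
next
  case (Suc k)
  have "Ck_on k UNIV (\<lambda>t. flat_exp (m + 2) t + (- real m) * flat_exp (m + 1) t)"
    by (intro Ck_on_add Ck_on_mult Ck_on_const Suc open_UNIV)
  then show ?case
    by (intro Ck_on_Suc_realI[OF DERIV_flat_exp]) simp
qed

lemma flat_exp_0_bounds: "0 \<le> flat_exp 0 t" "flat_exp 0 t \<le> 1"
  by (auto simp: flat_exp_def)

text \<open>Dilation drives the exponent \<open>- 1 / (j t)\<close> to 0 for positive
  \<open>t\<close>, so the cutoff sharpens to a step function.\<close>

lemma flat_exp_0_tendsto: "(\<lambda>j. flat_exp 0 (real j * t)) \<longlonglongrightarrow> (if t \<le> 0 then 0 else 1)"
proof (cases "t \<le> 0")
  case True
  then have "flat_exp 0 (real j * t) = 0" for j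
    by (simp add: flat_exp_def mult_nonneg_nonpos)
  then show ?thesis using True by simp
next
  case False
  have "(\<lambda>j. exp (- ((1/t) * inverse (real j)))) \<longlonglongrightarrow> exp (- ((1/t) * 0))"
    by (intro tendsto_intros lim_inverse_n)
  moreover have "eventually (\<lambda>j. exp (- ((1/t) * inverse (real j))) = flat_exp 0 (real j * t)) sequentially"
    using False by (intro eventually_sequentiallyI[of 1]) (auto simp: flat_exp_def field_simps mult_le_0_iff)
  ultimately show ?thesis using False Lim_transform_eventually by fastforce
qed

subsection \<open>Smooth functions on subsets\<close>

lemma has_derivative_within_transform_open:
  assumes "(F has_derivative D) (at x within S)" "open U" "x \<in> S \<inter> U" "\<And>y. y \<in> S \<inter> U \<Longrightarrow> F y = f y"
  shows "(f has_derivative D) (at x within S)"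
proof -
  obtain e where "e > 0" "ball x e \<subseteq> U" using assms(2,3) open_contains_ball by blast
  then show ?thesis
    by (intro has_derivative_transform_within[OF assms(1) \<open>e > 0\<close>])
      (use assms(3,4) in \<open>auto simp: dist_commute subset_iff\<close>)
qed

text \<open>A single local extension \<open>F\<close> gives the derivative within \<open>S\<close>
  at all nearby points of \<open>S\<close>, so this derivative inherits continuity from that of
  \<open>F\<close>. Gradients at boundary points are handled in this way.\<close>

lemma smooth_on_differentiable:
  assumes "smooth_on S f" "x \<in> S"
  shows "\<exists>U F. open U \<and> x \<in> U \<and> (\<forall>k. Ck_on k U F) \<and> (\<forall>y\<in>S \<inter> U. F y = f y) \<and>
    (\<forall>y\<in>S \<inter> U. (f has_derivative frechet_derivative F (at y)) (at y within S))"
proof -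
  obtain U F where U: "open U" "x \<in> U" "\<And>k. Ck_on k U F" "\<And>y. y\<in>S \<inter> U \<Longrightarrow> F y = f y"
    using assms unfolding smooth_on_def by metis
  have "(f has_derivative frechet_derivative F (at y)) (at y within S)" if y: "y \<in> S \<inter> U" for y
  proof -
    have "(F has_derivative frechet_derivative F (at y)) (at y within S)"
      using Ck_on_SucE(1)[OF U(3)] y by (auto intro: has_derivative_at_withinI)
    then show ?thesis
      using y by (rule has_derivative_within_transform_open[where f = f, OF _ U(1) _ U(4)])
  qed
  then show ?thesis using U by (intro exI[of _ U] exI[of _ F]) auto
qed

lemma smooth_on_has_derivative:
  assumes "smooth_on S f" "x \<in> S"
  shows "\<exists>D. (f has_derivative D) (at x within S)"
proof -
  obtain U F where "x \<in> U" "\<forall>y\<in>S \<inter> U. (f has_derivative frechet_derivative F (at y)) (at y within S)"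
    using smooth_on_differentiable[OF assms] by (elim exE conjE)
  then have "(f has_derivative frechet_derivative F (at x)) (at x within S)"
    using assms(2) by simp
  then show ?thesis by (intro exI[of _ "frechet_derivative F (at x)"])
qed

lemma smooth_on_continuous_on:
  assumes "smooth_on S f"
  shows "continuous_on S f"
proof (rule continuous_on_eq_continuous_within[THEN iffD2], rule ballI)
  fix x assume x: "x \<in> S"
  show "continuous (at x within S) f"
    using smooth_on_has_derivative[OF assms x] has_derivative_continuous by metis
qed

lemma smooth_on_open_derivative:
  assumes "smooth_on S f" "open S"
  shows "\<And>x. x \<in> S \<Longrightarrow> (f has_derivative frechet_derivative f (at x)) (at x)"
    and "continuous_on S (\<lambda>x. frechet_derivative f (at x) v)"
proof -
  show d: "(f has_derivative frechet_derivative f (at x)) (at x)" if x: "x \<in> S" for x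
  proof -
    obtain D where "(f has_derivative D) (at x within S)"
      using smooth_on_has_derivative[OF assms(1) x] by metis
    then have "f differentiable (at x)"
      using x assms(2) unfolding differentiable_def by (metis at_within_open)
    then show ?thesis using frechet_derivative_works by blast
  qed
  show "continuous_on S (\<lambda>x. frechet_derivative f (at x) v)"
  proof (rule continuous_at_imp_continuous_on, rule ballI)
    fix x assume x: "x \<in> S"
    obtain U F where U: "open U" "x \<in> U" "\<forall>k. Ck_on k U F"
      "\<forall>y\<in>S \<inter> U. (f has_derivative frechet_derivative F (at y)) (at y within S)"
      using smooth_on_differentiable[OF assms(1) x] by (elim exE conjE)
    have eq: "frechet_derivative F (at y) v = frechet_derivative f (at y) v" if "y \<in> S \<inter> U" for y
      using bspec[OF U(4) that] d[of y] that assms(2) by (metis IntE at_within_open has_derivative_unique)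
    have "continuous_on (S \<inter> U) (\<lambda>y. frechet_derivative F (at y) v)"
    proof (rule continuous_on_subset[OF _ Int_lower2])
      have "Ck_on (Suc 0) U F" using U(3) by (rule spec)
      then have "Ck_on 0 U (\<lambda>x. frechet_derivative F (at x) v)" by (rule Ck_on_SucE(2))
      then show "continuous_on U (\<lambda>y. frechet_derivative F (at y) v)" by (simp only: Ck_on.simps)
    qed
    then have "continuous_on (S \<inter> U) (\<lambda>y. frechet_derivative f (at y) v)"
      by (rule continuous_on_cong[THEN iffD1, OF refl, rotated]) (rule eq)
    then show "isCont (\<lambda>x. frechet_derivative f (at x) v) x"
      using x U assms(2) by (simp add: continuous_on_eq_continuous_at open_Int)
  qed
qed

lemma smooth_on_compose_real:
  fixes f :: "'a::real_normed_vector \<Rightarrow> real" and g :: "real \<Rightarrow> real"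
  assumes "smooth_on S f" "\<And>k. Ck_on k UNIV g"
  shows "smooth_on S (\<lambda>x. g (f x))"
  unfolding smooth_on_def
proof
  fix x assume "x \<in> S"
  then obtain U F where U: "open U" "x \<in> U" "\<forall>k. Ck_on k U F" "\<forall>y\<in>S \<inter> U. F y = f y"
    using assms(1) unfolding smooth_on_def by metis
  have "Ck_on k U (\<lambda>x. g (F x))" for k
    by (rule Ck_on_compose[OF U(1) spec[OF U(3)] assms(2)])
  moreover have "\<forall>y\<in>S \<inter> U. g (F y) = g (f y)" using U(4) by simp
  ultimately show "\<exists>U G. open U \<and> x \<in> U \<and> (\<forall>k. Ck_on k U G) \<and> (\<forall>y\<in>S \<inter> U. G y = g (f y))"
    using U(1,2) by (intro exI[of _ U] exI[of _ "\<lambda>x. g (F x)"] conjI allI)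
qed

section \<open>The fundamental lemma of the calculus of variations and integration by parts\<close>

lemma AE_lborel_negligible:
  assumes "negligible N"
  shows "AE x in lborel. x \<notin> N"
proof -
  have "AE x in lebesgue. x \<notin> N"
    using assms by (intro AE_not_in) (simp add: negligible_iff_null_sets)
  then show ?thesis by (simp add: AE_completion_iff)
qed

text \<open>Integrability makes the integrals of both parts finite, so that \<open>enn2real\<close>
  loses nothing.\<close>

lemma integral_zero_nn_integral_eq:
  assumes "integrable M f" "(\<integral>x. f x \<partial>M) = (0::real)"
  shows "(\<integral>\<^sup>+x. ennreal (f x) \<partial>M) = (\<integral>\<^sup>+x. ennreal (- f x) \<partial>M)"
proof -
  have "enn2real (\<integral>\<^sup>+x. ennreal (f x) \<partial>M) = enn2real (\<integral>\<^sup>+x. ennreal (- f x) \<partial>M)"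
    using real_lebesgue_integral_def[OF assms(1)] assms(2) by simp
  moreover have "(\<integral>\<^sup>+x. ennreal (f x) \<partial>M) \<noteq> \<infinity>" "(\<integral>\<^sup>+x. ennreal (- f x) \<partial>M) \<noteq> \<infinity>"
    using assms(1) unfolding real_integrable_def by auto
  ultimately show ?thesis
    by (metis ennreal_enn2real_if infinity_ennreal_def)
qed

text \<open>The positive and negative parts of \<open>f\<close> are densities of measures that agree on the
  generator of boxes.\<close>

lemma box_integral_zero_imp_AE_zero:
  fixes f :: "'a::euclidean_space \<Rightarrow> real"
  assumes int: "integrable lborel f"
    and 0: "\<And>c d. (\<integral>x. indicator (box c d) x * f x \<partial>lborel) = 0"
  shows "AE x in lborel. f x = 0"
proof -
  have [measurable]: "f \<in> borel_measurable borel" using int by auto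
  let ?M = "density lborel (\<lambda>x. ennreal (f x))" and ?N = "density lborel (\<lambda>x. ennreal (- f x))"
  let ?E = "range (\<lambda>(a, b). box a b :: 'a set)"
  have fin: "(\<integral>\<^sup>+x. ennreal (f x) \<partial>lborel) \<noteq> \<infinity>"
    using int unfolding real_integrable_def by auto
  have "?M = ?N"
  proof (rule measure_eqI_generator_eq[where E = ?E and \<Omega> = UNIV
        and A = "\<lambda>n::nat. box (- (real n *\<^sub>R One)) (real n *\<^sub>R One)"])
    show "Int_stable ?E" by (auto simp: Int_stable_def box_Int_box)
    show "?E \<subseteq> Pow UNIV" "sets ?M = sigma_sets UNIV ?E" "sets ?N = sigma_sets UNIV ?E"
      by (simp_all add: borel_eq_box)
    show "range (\<lambda>n::nat. box (- (real n *\<^sub>R One)) (real n *\<^sub>R One) :: 'a set) \<subseteq> ?E"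
      "(\<Union>n::nat. box (- (real n *\<^sub>R One)) (real n *\<^sub>R One) :: 'a set) = UNIV"
      unfolding UN_box_eq_UNIV by auto
    fix n :: nat
    have "emeasure ?M (box (- (real n *\<^sub>R One)) (real n *\<^sub>R One)) \<le> emeasure ?M UNIV"
      by (rule emeasure_mono) auto
    also have "\<dots> < \<infinity>" using fin by (simp add: emeasure_density less_top)
    finally show "emeasure ?M (box (- (real n *\<^sub>R One)) (real n *\<^sub>R One)) \<noteq> \<infinity>" by simp
  next
    fix X assume "X \<in> ?E"
    then obtain c d where X: "X = box c d" by auto
    have i: "integrable lborel (\<lambda>x. indicator (box c d) x * f x)"
      using integrable_mult_indicator[OF _ int, of "box c d"] by simp
    have "emeasure ?M X = (\<integral>\<^sup>+x. ennreal (indicator (box c d) x * f x) \<partial>lborel)"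
      unfolding X by (subst emeasure_density) (auto intro!: nn_integral_cong split: split_indicator)
    also have "\<dots> = (\<integral>\<^sup>+x. ennreal (- (indicator (box c d) x * f x)) \<partial>lborel)"
      by (rule integral_zero_nn_integral_eq[OF i 0])
    also have "\<dots> = emeasure ?N X"
      unfolding X by (subst emeasure_density) (auto intro!: nn_integral_cong split: split_indicator)
    finally show "emeasure ?M X = emeasure ?N X" .
  qed
  then have "AE x in lborel. ennreal (f x) = ennreal (- f x)"
    by (intro sigma_finite_measure.density_unique[OF sigma_finite_lborel]) auto
  then show ?thesis
  proof eventually_elim
    case (elim x)
    show ?case
    proof (rule ccontr)
      assume "f x \<noteq> 0"
      then consider "f x > 0" | "f x < 0" by linarith
      then show False using elim by cases (auto simp: ennreal_neg ennreal_eq_0_iff dest: sym)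
    qed
  qed
qed

text \<open>A product of steep one-dimensional cutoffs in the signed distances to the faces. It
  vanishes off the open box, takes values between 0 and 1, and tends to the indicator of the box as
  \<open>j\<close> grows.\<close>

definition box_bump :: "real^'n \<Rightarrow> real^'n \<Rightarrow> nat \<Rightarrow> real^'n \<Rightarrow> real" where
  "box_bump a b j x =
     (\<Prod>i\<in>UNIV. flat_exp 0 (real j * (x $ i - a $ i)) * flat_exp 0 (real j * (b $ i - x $ i)))"

lemma Ck_on_box_bump:
  fixes a b :: "real^'n"
  shows "Ck_on k UNIV (box_bump a b j)"
proof -
  have *: "Ck_on k UNIV (\<lambda>x::real^'n. real j * (x $ i - a $ i))"
    "Ck_on k UNIV (\<lambda>x::real^'n. real j * (b $ i - x $ i))" for i
  proof -
    have l: "bounded_linear (\<lambda>x::real^'n. real j * x $ i)" "bounded_linear (\<lambda>x::real^'n. - real j * x $ i)"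
      by (intro bounded_linear_const_mult bounded_linear_vec_nth)+
    show "Ck_on k UNIV (\<lambda>x::real^'n. real j * (x $ i - a $ i))"
      using Ck_on_add[OF open_UNIV Ck_on_bounded_linear[OF l(1) open_UNIV]
          Ck_on_const[where c = "- real j * a $ i"]] by (simp add: algebra_simps)
    show "Ck_on k UNIV (\<lambda>x::real^'n. real j * (b $ i - x $ i))"
      using Ck_on_add[OF open_UNIV Ck_on_bounded_linear[OF l(2) open_UNIV]
          Ck_on_const[where c = "real j * b $ i"]] by (simp add: algebra_simps)
  qed
  have "Ck_on k UNIV (\<lambda>x. \<Prod>i\<in>UNIV. flat_exp 0 (real j * (x $ i - a $ i)) * flat_exp 0 (real j * (b $ i - x $ i)))"
    by (intro Ck_on_prod Ck_on_mult Ck_on_compose[OF _ _ Ck_on_flat_exp] * open_UNIV)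
  then show ?thesis by (simp add: box_bump_def[abs_def])
qed

lemma box_bump_bounds: "0 \<le> box_bump a b j x" "box_bump a b j x \<le> 1"
  unfolding box_bump_def
  by (auto intro!: prod_nonneg prod_le_1 mult_le_one simp: flat_exp_0_bounds)

lemma box_bump_tendsto: "(\<lambda>j. box_bump a b j x) \<longlonglongrightarrow> indicator (box a b) x"
proof -
  have "(\<lambda>j. box_bump a b j x) \<longlonglongrightarrow>
      (\<Prod>i\<in>UNIV. (if x $ i - a $ i \<le> 0 then 0 else 1) * (if b $ i - x $ i \<le> 0 then 0 else 1))"
    unfolding box_bump_def by (intro tendsto_prod tendsto_mult flat_exp_0_tendsto)
  also have "(\<Prod>i\<in>UNIV. (if x $ i - a $ i \<le> 0 then 0 else 1) * (if b $ i - x $ i \<le> 0 then 0 else 1))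
    = (indicator (box a b) x :: real)"
  proof (cases "x \<in> box a b")
    case True
    then show ?thesis by (auto simp: mem_box_cart not_le intro!: prod.neutral)
  next
    case False
    then obtain i where "\<not> (a $ i < x $ i \<and> x $ i < b $ i)" by (auto simp: mem_box_cart)
    then show ?thesis using False by (subst prod_zero) (auto intro!: exI[of _ i] bexI[of _ i])
  qed
  finally show ?thesis .
qed

lemma box_bump_outside: "x \<notin> box a b \<Longrightarrow> box_bump a b j x = 0"
proof -
  assume "x \<notin> box a b"
  then obtain i where "\<not> (a $ i < x $ i \<and> x $ i < b $ i)" by (auto simp: mem_box_cart)
  then show ?thesis unfolding box_bump_def
    by (intro prod_zero bexI[of _ i]) (auto simp: flat_exp_def mult_le_0_iff)
qed

lemma Ck_on_imp_smooth_on_UNIV: "(\<And>k. Ck_on k UNIV f) \<Longrightarrow> smooth_on UNIV f"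
  unfolding smooth_on_def by (intro ballI exI[of _ UNIV] exI[of _ f]) simp

text \<open>This is the fundamental lemma of the calculus of variations. Bumps converge boundedly to
  box indicators, so the integrals over all boxes whose closure lies in \<open>V\<close> vanish;
  countably many closed boxes inside \<open>V\<close> cover it.\<close>

lemma test_function_integrals_zero_imp_AE_zero:
  fixes h :: "real^'n \<Rightarrow> real"
  assumes V: "open V"
    and int: "\<And>K. compact K \<Longrightarrow> K \<subseteq> V \<Longrightarrow> set_integrable lborel K h"
    and 0: "\<And>\<psi>. test_function V \<psi> \<Longrightarrow> (LINT x:V|lborel. h x * \<psi> x) = 0"
  shows "AE x in lborel. x \<in> V \<longrightarrow> h x = 0"
proof -
  have box0: "(\<integral>x. indicator (box a b) x * h x \<partial>lborel) = 0" if ab: "cbox a b \<subseteq> V" for a b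
  proof -
    \<comment> \<open>\<open>h\<close> is only locally integrable, so it is cut off to the closed
      box before anything is integrated.\<close>
    let ?g = "\<lambda>x. indicator (cbox a b) x * h x"
    have gi: "integrable lborel ?g"
      using int[OF compact_cbox ab] unfolding set_integrable_def by simp
    then have [measurable]: "?g \<in> borel_measurable borel" by simp
    have [measurable]: "box_bump a b j \<in> borel_measurable borel" for j
      using Ck_on_box_bump[of 0 a b j] by (simp add: borel_measurable_continuous_onI)
    have "(\<lambda>j. \<integral>x. ?g x * box_bump a b j x \<partial>lborel) \<longlonglongrightarrow> (\<integral>x. ?g x * indicator (box a b) x \<partial>lborel)"
    proof (rule integral_dominated_convergence[where w = "\<lambda>x. norm (?g x)"])
      show "AE x in lborel. (\<lambda>j. ?g x * box_bump a b j x) \<longlonglongrightarrow> ?g x * indicator (box a b) x"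
        by (intro AE_I2 tendsto_intros box_bump_tendsto)
      show "AE x in lborel. norm (?g x * box_bump a b j x) \<le> norm (?g x)" for j
        using box_bump_bounds[of a b j] by (intro AE_I2) (auto simp: abs_mult mult_left_le)
      show "integrable lborel (\<lambda>x. norm (?g x))" using gi by (rule integrable_norm)
    qed auto
    moreover have "(\<integral>x. ?g x * box_bump a b j x \<partial>lborel) = 0" for j
    proof -
      have "test_function V (box_bump a b j)"
        unfolding test_function_def
        using ab box_bump_outside[of _ a b j] box_subset_cbox[of a b]
        by (auto intro!: Ck_on_imp_smooth_on_UNIV Ck_on_box_bump exI[of _ "cbox a b"])
      from 0[OF this] have "(\<integral>x. indicator V x * (h x * box_bump a b j x) \<partial>lborel) = 0"
        by (simp add: set_lebesgue_integral_def)
      also have "(\<lambda>x. indicator V x * (h x * box_bump a b j x)) = (\<lambda>x. ?g x * box_bump a b j x)"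
        using ab box_bump_outside[of _ a b j] box_subset_cbox[of a b]
        by (auto simp: fun_eq_iff split: split_indicator)
      finally show ?thesis .
    qed
    ultimately have "(\<integral>x. ?g x * indicator (box a b) x \<partial>lborel) = 0"
      by (simp add: LIMSEQ_const_iff)
    also have "(\<lambda>x. ?g x * indicator (box a b) x) = (\<lambda>x. indicator (box a b) x * h x)"
      using box_subset_cbox[of a b] by (auto simp: fun_eq_iff split: split_indicator)
    finally show ?thesis .
  qed
  have cbox0: "AE x in lborel. x \<in> cbox a b \<longrightarrow> h x = 0" if ab: "cbox a b \<subseteq> V" for a b
  proof -
    let ?g = "\<lambda>x. indicator (cbox a b) x * h x"
    have gi: "integrable lborel ?g"
      using int[OF compact_cbox ab] unfolding set_integrable_def by simp
    then have [measurable]: "?g \<in> borel_measurable borel" by simp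
    have "(\<integral>x. indicator (box c d) x * ?g x \<partial>lborel) = 0" for c d
    proof -
      \<comment> \<open>The intersection of two open boxes is an open box, to which the first claim
        applies; passing from \<open>cbox a b\<close> to \<open>box a b\<close> changes only a null
        set.\<close>
      obtain a' b' where ab': "box a b \<inter> box c d = box a' b'" unfolding box_Int_box by blast
      have "(\<integral>x. indicator (box c d) x * ?g x \<partial>lborel) = (\<integral>x. indicator (box a' b') x * ?g x \<partial>lborel)"
      proof (rule integral_cong_AE)
        show "AE x in lborel. indicator (box c d) x * ?g x = indicator (box a' b') x * ?g x"
          using AE_lborel_negligible[OF negligible_frontier_interval[of a b]]
          by eventually_elim (auto simp: ab'[symmetric] split: split_indicator)
      qed auto
      also have "(\<lambda>x. indicator (box a' b') x * ?g x) = (\<lambda>x. indicator (box a' b') x * h x)"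
        using box_subset_cbox[of a b] by (auto simp: ab'[symmetric] fun_eq_iff split: split_indicator)
      also have "(\<integral>x. indicator (box a' b') x * h x \<partial>lborel) = 0"
      proof (cases "box a' b' = {}")
        case False
        have "closure (box a' b') \<subseteq> closure (box a b)" using ab' by (intro closure_mono) auto
        also have "\<dots> \<subseteq> cbox a b" by (intro closure_minimal box_subset_cbox closed_cbox)
        finally have "cbox a' b' \<subseteq> V" using False ab by (simp add: closure_box)
        then show ?thesis by (rule box0)
      qed simp
      finally show ?thesis .
    qed
    from box_integral_zero_imp_AE_zero[OF gi this] show ?thesis
      by eventually_elim (auto split: split_indicator)
  qed
  obtain D where D: "countable D" "D \<subseteq> Pow V" "\<And>X. X \<in> D \<Longrightarrow> \<exists>a b. X = cbox a b" "\<Union>D = V"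
    using open_countable_Union_open_cbox[OF V] by metis
  have "AE x in lborel. \<forall>X\<in>D. x \<in> X \<longrightarrow> h x = 0"
    unfolding AE_ball_countable[OF D(1)]
  proof
    fix X assume "X \<in> D"
    then obtain a b where "X = cbox a b" "cbox a b \<subseteq> V" using D by blast
    then show "AE x in lborel. x \<in> X \<longrightarrow> h x = 0" using cbox0 by simp
  qed
  then show ?thesis by eventually_elim (use D(4) in blast)
qed

text \<open>The difference quotients have integral zero by translation invariance, which avoids Fubini.\<close>

lemma integral_directional_derivative_zero:
  fixes G :: "'a::euclidean_space \<Rightarrow> real"
  assumes d: "\<And>x. (G has_derivative G' x) (at x)"
    and cont: "continuous_on UNIV (\<lambda>x. G' x v)"
    and K: "compact K" "\<And>x. x \<notin> K \<Longrightarrow> G x = 0"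
  shows "(\<integral>x. G' x v \<partial>lborel) = 0"
proof -
  have Gc: "continuous_on UNIV G"
    using d by (auto intro!: continuous_at_imp_continuous_on has_derivative_continuous)
  then have [measurable]: "G \<in> borel_measurable borel" by (rule borel_measurable_continuous_onI)
  have [measurable]: "(\<lambda>x. G' x v) \<in> borel_measurable borel"
    using cont by (rule borel_measurable_continuous_onI)
  have Gi: "integrable lborel G"
  proof -
    have "integrable lborel (\<lambda>x. indicator K x *\<^sub>R G x)"
      by (rule borel_integrable_compact[OF K(1)]) (use Gc in \<open>auto intro: continuous_on_subset\<close>)
    also have "(\<lambda>x. indicator K x *\<^sub>R G x) = G" using K(2) by (auto simp: fun_eq_iff indicator_def)
    finally show ?thesis .
  qed
  have G'0: "G' x v = 0" if "x \<notin> K" for x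
  proof -
    have "((\<lambda>_. 0) has_derivative (\<lambda>_. 0)) (at x)" by simp
    then have "(G has_derivative (\<lambda>_. 0)) (at x)"
      by (rule has_derivative_transform_within_open[where s = "- K"])
        (use that K in \<open>auto intro: compact_imp_closed\<close>)
    then show ?thesis using has_derivative_unique[OF d[of x]] by metis
  qed
  obtain B where B: "\<And>x. \<bar>G' x v\<bar> \<le> B" "B \<ge> 0"
  proof -
    obtain B where B: "B \<ge> 0" "\<And>x. x \<in> K \<Longrightarrow> norm (G' x v) \<le> B"
      using continuous_on_compact_bound[OF K(1) continuous_on_subset[OF cont subset_UNIV]] by metis
    have "\<bar>G' x v\<bar> \<le> B" for x using B G'0[of x] by (cases "x \<in> K") auto
    then show ?thesis using that B(1) by blast
  qed
  have line: "((\<lambda>t. G (x + t *\<^sub>R v)) has_real_derivative G' (x + t *\<^sub>R v) v) (at t)" for x t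
  proof -
    interpret bounded_linear "G' (x + t *\<^sub>R v)" using d by (rule has_derivative_bounded_linear)
    have "((\<lambda>t. x + t *\<^sub>R v) has_derivative (\<lambda>h. h *\<^sub>R v)) (at t)"
      by (auto intro!: derivative_eq_intros)
    from has_derivative_compose[OF this d]
    have "((\<lambda>t. G (x + t *\<^sub>R v)) has_derivative (\<lambda>h. G' (x + t *\<^sub>R v) (h *\<^sub>R v))) (at t)" .
    then show ?thesis by (simp add: has_field_derivative_def scaleR mult.commute[of _ "G' _ _"])
  qed
  \<comment> \<open>Difference quotients with step \<open>1 / (j + 1)\<close>, which is nonzero and
    at most 1.\<close>
  define q where "q j x = real (Suc j) * (G (x + (1 / real (Suc j)) *\<^sub>R v) - G x)" for j x
  obtain R where R: "\<And>x. x \<in> K \<Longrightarrow> norm x \<le> R"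
    using compact_imp_bounded[OF K(1)] bounded_iff by metis
  have "(\<lambda>j. \<integral>x. q j x \<partial>lborel) \<longlonglongrightarrow> (\<integral>x. G' x v \<partial>lborel)"
  \<comment> \<open>A step of length at most 1 moves the support by at most \<open>norm v\<close>,
    so all quotients vanish off the ball of radius \<open>R + norm v\<close>; the mean value theorem
    bounds them by \<open>B\<close>.\<close>
  proof (rule integral_dominated_convergence[where w = "\<lambda>x. indicator (cball 0 (R + norm v)) x *\<^sub>R B"])
    show "integrable lborel (\<lambda>x. indicator (cball 0 (R + norm v)) x *\<^sub>R B)"
      by (rule borel_integrable_compact) auto
    show "AE x in lborel. (\<lambda>j. q j x) \<longlonglongrightarrow> G' x v"
    proof (rule AE_I2)
      fix x
      have "((\<lambda>h. (G (x + h *\<^sub>R v) - G x) / h) \<longlongrightarrow> G' x v) (at 0)"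
        using line[of x 0] by (simp add: DERIV_def)
      moreover have "filterlim (\<lambda>j. 1 / real (Suc j)) (at 0) sequentially"
        unfolding filterlim_at using LIMSEQ_inverse_real_of_nat by (auto simp: field_simps)
      ultimately have "(\<lambda>j. (G (x + (1 / real (Suc j)) *\<^sub>R v) - G x) / (1 / real (Suc j))) \<longlonglongrightarrow> G' x v"
        by (rule filterlim_compose)
      then show "(\<lambda>j. q j x) \<longlonglongrightarrow> G' x v" by (simp add: q_def mult.commute)
    qed
    show "AE x in lborel. norm (q j x) \<le> indicator (cball 0 (R + norm v)) x *\<^sub>R B" for j
    proof (rule AE_I2)
      fix x
      have "\<exists>z>0. z < 1 / real (Suc j) \<and> G (x + (1 / real (Suc j)) *\<^sub>R v) - G (x + 0 *\<^sub>R v)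
          = (1 / real (Suc j) - 0) * G' (x + z *\<^sub>R v) v"
        by (rule MVT2) (use line in auto)
      then obtain z where "q j x = G' (x + z *\<^sub>R v) v" by (auto simp: q_def)
      then have 1: "norm (q j x) \<le> B" using B(1) by simp
      have "q j x = 0" if x: "x \<notin> cball 0 (R + norm v)"
      proof -
        have "norm ((1 / real (Suc j)) *\<^sub>R v) \<le> norm v"
          by (simp add: divide_le_eq algebra_simps)
        then have "norm (x + (1 / real (Suc j)) *\<^sub>R v) > R"
          using norm_triangle_ineq4[of "x + (1 / real (Suc j)) *\<^sub>R v" "(1 / real (Suc j)) *\<^sub>R v"] x
          by (simp only: add_diff_cancel_right' mem_cball_0 not_le)
        moreover have "norm x > R" using x by (simp add: not_le) (smt (verit) norm_ge_zero)
        ultimately have "x \<notin> K" "x + (1 / real (Suc j)) *\<^sub>R v \<notin> K" using R by (meson not_le)+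
        then show ?thesis using K(2) by (simp only: q_def) simp
      qed
      then show "norm (q j x) \<le> indicator (cball 0 (R + norm v)) x *\<^sub>R B"
        using 1 B(2) by (auto split: split_indicator)
    qed
  qed (auto simp: q_def)
  moreover have "(\<integral>x. q j x \<partial>lborel) = 0" for j
  proof -
    let ?c = "(1 / real (Suc j)) *\<^sub>R v"
    have e: "(\<integral>x. G (?c + x) \<partial>lborel) = (\<integral>x. G x \<partial>lborel)"
      using integral_distr[of "(+) ?c" lborel borel G] by (simp add: lborel_distr_plus)
    have i: "integrable lborel (\<lambda>x. G (?c + x))"
      using Gi integrable_distr_eq[of "(+) ?c" lborel borel G] by (simp add: lborel_distr_plus)
    show ?thesis unfolding q_def using e i Gi by (simp add: add.commute)
  qed
  ultimately show ?thesis by (simp add: LIMSEQ_const_iff)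
qed

lemma test_function_support:
  assumes "test_function V \<psi>"
  obtains K where "compact K" "K \<subseteq> V" "\<And>x. x \<notin> K \<Longrightarrow> \<psi> x = 0"
    "\<And>x. (\<psi> has_derivative frechet_derivative \<psi> (at x)) (at x)"
    "\<And>v. continuous_on UNIV (\<lambda>x. frechet_derivative \<psi> (at x) v)"
    "continuous_on UNIV \<psi>"
    "\<And>x v. x \<notin> K \<Longrightarrow> frechet_derivative \<psi> (at x) v = 0"
proof -
  obtain K where K: "compact K" "K \<subseteq> V" "\<forall>x. x \<notin> K \<longrightarrow> \<psi> x = 0" and s: "smooth_on UNIV \<psi>"
    using assms unfolding test_function_def by blast
  note d = smooth_on_open_derivative[OF s open_UNIV]
  have "frechet_derivative \<psi> (at x) v = 0" if "x \<notin> K" for x v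
  proof -
    have "((\<lambda>_. 0) has_derivative (\<lambda>_. 0)) (at x)" by simp
    then have "(\<psi> has_derivative (\<lambda>_. 0)) (at x)"
      by (rule has_derivative_transform_within_open[where s = "- K"])
        (use that K in \<open>auto intro: compact_imp_closed\<close>)
    then show ?thesis using frechet_derivative_at by metis
  qed
  then show ?thesis using that K d smooth_on_continuous_on[OF s] by simp
qed

text \<open>Extended by zero, the product of \<open>F\<close> and \<open>\<psi>\<close> is
  differentiable everywhere, because \<open>V\<close> and the complement of the support cover the
  space. The integral of its directional derivative vanishes, and the product rule splits that
  integral.\<close>

lemma integration_by_parts_test_function:
  fixes F :: "real^'n \<Rightarrow> real"
  assumes V: "open V" and d: "\<And>x. x \<in> V \<Longrightarrow> (F has_derivative F' x) (at x)"
    and cont: "continuous_on V (\<lambda>x. F' x v)" and \<psi>: "test_function V \<psi>"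
  shows "(LINT x:V|lborel. F x * frechet_derivative \<psi> (at x) v) = - (LINT x:V|lborel. F' x v * \<psi> x)"
proof -
  from \<psi> obtain K where K: "compact K" "K \<subseteq> V" "\<And>x. x \<notin> K \<Longrightarrow> \<psi> x = 0"
    and \<psi>d: "\<And>x. (\<psi> has_derivative frechet_derivative \<psi> (at x)) (at x)"
    and \<psi>c: "continuous_on UNIV (\<lambda>x. frechet_derivative \<psi> (at x) v)" "continuous_on UNIV \<psi>"
    and \<psi>0: "\<And>x. x \<notin> K \<Longrightarrow> frechet_derivative \<psi> (at x) v = 0"
    using test_function_support by metis
  have Fc: "continuous_on V F"
    using d by (auto intro!: continuous_at_imp_continuous_on has_derivative_continuous)
  define G where "G x = (if x \<in> V then F x * \<psi> x else 0)" for x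
  define G' where "G' x w = (if x \<in> V then F x * frechet_derivative \<psi> (at x) w + F' x w * \<psi> x else 0)" for x w
  have Gd: "(G has_derivative G' x) (at x)" for x
  proof (cases "x \<in> V")
    case True
    have "((\<lambda>x. F x * \<psi> x) has_derivative G' x) (at x)"
      using has_derivative_mult[OF d[OF True] \<psi>d] True by (simp add: G'_def[abs_def])
    then show ?thesis
      by (rule has_derivative_transform_within_open[OF _ V True]) (simp add: G_def)
  next
    case False
    have "((\<lambda>_. 0) has_derivative G' x) (at x)" using False by (simp add: G'_def[abs_def])
    then show ?thesis
      by (rule has_derivative_transform_within_open[where s = "- K"])
        (use False K in \<open>auto intro: compact_imp_closed simp: G_def\<close>)
  qed
  have "continuous_on (V \<union> - K) (\<lambda>x. G' x v)"
  proof (rule continuous_on_open_Un[OF V])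
    show "open (- K)" using K(1) by (simp add: compact_imp_closed open_Compl)
    have "continuous_on V (\<lambda>x. F x * frechet_derivative \<psi> (at x) v + F' x v * \<psi> x)"
      by (intro continuous_intros Fc cont continuous_on_subset[OF \<psi>c(1)] continuous_on_subset[OF \<psi>c(2)]) auto
    then show "continuous_on V (\<lambda>x. G' x v)"
      by (rule continuous_on_cong[THEN iffD1, OF refl, rotated]) (simp add: G'_def)
    have "continuous_on (- K) (\<lambda>x. 0::real)" by simp
    then show "continuous_on (- K) (\<lambda>x. G' x v)"
      by (rule continuous_on_cong[THEN iffD1, OF refl, rotated]) (auto simp: G'_def K(3) \<psi>0)
  qed
  moreover have "V \<union> - K = UNIV" using K(2) by blast
  ultimately have G'c: "continuous_on UNIV (\<lambda>x. G' x v)" by (simp only:)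
  have 0: "(\<integral>x. G' x v \<partial>lborel) = 0"
    by (rule integral_directional_derivative_zero[OF Gd G'c K(1)]) (simp add: G_def K(3))
  have i1: "integrable lborel (\<lambda>x. indicator K x *\<^sub>R (F x * frechet_derivative \<psi> (at x) v))"
    by (intro borel_integrable_compact K(1) continuous_intros continuous_on_subset[OF Fc]
        continuous_on_subset[OF \<psi>c(1)]) (use K(2) in auto)
  have i2: "integrable lborel (\<lambda>x. indicator K x *\<^sub>R (F' x v * \<psi> x))"
    by (intro borel_integrable_compact K(1) continuous_intros continuous_on_subset[OF cont]
        continuous_on_subset[OF \<psi>c(2)]) (use K(2) in auto)
  have e1: "(\<lambda>x. indicator V x *\<^sub>R (F x * frechet_derivative \<psi> (at x) v))
      = (\<lambda>x. indicator K x *\<^sub>R (F x * frechet_derivative \<psi> (at x) v))"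
    and e2: "(\<lambda>x. indicator V x *\<^sub>R (F' x v * \<psi> x)) = (\<lambda>x. indicator K x *\<^sub>R (F' x v * \<psi> x))"
    using K \<psi>0 by (auto simp: fun_eq_iff split: split_indicator)
  have "(\<lambda>x. G' x v) = (\<lambda>x. indicator K x *\<^sub>R (F x * frechet_derivative \<psi> (at x) v)
      + indicator K x *\<^sub>R (F' x v * \<psi> x))"
    using K \<psi>0 by (auto simp: fun_eq_iff G'_def split: split_indicator)
  with 0 have "(\<integral>x. indicator K x *\<^sub>R (F x * frechet_derivative \<psi> (at x) v) \<partial>lborel)
      + (\<integral>x. indicator K x *\<^sub>R (F' x v * \<psi> x) \<partial>lborel) = 0"
    using Bochner_Integration.integral_add[OF i1 i2] by simp
  then show ?thesis unfolding set_lebesgue_integral_def e1 e2 by linarith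
qed

section \<open>Smooth approximation with bounded derivatives\<close>

lemma real_antiderivative:
  fixes f :: "real \<Rightarrow> real"
  assumes "continuous_on UNIV f"
  shows "\<exists>F. F 0 = 0 \<and> (\<forall>x. (F has_real_derivative f x) (at x))"
proof -
  let ?F = "\<lambda>u. LBINT y=ereal 0..ereal u. f y"
  have "(?F has_real_derivative f x) (at x)" for x
  proof -
  \<comment> \<open>The interval contains both 0 and \<open>x\<close> in its interior, which covers
    negative arguments and yields a two-sided derivative.\<close>
  have "((\<lambda>u. LBINT y=0..u. f y) has_vector_derivative f x) (at x within {- \<bar>x\<bar> - 1..\<bar>x\<bar> + 1})"
    using interval_integral_FTC2[of "- \<bar>x\<bar> - 1" 0 "\<bar>x\<bar> + 1" f x] continuous_on_subset[OF assms]
    by (simp add: zero_ereal_def)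
  moreover have "at x within {- \<bar>x\<bar> - 1..\<bar>x\<bar> + 1} = at x"
    by (rule at_within_interior) (auto simp: interior_atLeastAtMost_real)
  ultimately show ?thesis
    by (simp add: has_real_derivative_iff_has_vector_derivative zero_ereal_def)
  qed
  then show ?thesis by (intro exI[of _ ?F]) simp
qed

text \<open>The substitution \<open>y = cos (pi x / C)\<close> turns Weierstrass approximations on \<open>[-1,1]\<close>
  into smooth functions that are bounded on the whole line.\<close>

lemma smooth_bounded_derivative_approx:
  fixes g :: "real \<Rightarrow> real"
  assumes C: "C > 0" and g: "continuous_on {0..C} g"
  shows "\<exists>\<theta> L. continuous_on UNIV \<theta> \<and> (\<forall>x. \<bar>\<theta> x\<bar> \<le> L) \<and> (\<forall>x. \<bar>x\<bar> \<le> C \<longrightarrow> \<theta> x = g \<bar>x\<bar>) \<and>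
    (\<forall>\<epsilon>>0. \<exists>\<phi> \<phi>'. (\<forall>k. Ck_on k UNIV \<phi>) \<and> \<phi> 0 = (0::real) \<and>
       (\<forall>x. (\<phi> has_real_derivative \<phi>' x) (at x)) \<and> continuous_on UNIV \<phi>' \<and> (\<forall>x. \<bar>\<phi>' x - \<theta> x\<bar> < \<epsilon>))"
proof -
  define h where "h y = g (C / pi * arccos y)" for y
  have hc: "continuous_on {-1..1} h"
    unfolding h_def
  proof (rule continuous_on_compose2[OF g])
    show "continuous_on {- 1..1} (\<lambda>x. C / pi * arccos x)"
      by (intro continuous_intros continuous_on_arccos) auto
    show "(\<lambda>x. C / pi * arccos x) ` {- 1..1} \<subseteq> {0..C}"
      using C by (auto simp: arccos_lbound arccos_ubound field_simps)
  qed
  obtain L where "\<And>y. y \<in> {-1..1} \<Longrightarrow> norm (h y) \<le> L"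
    using continuous_on_compact_bound[OF compact_Icc hc] by metis
  then have L: "\<bar>h y\<bar> \<le> L" if "y \<in> {-1..1}" for y using that by simp
  define c where "c x = cos (pi / C * x)" for x
  have c: "c x \<in> {-1..1}" for x by (simp add: c_def)
  have ck: "Ck_on k UNIV c" for k
    unfolding c_def
    by (rule Ck_on_compose[OF open_UNIV
          Ck_on_bounded_linear[OF bounded_linear_mult_right open_UNIV] Ck_on_sin_cos(2)])
  have cc: "continuous_on UNIV c" using ck[of 0] by simp
  \<comment> \<open>\<open>cos\<close> is even and \<open>arccos\<close> inverts it on
    \<open>[0, pi]\<close>; this explains the absolute value and the restriction to
    \<open>\<bar>x\<bar> \<le> C\<close>.\<close>
  have \<theta>: "h (c x) = g \<bar>x\<bar>" if "\<bar>x\<bar> \<le> C" for x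
  proof -
    have "c x = cos (pi / C * \<bar>x\<bar>)" by (simp add: c_def abs_if)
    then have "arccos (c x) = pi / C * \<bar>x\<bar>"
      using that C by (simp add: arccos_cos field_simps)
    then show ?thesis using C by (simp add: h_def)
  qed
  show ?thesis
  proof (rule exI[of _ "\<lambda>x. h (c x)"], rule exI[of _ L], intro conjI allI impI)
    show "continuous_on UNIV (\<lambda>x. h (c x))"
      by (rule continuous_on_compose2[OF hc cc]) (use c in auto)
    show "\<bar>h (c x)\<bar> \<le> L" for x using L c by blast
    show "h (c x) = g \<bar>x\<bar>" if "\<bar>x\<bar> \<le> C" for x using \<theta> that .
    fix \<epsilon> :: real assume "\<epsilon> > 0"
    then obtain P where P: "real_polynomial_function P" "\<And>y. y \<in> {-1..1} \<Longrightarrow> \<bar>h y - P y\<bar> < \<epsilon>"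
      using Stone_Weierstrass_real_polynomial_function[OF compact_Icc hc] by metis
    have Pk: "Ck_on k UNIV (\<lambda>x. P (c x))" for k
      by (rule Ck_on_compose[OF open_UNIV ck Ck_on_real_polynomial_function[OF P(1)]])
    then have Pc: "continuous_on UNIV (\<lambda>x. P (c x))" by (metis Ck_on.simps(1))
    \<comment> \<open>The derivative is approximated first and then integrated from 0. The
      normalisation \<open>\<phi> 0 = 0\<close> is what makes composition with \<open>\<phi>\<close>
      preserve compact supports.\<close>
    then obtain \<phi> where \<phi>: "\<phi> 0 = 0" "\<And>x. (\<phi> has_real_derivative P (c x)) (at x)"
      using real_antiderivative by metis
    have "Ck_on k UNIV \<phi>" for k
      using Ck_on_SucD[OF Ck_on_Suc_realI[OF \<phi>(2) Pk]] .
    then show "\<exists>\<phi> \<phi>'. (\<forall>k. Ck_on k UNIV \<phi>) \<and> \<phi> 0 = (0::real) \<and>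
       (\<forall>x. (\<phi> has_real_derivative \<phi>' x) (at x)) \<and> continuous_on UNIV \<phi>' \<and> (\<forall>x. \<bar>\<phi>' x - h (c x)\<bar> < \<epsilon>)"
      using \<phi> Pc P(2)[OF c]
      by (intro exI[of _ \<phi>] exI[of _ "\<lambda>x. P (c x)"] conjI allI) (simp_all add: abs_minus_commute)
  qed
qed

subsection \<open>Relatively open subsets of a half-space\<close>

definition half_open :: "(real^'n) set \<Rightarrow> bool" where
  "half_open S \<longleftrightarrow> open S \<or> (\<exists>i. openin (top_of_set {x. 0 \<le> x $ i}) S)"

lemma half_openE:
  assumes "half_open S"
  obtains U where "open U" "S = U" | U i where "open U" "S = U \<inter> {x. 0 \<le> x $ i}"
  using assms unfolding half_open_def openin_open by (metis Int_commute)

lemma half_open_subset: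
  assumes "half_open S" "openin (top_of_set S) T"
  shows "half_open T"
proof -
  obtain W where W: "open W" "T = S \<inter> W" using assms(2) by (auto simp: openin_open)
  from assms(1) show ?thesis
  proof (cases rule: half_openE)
    case (1 U)
    then show ?thesis using W by (simp add: half_open_def open_Int)
  next
    case (2 U i)
    then have "T = {x. 0 \<le> x $ i} \<inter> (U \<inter> W)" using W by blast
    moreover have "open (U \<inter> W)" using 2 W by (intro open_Int)
    ultimately have "openin (top_of_set {x. 0 \<le> x $ i}) T" by (simp add: openin_open_Int)
    then show ?thesis unfolding half_open_def by (intro disjI2 exI[of _ i])
  qed
qed

lemma half_open_borel: "half_open S \<Longrightarrow> S \<in> sets borel"
proof (cases rule: half_openE)
  fix U i assume "open U" "S = U \<inter> {x. 0 \<le> x $ i}"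
  moreover have "closed {x::real^'a. 0 \<le> x $ i}"
    by (intro closed_Collect_le continuous_intros)
  ultimately show ?thesis by simp
qed auto

text \<open>Points that are not interior lie on the hyperplane bounding the half-space. Weak
  gradients are tested in the interior of a chart only, and this extends almost-everywhere
  statements to the full chart.\<close>

lemma negligible_half_open_boundary:
  assumes "half_open (S :: (real^'n) set)"
  shows "negligible (S - interior S)"
  using assms
proof (cases rule: half_openE)
  case (1 U)
  then show ?thesis by (simp add: interior_open)
next
  case (2 U i)
  have "open (U \<inter> {x. 0 < x $ i})"
    using 2 by (intro open_Int open_Collect_less continuous_intros) auto
  then have "U \<inter> {x. 0 < x $ i} \<subseteq> interior S"
    using 2 by (intro interior_maximal) auto
  then have "S - interior S \<subseteq> {x. x \<bullet> axis i 1 = 0}" using 2 by (force simp: inner_axis)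
  moreover have "negligible {x :: real^'n. x \<bullet> axis i 1 = 0}"
    by (rule negligible_standard_hyperplane) simp
  ultimately show ?thesis by (rule negligible_subset[rotated])
qed

text \<open>From a point of a half-space one can move a little in every positive coordinate
  direction without leaving it. Along these directions a derivative within \<open>S\<close> is
  determined, and they span the space.\<close>

lemma has_derivative_unique_half_open:
  fixes f :: "real^'n \<Rightarrow> 'b::real_normed_vector"
  assumes S: "half_open S" "x \<in> S"
    and d: "(f has_derivative A) (at x within S)" "(f has_derivative B) (at x within S)"
  shows "A = B"
proof (rule frechet_derivative_unique_within[OF d])
  fix i :: "real^'n" and e :: real
  assume i: "i \<in> Basis" and e: "e > 0"
  then obtain l where l: "i = axis l 1" by (auto simp: Basis_vec_def)
  obtain U where U: "open U" "x \<in> U" "\<And>t. t > 0 \<Longrightarrow> x + t *\<^sub>R i \<in> U \<Longrightarrow> x + t *\<^sub>R i \<in> S"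
    using S(1)
  proof (cases rule: half_openE)
    case (1 U)
    then show ?thesis using that S(2) by blast
  next
    case (2 U k)
    have "x + t *\<^sub>R i \<in> S" if "t > 0" "x + t *\<^sub>R i \<in> U" for t
      using that 2 S(2) by (auto simp: l axis_def)
    then show ?thesis using that[of U] 2 S(2) by blast
  qed
  then obtain r where r: "r > 0" "ball x r \<subseteq> U" using open_contains_ball by blast
  define t where "t = min r e / 2"
  have t: "t > 0" "t < r" "t < e" using r(1) e by (auto simp: t_def min_def)
  have "x + t *\<^sub>R i \<in> ball x r" using t i by (simp add: dist_norm)
  then have "x + t *\<^sub>R i \<in> S" using U(3)[OF t(1)] r(2) by blast
  then show "\<exists>t. 0 < \<bar>t\<bar> \<and> \<bar>t\<bar> < e \<and> x + t *\<^sub>R i \<in> S"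
    using t by (intro exI[of _ t]) auto
qed

subsection \<open>Positive definite matrices\<close>

definition posdef :: "real^'n^'n \<Rightarrow> bool" where
  "posdef G \<longleftrightarrow> transpose G = G \<and> (\<forall>v. v \<noteq> 0 \<longrightarrow> 0 < v \<bullet> (G *v v))"

definition gnorm :: "real^'n^'n \<Rightarrow> real^'n \<Rightarrow> real" where
  "gnorm G v = sqrt (v \<bullet> (G *v v))"

lemma continuous_on_det:
  fixes A :: "'a::topological_space \<Rightarrow> real^'n^'n"
  assumes "continuous_on S A"
  shows "continuous_on S (\<lambda>x. det (A x))"
  unfolding det_def by (intro continuous_intros assms)

lemma continuous_on_matrix_vector:
  fixes A :: "'a::topological_space \<Rightarrow> real^'n^'m"
  assumes "continuous_on S A" "continuous_on S v"
  shows "continuous_on S (\<lambda>x. A x *v v x)"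
  unfolding matrix_vector_mult_def by (intro continuous_intros assms)

lemma posdef_det_nonzero:
  assumes "posdef G"
  shows "det G \<noteq> 0"
proof -
  have "inj ((*v) G)"
  proof (rule injI)
    fix x y assume "G *v x = G *v y"
    then have "G *v (x - y) = 0" by (simp add: matrix_vector_mult_diff_distrib)
    then have "(x - y) \<bullet> (G *v (x - y)) = 0" by simp
    then show "x = y" using assms unfolding posdef_def by (metis less_irrefl right_minus_eq)
  qed
  then have "\<exists>B. B ** G = mat 1" using matrix_left_invertible_injective by blast
  then have "invertible G" using invertible_left_inverse by blast
  then show ?thesis by (simp add: invertible_det_nz)
qed

text \<open>The segment from the identity to \<open>G\<close> consists of positive definite matrices.\<close>

lemma posdef_det_pos:
  assumes G: "posdef (G :: real^'n^'n)"
  shows "det G > 0"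
proof (rule ccontr)
  assume "\<not> det G > 0"
  define H where "H t = (1 - t) *\<^sub>R mat 1 + t *\<^sub>R G" for t
  have "continuous_on {0..1} (\<lambda>t. det (H t))"
    unfolding H_def by (intro continuous_on_det continuous_intros)
  moreover have "det (H 0) = 1" "det (H 1) = det G" by (simp_all add: H_def)
  ultimately obtain t where t: "0 \<le> t" "t \<le> 1" "det (H t) = 0"
    using IVT2'[of "\<lambda>t. det (H t)" 1 0 0] \<open>\<not> det G > 0\<close> by auto
  have "posdef (H t)"
    unfolding posdef_def
  proof (intro conjI allI impI)
    have "transpose G = G" using G by (simp add: posdef_def)
    then show "transpose (H t) = H t"
      unfolding H_def by (auto simp: transpose_def vec_eq_iff mat_def)
    fix v :: "real^'n" assume v: "v \<noteq> 0"
    have "v \<bullet> (H t *v v) = (1 - t) * (v \<bullet> v) + t * (v \<bullet> (G *v v))"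
      by (simp add: H_def matrix_vector_mult_add_rdistrib scaleR_matrix_vector_assoc[symmetric] inner_right_distrib)
    moreover have "v \<bullet> v > 0" "v \<bullet> (G *v v) > 0" using v G by (auto simp: posdef_def)
    ultimately show "0 < v \<bullet> (H t *v v)"
      using t(1,2) by (cases "t = 0") (auto intro!: add_nonneg_pos mult_pos_pos)
  qed
  then show False using posdef_det_nonzero t(3) by blast
qed

lemma posdef_sym: "posdef G \<Longrightarrow> v \<bullet> (G *v w) = w \<bullet> (G *v v)"
  by (metis dot_lmul_matrix inner_commute posdef_def transpose_matrix_vector)

lemma posdef_nonneg: "posdef G \<Longrightarrow> 0 \<le> v \<bullet> (G *v v)"
  unfolding posdef_def by (cases "v = 0") (auto intro: less_imp_le)

lemma gnorm_nonneg: "posdef G \<Longrightarrow> 0 \<le> gnorm G v"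
  by (simp add: gnorm_def posdef_nonneg)

lemma gnorm_square: "posdef G \<Longrightarrow> gnorm G v ^ 2 = v \<bullet> (G *v v)"
  by (simp add: gnorm_def posdef_nonneg)

lemma gnorm_cauchy_schwarz:
  assumes G: "posdef G"
  shows "\<bar>v \<bullet> (G *v w)\<bar> \<le> gnorm G v * gnorm G w"
proof (cases "w = 0")
  case False
  let ?a = "v \<bullet> (G *v v)" and ?b = "v \<bullet> (G *v w)" and ?c = "w \<bullet> (G *v w)"
  have c: "?c > 0" using False G by (simp add: posdef_def)
  \<comment> \<open>The vector is the component of \<open>v\<close> orthogonal to \<open>w\<close>
    with respect to \<open>G\<close>; its square is nonnegative.\<close>
  have "0 \<le> (v - (?b / ?c) *\<^sub>R w) \<bullet> (G *v (v - (?b / ?c) *\<^sub>R w))"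
    by (rule posdef_nonneg[OF G])
  also have "\<dots> = ?a - ?b\<^sup>2 / ?c"
    using posdef_sym[OF G, of w v] c
    by (simp add: matrix_vector_mult_diff_distrib matrix_vector_mult_scaleR inner_diff_left
        inner_diff_right power2_eq_square field_simps)
  finally have "?b\<^sup>2 \<le> ?a * ?c" using c by (simp add: field_simps)
  then have "sqrt (?b\<^sup>2) \<le> sqrt (?a * ?c)" by (rule real_sqrt_le_mono)
  then show ?thesis by (simp add: gnorm_def real_sqrt_mult)
qed (simp add: gnorm_def)

lemma gnorm_triangle:
  assumes G: "posdef G"
  shows "gnorm G (v + w) \<le> gnorm G v + gnorm G w"
proof (rule power2_le_imp_le)
  have "gnorm G (v + w) ^ 2 = gnorm G v ^ 2 + 2 * (v \<bullet> (G *v w)) + gnorm G w ^ 2"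
    using posdef_sym[OF G, of w v]
    by (simp add: gnorm_square[OF G] matrix_vector_right_distrib inner_add_left inner_add_right)
  also have "\<dots> \<le> (gnorm G v + gnorm G w) ^ 2"
    using gnorm_cauchy_schwarz[OF G, of v w] by (simp add: power2_sum)
  finally show "gnorm G (v + w) ^ 2 \<le> (gnorm G v + gnorm G w) ^ 2" .
qed (simp add: gnorm_nonneg[OF G])

lemma gnorm_scaleR: "gnorm G (a *\<^sub>R v) = \<bar>a\<bar> * gnorm G v"
proof -
  have "gnorm G (a *\<^sub>R v) = sqrt (a\<^sup>2 * (v \<bullet> (G *v v)))"
    by (simp add: gnorm_def matrix_vector_mult_scaleR power2_eq_square mult.assoc)
  then show ?thesis by (simp add: real_sqrt_mult gnorm_def)
qed

lemma norm_matrix_vector_le: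
  fixes A :: "real^'n^'m"
  shows "norm (A *v v) \<le> (\<Sum>i\<in>UNIV. norm (A $ i)) * norm v"
proof -
  have "norm (A *v v) \<le> (\<Sum>i\<in>UNIV. \<bar>(A *v v) $ i\<bar>)" by (rule norm_le_l1_cart)
  also have "\<dots> \<le> (\<Sum>i\<in>UNIV. norm (A $ i) * norm v)"
    by (intro sum_mono) (simp add: matrix_vector_mul_component Cauchy_Schwarz_ineq2)
  finally show ?thesis by (simp add: sum_distrib_right)
qed

text \<open>For \<open>w = G *v v\<close>, Cauchy-Schwarz bounds the square of
  \<open>norm w\<close>, which is \<open>w \<bullet> (G *v v)\<close>, by
  \<open>gnorm G w * gnorm G v\<close>; and \<open>gnorm G w \<le> sqrt L * norm w\<close> because
  \<open>L\<close> bounds the operator norm. Thus only an upper bound for the entries of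
  \<open>G\<close> enters.\<close>

lemma norm_lower_le_gnorm:
  assumes G: "posdef G" and L: "(\<Sum>i\<in>UNIV. norm (G $ i)) \<le> L"
  shows "norm (G *v v) \<le> sqrt L * gnorm G v"
proof (cases "G *v v = 0")
  case True
  moreover have "0 \<le> L" using L sum_nonneg[of UNIV "\<lambda>i. norm (G $ i)"] by (simp add: order_trans[OF _ L] sum_nonneg)
  ultimately show ?thesis by (simp add: gnorm_nonneg[OF G])
next
  case False
  let ?w = "G *v v"
  have L0: "0 \<le> L" by (rule order_trans[OF _ L]) (simp add: sum_nonneg)
  have "?w \<bullet> ?w \<le> gnorm G ?w * gnorm G v"
    using gnorm_cauchy_schwarz[OF G, of ?w v] by linarith
  then have 1: "(norm ?w)\<^sup>2 \<le> gnorm G ?w * gnorm G v" by (simp add: power2_norm_eq_inner)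
  have "gnorm G ?w ^ 2 \<le> norm ?w * norm (G *v ?w)"
    unfolding gnorm_square[OF G] using Cauchy_Schwarz_ineq2[of ?w "G *v ?w"] by linarith
  also have "\<dots> \<le> norm ?w * (L * norm ?w)"
    by (intro mult_left_mono order_trans[OF norm_matrix_vector_le] mult_right_mono L) auto
  finally have "gnorm G ?w ^ 2 \<le> (sqrt L * norm ?w) ^ 2"
    using L0 by (simp add: power_mult_distrib) (simp add: power2_eq_square mult_ac)
  then have "gnorm G ?w \<le> sqrt L * norm ?w" by (rule power2_le_imp_le) (simp add: L0)
  then have "(norm ?w)\<^sup>2 \<le> sqrt L * norm ?w * gnorm G v"
    using 1 mult_right_mono[OF _ gnorm_nonneg[OF G, of v]] by (meson order_trans)
  then have "norm ?w * norm ?w \<le> norm ?w * (sqrt L * gnorm G v)"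
    by (simp add: power2_eq_square mult_ac)
  then show ?thesis using False by simp
qed

text \<open>The solution of \<open>G *v x = b\<close> by Cramer's rule: a quotient of polynomials in
  the entries, hence visibly continuous in \<open>G\<close> and \<open>b\<close>.\<close>

definition cramer_solution :: "real^'n^'n \<Rightarrow> real^'n \<Rightarrow> real^'n" where
  "cramer_solution G b = (\<chi> k. det (\<chi> i j. if j = k then b $ i else G $ i $ j) / det G)"

lemma posdef_cramer: "posdef G \<Longrightarrow> G *v x = b \<longleftrightarrow> x = cramer_solution G b"
  unfolding cramer_solution_def by (rule cramer) (rule posdef_det_nonzero)

lemma continuous_on_cramer_solution:
  fixes G :: "'a::topological_space \<Rightarrow> real^'n^'n"
  assumes "continuous_on S G" "continuous_on S b" "\<And>x. x \<in> S \<Longrightarrow> posdef (G x)"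
  shows "continuous_on S (\<lambda>x. cramer_solution (G x) (b x))"
proof -
  have "continuous_on S (\<lambda>x. if j = k then b x $ i else G x $ i $ j)" for i j k
    by (cases "j = k") (auto intro!: continuous_intros assms)
  then show ?thesis
    unfolding cramer_solution_def
    by (intro continuous_intros continuous_on_det assms) (auto simp: posdef_det_nonzero assms(3))
qed

lemma posdef_injective: "posdef G \<Longrightarrow> G *v x = G *v y \<Longrightarrow> x = y"
  by (metis posdef_cramer)

lemma gnorm_zero [simp]: "gnorm G 0 = 0"
  by (simp add: gnorm_def)

section \<open>The standing setting and its charts\<close>

locale riemannian_space =
  fixes M :: "('a::{t2_space,second_countable_topology}, 'n::finite) riemannian"
    and vol :: "'a measure"
  assumes manifold: "riemannian_manifold M"
    and volume: "riemannian_volume M vol"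
    and finite_volume: "emeasure vol (points M) < \<infinity>"
begin

lemma atlas_cover: "(\<Union>c\<in>atlas M. dom c) = points M"
  using manifold by (simp add: riemannian_manifold_def smooth_atlas_def)

lemma chart_openin: "c \<in> atlas M \<Longrightarrow> openin (top_of_set (points M)) (dom c)"
  using manifold by (simp add: riemannian_manifold_def smooth_atlas_def)

lemma chart_half_open: "c \<in> atlas M \<Longrightarrow> half_open (codom c)"
  using manifold by (simp add: riemannian_manifold_def smooth_atlas_def half_open_def)

lemma chart_homeomorphism: "c \<in> atlas M \<Longrightarrow> homeomorphism (dom c) (codom c) (coord c) (uncoord c)"
  using manifold by (simp add: riemannian_manifold_def smooth_atlas_def)

lemma chart_inj: "c \<in> atlas M \<Longrightarrow> inj_on (coord c) (dom c)"
  using chart_homeomorphism unfolding homeomorphism_def by (metis inj_on_inverseI)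

lemma uncoord_coord [simp]: "c \<in> atlas M \<Longrightarrow> p \<in> dom c \<Longrightarrow> uncoord c (coord c p) = p"
  by (simp add: chart_inj inv_into_f_f)

lemma coord_uncoord: "x \<in> codom c \<Longrightarrow> coord c (uncoord c x) = x"
  by (rule f_inv_into_f)

lemma uncoord_in_dom: "x \<in> codom c \<Longrightarrow> uncoord c x \<in> dom c"
  by (rule inv_into_into)

lemma dom_subset: "c \<in> atlas M \<Longrightarrow> dom c \<subseteq> points M"
  using atlas_cover by blast

lemma continuous_coord: "c \<in> atlas M \<Longrightarrow> continuous_on (dom c) (coord c)"
  using chart_homeomorphism homeomorphism_cont1 by blast

lemma continuous_uncoord: "c \<in> atlas M \<Longrightarrow> continuous_on (codom c) (uncoord c)"
  using chart_homeomorphism homeomorphism_cont2 by blast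

lemma gram_posdef: "c \<in> atlas M \<Longrightarrow> x \<in> codom c \<Longrightarrow> posdef (gram M c x)"
  using manifold unfolding riemannian_manifold_def posdef_def by blast

lemma continuous_gram: "c \<in> atlas M \<Longrightarrow> continuous_on (codom c) (gram M c)"
  using manifold unfolding riemannian_manifold_def by (blast intro: smooth_on_continuous_on)

lemma overlap_subset: "overlap c d \<subseteq> codom c"
  by blast

lemma overlap_half_open:
  assumes "c \<in> atlas M" "d \<in> atlas M"
  shows "half_open (overlap c d)"
proof -
  have "openin (top_of_set (points M)) (dom c \<inter> dom d)"
    using chart_openin assms by blast
  then have "openin (top_of_set (dom c)) (dom c \<inter> dom d)"
    by (rule openin_subset_trans) (use dom_subset assms in auto)
  then have "openin (top_of_set (codom c)) (overlap c d)"
    by (rule homeomorphism_imp_open_map[OF chart_homeomorphism[OF assms(1)]])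
  then show ?thesis by (rule half_open_subset[OF chart_half_open[OF assms(1)]])
qed

lemma transition_has_derivative:
  assumes "c \<in> atlas M" "d \<in> atlas M" "p \<in> dom c \<inter> dom d"
  obtains D where "(transition c d has_derivative D) (at (coord c p) within overlap c d)"
proof -
  have "smooth_on (overlap c d) (transition c d)"
    using manifold assms by (simp add: riemannian_manifold_def smooth_atlas_def)
  moreover have "coord c p \<in> overlap c d" using assms(3) by simp
  ultimately have "\<exists>D. (transition c d has_derivative D) (at (coord c p) within overlap c d)"
    by (rule smooth_on_has_derivative)
  then show ?thesis by (rule exE) (rule that)
qed

lemma transition_coord: "c \<in> atlas M \<Longrightarrow> p \<in> dom c \<Longrightarrow> transition c d (coord c p) = coord d p"
  by simp

lemma gram_transition:
  assumes "c \<in> atlas M" "d \<in> atlas M" "p \<in> dom c \<inter> dom d"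
    and "(transition c d has_derivative D) (at (coord c p) within overlap c d)"
  shows "v \<bullet> (gram M c (coord c p) *v w) = D v \<bullet> (gram M d (coord d p) *v D w)"
proof -
  have "v \<bullet> (gram M c (coord c p) *v w)
      = D v \<bullet> (gram M d (transition c d (coord c p)) *v D w)"
    using manifold assms unfolding riemannian_manifold_def by blast
  then show ?thesis using assms by (simp add: transition_coord)
qed

text \<open>\<open>vnorm\<close> evaluates in an arbitrarily chosen chart. The transformation laws
  of the field and of the Gram matrices cancel, so every chart gives the same value.\<close>

lemma vnorm_chart:
  assumes X: "vector_field M X" and c: "c \<in> atlas M" "p \<in> dom c"
  shows "vnorm M X p = gnorm (gram M c (coord c p)) (X c p)"
proof -
  define d where "d = (SOME d. d \<in> atlas M \<and> p \<in> dom d)"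
  have d: "d \<in> atlas M" "p \<in> dom d"
    using someI[of "\<lambda>d. d \<in> atlas M \<and> p \<in> dom d" c] c unfolding d_def by auto
  have p: "p \<in> dom c \<inter> dom d" using c d by simp
  obtain D where D: "(transition c d has_derivative D) (at (coord c p) within overlap c d)"
    using transition_has_derivative[OF c(1) d(1) p] .
  have "X d p = D (X c p)"
    using X c(1) d(1) p D unfolding vector_field_def by blast
  then have "gnorm (gram M d (coord d p)) (X d p) = gnorm (gram M c (coord c p)) (X c p)"
    using gram_transition[OF c(1) d(1) p D] by (simp add: gnorm_def)
  then show ?thesis unfolding vnorm_def d_def[symmetric] by (simp add: gnorm_def)
qed

lemma point_chart: "p \<in> points M \<Longrightarrow> \<exists>c\<in>atlas M. p \<in> dom c"
  using atlas_cover by blast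

subsection \<open>Measurability and the volume measure in charts\<close>

lemma sets_vol: "sets vol = sets (restrict_space borel (points M))"
  using volume by (simp add: riemannian_volume_def)

lemma space_vol: "space vol = points M"
  using sets_eq_imp_space_eq[OF sets_vol] by (simp add: space_restrict_space)

lemma finite_measure_vol: "finite_measure vol"
  by (rule finite_measureI) (use finite_volume in \<open>simp add: space_vol\<close>)

lemma openin_sets_vol: "openin (top_of_set (points M)) S \<Longrightarrow> S \<in> sets vol"
proof -
  assume "openin (top_of_set (points M)) S"
  then obtain T where "open T" "S = points M \<inter> T" unfolding openin_open by (elim exE conjE)
  then show ?thesis unfolding sets_vol sets_restrict_space by (intro image_eqI[of _ _ T]) simp_all
qed

lemma dom_sets_vol: "c \<in> atlas M \<Longrightarrow> dom c \<in> sets vol"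
  by (rule openin_sets_vol[OF chart_openin])

lemma sets_restrict_vol:
  assumes "c \<in> atlas M"
  shows "sets (restrict_space vol (dom c)) = sets (restrict_space borel (dom c))"
proof -
  have "sets (restrict_space vol (dom c)) = sets (restrict_space (restrict_space borel (points M)) (dom c))"
    by (rule sets_restrict_space_cong[OF sets_vol])
  also have "\<dots> = sets (restrict_space borel (points M \<inter> dom c))"
    by (rule sets_restrict_restrict_space)
  also have "points M \<inter> dom c = dom c" using dom_subset[OF assms] by blast
  finally show ?thesis .
qed

lemma uncoord_measurable:
  assumes c: "c \<in> atlas M"
  shows "uncoord c \<in> measurable (restrict_space borel (codom c)) (restrict_space borel (dom c))"
  by (rule measurable_restrict_space2)
    (auto simp: space_restrict_space uncoord_in_dom
      intro!: borel_measurable_continuous_on_restrict continuous_uncoord c)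

lemma coord_measurable:
  assumes c: "c \<in> atlas M"
  shows "coord c \<in> measurable (restrict_space borel (dom c)) (restrict_space borel (codom c))"
  by (rule measurable_restrict_space2)
    (auto simp: space_restrict_space
      intro!: borel_measurable_continuous_on_restrict continuous_coord c)

text \<open>Second countability gives a countable subcover (Lindelof), which reduces measurability
  and null sets to single charts.\<close>

lemma countable_atlas: "\<exists>A\<subseteq>atlas M. countable A \<and> (\<Union>c\<in>A. dom c) = points M"
proof -
  have op: "openin (top_of_set (points M)) S" if "S \<in> dom ` atlas M" for S
    using that chart_openin by blast
  obtain F where F: "F \<subseteq> dom ` atlas M" "countable F" "\<Union>F = \<Union>(dom ` atlas M)"
    using Lindelof_openin[OF op] by metis
  then obtain A where "A \<subseteq> atlas M" "countable A" "F = dom ` A"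
    using countable_subset_image[of F dom "atlas M"] by metis
  then show ?thesis using F atlas_cover by auto
qed

lemma borel_measurable_vol_charts:
  fixes h :: "'a \<Rightarrow> 'b::topological_space"
  assumes "\<And>c. c \<in> atlas M \<Longrightarrow> h \<in> borel_measurable (restrict_space borel (dom c))"
  shows "h \<in> borel_measurable vol"
proof -
  obtain A where A: "A \<subseteq> atlas M" "countable A" "(\<Union>c\<in>A. dom c) = points M"
    using countable_atlas by blast
  show ?thesis
  proof (rule measurable_piecewise_restrict[of "dom ` A"])
    show "countable (dom ` A)" using A(2) by simp
    show "\<Omega> \<inter> space vol \<in> sets vol" if "\<Omega> \<in> dom ` A" for \<Omega>
      using that A(1) dom_sets_vol by auto
    show "space vol \<subseteq> \<Union> (dom ` A)" using A(3) by (simp add: space_vol)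
    show "h \<in> borel_measurable (restrict_space vol \<Omega>)" if "\<Omega> \<in> dom ` A" for \<Omega>
    proof -
      obtain c where c: "c \<in> atlas M" "\<Omega> = dom c" using \<open>\<Omega> \<in> dom ` A\<close> A(1) by blast
      show ?thesis
        using assms[OF c(1)] measurable_cong_sets[OF sets_restrict_vol[OF c(1)] refl] c(2) by blast
    qed
  qed
qed

lemma borel_measurable_vol_restrict:
  assumes "h \<in> borel_measurable vol" "c \<in> atlas M"
  shows "h \<in> borel_measurable (restrict_space borel (dom c))"
  using measurable_restrict_space1[OF assms(1), of "dom c"]
    measurable_cong_sets[OF sets_restrict_vol[OF assms(2)] refl] by blast

lemma borel_measurable_uncoord:
  assumes "h \<in> borel_measurable (restrict_space borel (dom c))" "c \<in> atlas M"
  shows "(\<lambda>x. h (uncoord c x)) \<in> borel_measurable (restrict_space borel (codom c))"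
  using measurable_compose[OF uncoord_measurable[OF assms(2)] assms(1)] .

lemma borel_measurable_gram:
  assumes "c \<in> atlas M"
  shows "gram M c \<in> borel_measurable (restrict_space borel (codom c))"
  by (intro borel_measurable_continuous_on_restrict continuous_gram assms)

lemma vector_field_measurable:
  "vector_field M X \<Longrightarrow> c \<in> atlas M \<Longrightarrow> X c \<in> borel_measurable (restrict_space borel (dom c))"
  unfolding vector_field_def by blast

lemma borel_measurable_matrix_vector:
  fixes A :: "'b \<Rightarrow> real^'k^'m"
  assumes "A \<in> borel_measurable N" "v \<in> borel_measurable N"
  shows "(\<lambda>x. A x *v v x) \<in> borel_measurable N"
proof -
  have "continuous_on UNIV (\<lambda>z::(real^'k^'m) \<times> (real^'k). fst z *v snd z)"
    by (intro continuous_on_matrix_vector continuous_intros)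
  then have "(\<lambda>z::(real^'k^'m) \<times> (real^'k). fst z *v snd z) \<in> borel_measurable borel"
    by (rule borel_measurable_continuous_onI)
  from measurable_compose[OF borel_measurable_Pair[OF assms] this] show ?thesis by simp
qed

lemma vnorm_measurable:
  assumes X: "vector_field M X"
  shows "vnorm M X \<in> borel_measurable vol"
proof (rule borel_measurable_vol_charts)
  fix c assume c: "c \<in> atlas M"
  have 1: "(\<lambda>p. gram M c (coord c p)) \<in> borel_measurable (restrict_space borel (dom c))"
    using measurable_compose[OF coord_measurable[OF c] borel_measurable_gram[OF c]] .
  have "(\<lambda>p. sqrt (X c p \<bullet> (gram M c (coord c p) *v X c p))) \<in> borel_measurable (restrict_space borel (dom c))"
    using vector_field_measurable[OF X c] borel_measurable_matrix_vector[OF 1 vector_field_measurable[OF X c]]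
    by measurable
  then show "vnorm M X \<in> borel_measurable (restrict_space borel (dom c))"
    by (rule measurable_cong[THEN iffD1, rotated])
      (simp add: space_restrict_space vnorm_chart[OF X c] gnorm_def)
qed

lemma coord_image_borel:
  assumes c: "c \<in> atlas M" and E: "E \<in> sets vol" "E \<subseteq> dom c"
  shows "coord c ` E \<in> sets borel"
proof -
  have "E \<in> sets (restrict_space vol (dom c))"
    using E dom_sets_vol[OF c] by (subst sets_restrict_space_iff) auto
  then have "E \<in> sets (restrict_space borel (dom c))" using sets_restrict_vol[OF c] by simp
  from measurable_sets[OF uncoord_measurable[OF c] this]
  have "uncoord c -` E \<inter> codom c \<in> sets (restrict_space borel (codom c))"
    by (simp add: space_restrict_space)
  also have "uncoord c -` E \<inter> codom c = coord c ` E"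
    using E(2) c by (auto simp: image_iff)
  finally show ?thesis
    using half_open_borel[OF chart_half_open[OF c]] by (subst (asm) sets_restrict_space_iff) auto
qed

lemma emeasure_vol_chart:
  assumes "c \<in> atlas M" "E \<in> sets vol" "E \<subseteq> dom c"
  shows "emeasure vol E = (\<integral>\<^sup>+x\<in>coord c ` E. ennreal (sqrt (det (gram M c x))) \<partial>lborel)"
  using volume assms by (simp add: riemannian_volume_def)

lemma density_measurable:
  assumes c: "c \<in> atlas M"
  shows "(\<lambda>x. ennreal (sqrt (det (gram M c x)))) \<in> borel_measurable (restrict_space lborel (codom c))"
proof -
  have "(\<lambda>x. sqrt (det (gram M c x))) \<in> borel_measurable (restrict_space borel (codom c))"
    by (intro borel_measurable_continuous_on_restrict continuous_intros continuous_on_det continuous_gram c)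
  then have "(\<lambda>x. sqrt (det (gram M c x))) \<in> borel_measurable (restrict_space lborel (codom c))"
    by (simp add: measurable_cong_sets sets_restrict_space)
  then show ?thesis by measurable
qed

text \<open>\<open>riemannian_volume\<close> prescribes the measure of sets only. Written as an
  image of a weighted Lebesgue measure, the volume transports integrals to coordinates as
  well.\<close>

lemma vol_chart:
  assumes c: "c \<in> atlas M"
  shows "restrict_space vol (dom c) =
    distr (density (restrict_space lborel (codom c)) (\<lambda>x. ennreal (sqrt (det (gram M c x)))))
      (restrict_space borel (dom c)) (uncoord c)" (is "_ = distr ?D ?B _")
proof (rule measure_eqI)
  show sets: "sets (restrict_space vol (dom c)) = sets (distr ?D ?B (uncoord c))"
    using sets_restrict_vol[OF c] by simp
  have cb: "codom c \<in> sets borel" by (rule half_open_borel[OF chart_half_open[OF c]])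
  have m: "uncoord c \<in> measurable ?D ?B"
    using uncoord_measurable[OF c] by (simp add: measurable_cong_sets sets_restrict_space)
  note w = density_measurable[OF c]
  fix E assume E: "E \<in> sets (restrict_space vol (dom c))"
  then have E': "E \<in> sets vol" "E \<subseteq> dom c" using dom_sets_vol[OF c] by (auto simp: sets_restrict_space_iff)
  have pre: "uncoord c -` E \<inter> codom c = coord c ` E" using E'(2) c by (auto simp: image_iff)
  have iE: "coord c ` E \<in> sets borel" by (rule coord_image_borel[OF c E'])
  have "emeasure (distr ?D ?B (uncoord c)) E = emeasure ?D (uncoord c -` E \<inter> space ?D)"
    by (rule emeasure_distr[OF m]) (use E sets in simp)
  also have "uncoord c -` E \<inter> space ?D = coord c ` E" using pre by (simp add: space_restrict_space)
  also have "emeasure ?D (coord c ` E) = (\<integral>\<^sup>+x. ennreal (sqrt (det (gram M c x))) * indicator (coord c ` E) x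
      \<partial>restrict_space lborel (codom c))"
    by (rule emeasure_density[OF w]) (use iE E'(2) cb in \<open>auto simp: sets_restrict_space_iff\<close>)
  also have "\<dots> = (\<integral>\<^sup>+x. ennreal (sqrt (det (gram M c x))) * indicator (coord c ` E) x * indicator (codom c) x \<partial>lborel)"
    by (rule nn_integral_restrict_space) (use cb in simp)
  also have "\<dots> = (\<integral>\<^sup>+x\<in>coord c ` E. ennreal (sqrt (det (gram M c x))) \<partial>lborel)"
    using E'(2) by (intro nn_integral_cong) (auto split: split_indicator)
  also have "\<dots> = emeasure vol E" using emeasure_vol_chart[OF c E'] by simp
  also have "\<dots> = emeasure (restrict_space vol (dom c)) E"
    using dom_sets_vol[OF c] E'(2) by (subst emeasure_restrict_space) auto
  finally show "emeasure (restrict_space vol (dom c)) E = emeasure (distr ?D ?B (uncoord c)) E" ..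
qed

lemma nn_integral_vol_chart:
  assumes c: "c \<in> atlas M" and h: "h \<in> borel_measurable vol"
  shows "(\<integral>\<^sup>+p. h p * indicator (dom c) p \<partial>vol) =
    (\<integral>\<^sup>+x. ennreal (sqrt (det (gram M c x))) * h (uncoord c x) * indicator (codom c) x \<partial>lborel)"
proof -
  have cb: "codom c \<in> sets borel" by (rule half_open_borel[OF chart_half_open[OF c]])
  have hr: "h \<in> borel_measurable (restrict_space borel (dom c))"
    by (rule borel_measurable_vol_restrict[OF h c])
  note w = density_measurable[OF c]
  have hu: "(\<lambda>x. h (uncoord c x)) \<in> borel_measurable (restrict_space lborel (codom c))"
    using borel_measurable_uncoord[OF hr c] by (simp add: measurable_cong_sets sets_restrict_space)
  have m: "uncoord c \<in> measurable (density (restrict_space lborel (codom c)) (\<lambda>x. ennreal (sqrt (det (gram M c x)))))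
      (restrict_space borel (dom c))"
    using uncoord_measurable[OF c] by (simp add: measurable_cong_sets sets_restrict_space)
  have "(\<integral>\<^sup>+p. h p * indicator (dom c) p \<partial>vol) = (\<integral>\<^sup>+p. h p \<partial>restrict_space vol (dom c))"
    by (rule nn_integral_restrict_space[symmetric]) (use dom_sets_vol[OF c] in auto)
  also have "\<dots> = (\<integral>\<^sup>+x. h (uncoord c x) \<partial>density (restrict_space lborel (codom c))
      (\<lambda>x. ennreal (sqrt (det (gram M c x)))))"
    unfolding vol_chart[OF c] using hr by (subst nn_integral_distr[OF m]) simp_all
  also have "\<dots> = (\<integral>\<^sup>+x. ennreal (sqrt (det (gram M c x))) * h (uncoord c x) \<partial>restrict_space lborel (codom c))"
    by (rule nn_integral_density[OF w hu])
  also have "\<dots> = (\<integral>\<^sup>+x. ennreal (sqrt (det (gram M c x))) * h (uncoord c x) * indicator (codom c) x \<partial>lborel)"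
    by (rule nn_integral_restrict_space) (use cb in simp)
  finally show ?thesis .
qed

text \<open>A null set of coordinates pulls back to a null set, since the volume has a density
  there; the part of the chart range off its interior is negligible.\<close>

lemma AE_vol_chart:
  assumes c: "c \<in> atlas M" and P: "AE x in lborel. x \<in> interior (codom c) \<longrightarrow> P (uncoord c x)"
  shows "AE p in vol. p \<in> dom c \<longrightarrow> P p"
proof -
  have "AE x in lborel. x \<in> codom c \<longrightarrow> P (uncoord c x)"
    using P AE_lborel_negligible[OF negligible_half_open_boundary[OF chart_half_open[OF c]]]
    by eventually_elim blast
  then obtain N where N: "{x. \<not> (x \<in> codom c \<longrightarrow> P (uncoord c x))} \<subseteq> N" "N \<in> null_sets lborel"
    by (auto elim!: AE_E simp: null_sets_def)
  define N' where "N' = {p \<in> dom c. coord c p \<in> N}"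
  have "N \<inter> codom c \<in> sets borel"
    using N(2) half_open_borel[OF chart_half_open[OF c]] by (simp add: null_sets_def sets.Int)
  then have "N \<inter> codom c \<in> sets (restrict_space borel (codom c))"
    using half_open_borel[OF chart_half_open[OF c]] by (subst sets_restrict_space_iff) auto
  from measurable_sets[OF coord_measurable[OF c] this]
  have "coord c -` (N \<inter> codom c) \<inter> dom c \<in> sets (restrict_space borel (dom c))"
    by (simp only: space_restrict_space space_borel Int_UNIV_right)
  also have "coord c -` (N \<inter> codom c) \<inter> dom c = N'" by (auto simp: N'_def)
  finally have "N' \<in> sets (restrict_space vol (dom c))" using sets_restrict_vol[OF c] by simp
  then have N': "N' \<in> sets vol" "N' \<subseteq> dom c" using dom_sets_vol[OF c] by (auto simp: sets_restrict_space_iff)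
  have "emeasure vol N' = (\<integral>\<^sup>+x\<in>coord c ` N'. ennreal (sqrt (det (gram M c x))) \<partial>lborel)"
    by (rule emeasure_vol_chart[OF c N'])
  also have "\<dots> = (\<integral>\<^sup>+x. 0 \<partial>(lborel :: (real^'n) measure))"
  proof (rule nn_integral_cong_AE)
    show "AE x in lborel. ennreal (sqrt (det (gram M c x))) * indicator (coord c ` N') x = 0"
      using AE_not_in[OF N(2)] by eventually_elim (auto simp: N'_def split: split_indicator)
  qed
  finally have "N' \<in> null_sets vol" using N'(1) by (simp add: null_sets_def)
  moreover have "{p \<in> space vol. \<not> (p \<in> dom c \<longrightarrow> P p)} \<subseteq> N'"
    using N(1) c by (auto simp: N'_def)
  ultimately show ?thesis by (rule AE_I')
qed

lemma AE_vol_charts: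
  assumes "\<And>c. c \<in> atlas M \<Longrightarrow> AE x in lborel. x \<in> interior (codom c) \<longrightarrow> P (uncoord c x)"
  shows "AE p in vol. P p"
proof -
  obtain A where A: "A \<subseteq> atlas M" "countable A" "(\<Union>c\<in>A. dom c) = points M"
    using countable_atlas by blast
  have "AE p in vol. \<forall>c\<in>A. p \<in> dom c \<longrightarrow> P p"
    unfolding AE_ball_countable[OF A(2)] using AE_vol_chart assms A(1) by blast
  then show ?thesis
    by (rule AE_mp) (use A(3) in \<open>auto intro!: AE_I2 simp: space_vol\<close>)
qed

text \<open>On a compact part of a chart domain the density is bounded below.\<close>

lemma compact_chart_nn_integral_le:
  assumes c: "c \<in> atlas M" and K: "compact K" "K \<subseteq> codom c"
  obtains B where "B > 0" "\<And>h. h \<in> borel_measurable vol \<Longrightarrow>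
    (\<integral>\<^sup>+x. h (uncoord c x) * indicator K x \<partial>lborel) \<le> ennreal B * (\<integral>\<^sup>+p. h p \<partial>vol)"
proof -
  let ?w = "\<lambda>x. sqrt (det (gram M c x))"
  have "continuous_on K ?w"
    by (intro continuous_intros continuous_on_det continuous_on_subset[OF continuous_gram[OF c] K(2)])
  have "\<exists>m>0. \<forall>x\<in>K. m \<le> ?w x"
  proof (cases "K = {}")
    case False
    obtain x0 where "x0 \<in> K" "\<forall>x\<in>K. ?w x0 \<le> ?w x"
      using continuous_attains_inf[OF K(1) False \<open>continuous_on K ?w\<close>] by blast
    moreover have "?w x0 > 0" using \<open>x0 \<in> K\<close> K(2) posdef_det_pos[OF gram_posdef[OF c]] by auto
    ultimately show ?thesis by blast
  qed (auto intro: exI[of _ 1])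
  then obtain m where m: "m > 0" "\<And>x. x \<in> K \<Longrightarrow> m \<le> ?w x" by blast
  show ?thesis
  proof (rule that[of "1 / m"])
    fix h :: "'a \<Rightarrow> ennreal" assume h: "h \<in> borel_measurable vol"
    have "(\<integral>\<^sup>+x. h (uncoord c x) * indicator K x \<partial>lborel) \<le>
      (\<integral>\<^sup>+x. ennreal (1/m) * (ennreal (?w x) * h (uncoord c x) * indicator (codom c) x) \<partial>lborel)"
    proof (intro nn_integral_mono)
      fix x
      show "h (uncoord c x) * indicator K x \<le> ennreal (1/m) * (ennreal (?w x) * h (uncoord c x) * indicator (codom c) x)"
      proof (cases "x \<in> K")
        case True
        have "1 \<le> ennreal (1/m) * ennreal (?w x)"
        proof -
          have "ennreal 1 \<le> ennreal (1/m * ?w x)"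
            using m(1) m(2)[OF True] by (intro ennreal_leI) (simp add: field_simps)
          then show ?thesis
            using m(1) order.trans[OF less_imp_le[OF m(1)] m(2)[OF True]]
            by (subst ennreal_mult[symmetric]) simp_all
        qed
        from mult_right_mono[OF this, of "h (uncoord c x)"] True K(2) show ?thesis
          by (auto simp: mult.assoc)
      qed simp
    qed
    also have "\<dots> = ennreal (1/m) * (\<integral>\<^sup>+x. (ennreal (?w x) * h (uncoord c x) * indicator (codom c) x) \<partial>lborel)"
    proof (rule nn_integral_cmult)
      have "(\<lambda>x. ennreal (?w x) * h (uncoord c x)) \<in> borel_measurable (restrict_space borel (codom c))"
      proof -
        have "?w \<in> borel_measurable (restrict_space borel (codom c))"
          by (intro borel_measurable_continuous_on_restrict continuous_intros continuous_on_det continuous_gram c)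
        then show ?thesis
          using borel_measurable_uncoord[OF borel_measurable_vol_restrict[OF h c] c] by measurable
      qed
      then show "(\<lambda>x. ennreal (?w x) * h (uncoord c x) * indicator (codom c) x) \<in> borel_measurable lborel"
        using borel_measurable_restrict_space_iff_ennreal[of "codom c" borel]
          half_open_borel[OF chart_half_open[OF c]] by simp
    qed
    also have "\<dots> = ennreal (1/m) * (\<integral>\<^sup>+p. h p * indicator (dom c) p \<partial>vol)"
      by (simp only: nn_integral_vol_chart[OF c h])
    also have "\<dots> \<le> ennreal (1/m) * (\<integral>\<^sup>+p. h p \<partial>vol)"
      by (intro mult_left_mono nn_integral_mono) (auto split: split_indicator)
    finally show "(\<integral>\<^sup>+x. h (uncoord c x) * indicator K x \<partial>lborel) \<le> ennreal (1/m) * (\<integral>\<^sup>+p. h p \<partial>vol)" .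
  qed (use m in simp)
qed

end

section \<open>Integrals over compact sets against test functions\<close>

lemma set_integrable_mult_continuous:
  fixes g \<psi> :: "'b::euclidean_space \<Rightarrow> real"
  assumes "compact K" "set_integrable lborel K g" "continuous_on UNIV \<psi>"
  shows "set_integrable lborel K (\<lambda>x. g x * \<psi> x)"
proof -
  obtain B where B: "B \<ge> 0" "\<And>x. x \<in> K \<Longrightarrow> norm (\<psi> x) \<le> B"
    using continuous_on_compact_bound[OF assms(1) continuous_on_subset[OF assms(3) subset_UNIV]] by metis
  have m: "\<psi> \<in> borel_measurable lborel" using assms(3) by (simp add: borel_measurable_continuous_onI)
  have g: "integrable lborel (\<lambda>x. indicator K x * g x)" using assms(2) by (simp add: set_integrable_def)
  have "integrable lborel (\<lambda>x. (indicator K x * g x) * \<psi> x)"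
  proof (rule Bochner_Integration.integrable_bound)
    show "integrable lborel (\<lambda>x. B * (indicator K x * g x))" using g by simp
    show "(\<lambda>x. (indicator K x * g x) * \<psi> x) \<in> borel_measurable lborel" using g m by measurable
    show "AE x in lborel. norm ((indicator K x * g x) * \<psi> x) \<le> norm (B * (indicator K x * g x))"
    proof (rule AE_I2)
      fix x
      have "\<bar>g x\<bar> * \<bar>\<psi> x\<bar> \<le> B * \<bar>g x\<bar>" if "x \<in> K"
        using mult_left_mono[OF B(2)[OF that] abs_ge_zero[of "g x"]] by (simp add: mult.commute)
      then show "norm ((indicator K x * g x) * \<psi> x) \<le> norm (B * (indicator K x * g x))"
        using B(1) by (auto simp: abs_mult split: split_indicator)
    qed
  qed
  then show ?thesis by (simp add: set_integrable_def mult.assoc)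
qed

text \<open>A continuous test function is bounded on \<open>K\<close>, so convergence in mean on
  \<open>K\<close> survives multiplication by it. This is the limit step in the weak
  formulation.\<close>

lemma set_integral_mult_continuous_tendsto:
  fixes g \<psi> :: "'b::euclidean_space \<Rightarrow> real"
  assumes K: "compact K" and g: "set_integrable lborel K g" "\<And>n. set_integrable lborel K (h n)"
    and \<psi>: "continuous_on UNIV \<psi>"
    and lim: "(\<lambda>n. LINT x:K|lborel. \<bar>g x - h n x\<bar>) \<longlonglongrightarrow> 0"
  shows "(\<lambda>n. LINT x:K|lborel. h n x * \<psi> x) \<longlonglongrightarrow> (LINT x:K|lborel. g x * \<psi> x)"
proof -
  obtain B where B: "\<And>x. x \<in> K \<Longrightarrow> norm (\<psi> x) \<le> B"
    using continuous_on_compact_bound[OF K continuous_on_subset[OF \<psi> subset_UNIV]] by metis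
  have "(\<lambda>n. B * (LINT x:K|lborel. \<bar>g x - h n x\<bar>)) \<longlonglongrightarrow> 0"
    using tendsto_mult_left[OF lim, of "B"] by simp
  then have "(\<lambda>n. (LINT x:K|lborel. h n x * \<psi> x) - (LINT x:K|lborel. g x * \<psi> x)) \<longlonglongrightarrow> 0"
  proof (rule Lim_null_comparison[rotated], intro always_eventually allI)
    fix n
    have i: "set_integrable lborel K (\<lambda>x. h n x * \<psi> x)" "set_integrable lborel K (\<lambda>x. g x * \<psi> x)"
      using set_integrable_mult_continuous[OF K _ \<psi>] g by blast+
    have d: "set_integrable lborel K (\<lambda>x. \<bar>g x - h n x\<bar>)"
      by (intro set_integrable_abs set_integral_diff g)
    have "(LINT x:K|lborel. h n x * \<psi> x) - (LINT x:K|lborel. g x * \<psi> x)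
        = (LINT x:K|lborel. h n x * \<psi> x - g x * \<psi> x)"
      by (rule set_integral_diff(2)[symmetric]) (rule i)+
    also have "norm \<dots> \<le> (LINT x:K|lborel. norm (h n x * \<psi> x - g x * \<psi> x))"
      by (rule set_integral_norm_bound) (intro set_integral_diff i)
    also have "\<dots> \<le> (LINT x:K|lborel. B * \<bar>g x - h n x\<bar>)"
    proof (rule set_integral_mono)
      show "set_integrable lborel K (\<lambda>x. norm (h n x * \<psi> x - g x * \<psi> x))"
        by (intro set_integrable_norm set_integral_diff i)
      show "set_integrable lborel K (\<lambda>x. B * \<bar>g x - h n x\<bar>)"
        using d by (rule set_integrable_mult_right)
      fix x assume "x \<in> K"
      have "h n x * \<psi> x - g x * \<psi> x = - (\<psi> x * (g x - h n x))" by (simp add: algebra_simps)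
      then have "norm (h n x * \<psi> x - g x * \<psi> x) = \<bar>\<psi> x\<bar> * \<bar>g x - h n x\<bar>" by (simp add: abs_mult)
      then show "norm (h n x * \<psi> x - g x * \<psi> x) \<le> B * \<bar>g x - h n x\<bar>"
        using mult_right_mono[OF B[OF \<open>x \<in> K\<close>] abs_ge_zero[of "g x - h n x"]] by simp
    qed
    also have "\<dots> = B * (LINT x:K|lborel. \<bar>g x - h n x\<bar>)"
      by (rule set_integral_mult_right)
    finally show "norm ((LINT x:K|lborel. h n x * \<psi> x) - (LINT x:K|lborel. g x * \<psi> x))
        \<le> B * (LINT x:K|lborel. \<bar>g x - h n x\<bar>)" .
  qed
  then show ?thesis by (simp add: LIM_zero_iff)
qed

lemma set_integral_support:
  fixes g \<psi> :: "'b \<Rightarrow> real"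
  assumes "K \<subseteq> V" "\<And>x. x \<notin> K \<Longrightarrow> \<psi> x = 0"
  shows "(LINT x:V|N. g x * \<psi> x) = (LINT x:K|N. g x * \<psi> x)"
proof -
  have "(\<lambda>x. indicator V x *\<^sub>R (g x * \<psi> x)) = (\<lambda>x. indicator K x *\<^sub>R (g x * \<psi> x))"
    using assms by (auto simp: fun_eq_iff split: split_indicator)
  then show ?thesis by (simp only: set_lebesgue_integral_def)
qed

lemma set_integrable_vec_nth:
  fixes g :: "'b \<Rightarrow> real^'n"
  assumes "set_integrable N K g"
  shows "set_integrable N K (\<lambda>x. g x $ i)"
  using integrable_bounded_linear[OF bounded_linear_vec_nth assms[unfolded set_integrable_def]]
  by (simp add: set_integrable_def)

lemma borel_measurable_restrict_indicator:
  fixes g :: "'b::topological_space \<Rightarrow> 'c::{real_normed_vector,second_countable_topology}"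
  assumes "g \<in> borel_measurable (restrict_space borel S)" "S \<in> sets borel" "K \<in> sets borel" "K \<subseteq> S"
  shows "(\<lambda>x. indicator K x *\<^sub>R g x) \<in> borel_measurable borel"
proof -
  have "(\<lambda>x. indicator S x *\<^sub>R g x) \<in> borel_measurable borel"
    using assms(1,2) borel_measurable_restrict_space_iff[of S borel g] by simp
  then have "(\<lambda>x. indicator K x *\<^sub>R (indicator S x *\<^sub>R g x)) \<in> borel_measurable borel"
    using assms(3) by measurable
  also have "(\<lambda>x. indicator K x *\<^sub>R (indicator S x *\<^sub>R g x)) = (\<lambda>x. indicator K x *\<^sub>R g x)"
    using assms(4) by (auto simp: fun_eq_iff split: split_indicator)
  finally show ?thesis .
qed

lemma continuous_on_openin_cover:
  fixes h :: "'b::topological_space \<Rightarrow> 'c::topological_space"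
  assumes "\<And>T. T \<in> F \<Longrightarrow> openin (top_of_set S) T" "\<Union>F = S" "\<And>T. T \<in> F \<Longrightarrow> continuous_on T h"
  shows "continuous_on S h"
  unfolding continuous_on_open_invariant
proof (intro allI impI)
  fix B :: "'c set" assume B: "open B"
  have "\<exists>W. open W \<and> W \<inter> T = h -` B \<inter> T" if "T \<in> F" for T
    using assms(3)[OF that] B unfolding continuous_on_open_invariant by blast
  then obtain W where W: "\<And>T. T \<in> F \<Longrightarrow> open (W T) \<and> W T \<inter> T = h -` B \<inter> T" by metis
  have "\<exists>U. open U \<and> T = S \<inter> U" if "T \<in> F" for T
    using assms(1)[OF that] unfolding openin_open .
  then obtain U where U: "\<And>T. T \<in> F \<Longrightarrow> open (U T) \<and> T = S \<inter> U T" by metis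
  have "open (\<Union>T\<in>F. W T \<inter> U T)" using W U by blast
  moreover have "(\<Union>T\<in>F. W T \<inter> U T) \<inter> S = h -` B \<inter> S"
  proof (intro equalityI subsetI)
    fix x assume "x \<in> (\<Union>T\<in>F. W T \<inter> U T) \<inter> S"
    then obtain T where "T \<in> F" "x \<in> W T" "x \<in> U T" "x \<in> S" by blast
    then show "x \<in> h -` B \<inter> S" using W[of T] U[of T] by blast
  next
    fix x assume x: "x \<in> h -` B \<inter> S"
    then obtain T where T: "T \<in> F" "x \<in> T" using assms(2) by blast
    then have "x \<in> W T" "x \<in> U T" using W[of T] U[of T] x by blast+
    then show "x \<in> (\<Union>T\<in>F. W T \<inter> U T) \<inter> S" using T x by blast
  qed
  ultimately show "\<exists>A. open A \<and> A \<inter> S = h -` B \<inter> S" by blast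
qed

context riemannian_space
begin

subsection \<open>Integrability in charts\<close>

text \<open>The field with lowered index, in coordinates. \<open>weak_gradient\<close> tests these
  components against partial derivatives, so limits and uniqueness are settled for them.\<close>

definition covector :: "('a, 'n) vfield \<Rightarrow> ('a, 'n) chart \<Rightarrow> real^'n \<Rightarrow> real^'n" where
  "covector X c x = gram M c x *v X c (uncoord c x)"

lemma codom_borel: "c \<in> atlas M \<Longrightarrow> codom c \<in> sets borel"
  by (rule half_open_borel[OF chart_half_open])

lemma covector_measurable:
  assumes "vector_field M X" "c \<in> atlas M"
  shows "covector X c \<in> borel_measurable (restrict_space borel (codom c))"
  unfolding covector_def[abs_def]
  by (intro borel_measurable_matrix_vector borel_measurable_gram assms(2)
      measurable_compose[OF uncoord_measurable[OF assms(2)] vector_field_measurable[OF assms]])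

text \<open>The density of the volume is bounded below on compact parts of a chart. The order of
  quantifiers matters: one \<open>B\<close> serves all \<open>f\<close>, so convergence in mean on
  the manifold becomes convergence in mean on \<open>K\<close>.\<close>

lemma chart_integrable:
  assumes c: "c \<in> atlas M" and K: "compact K" "K \<subseteq> codom c"
  shows "\<exists>B. \<forall>f::'a \<Rightarrow> real. integrable vol f \<longrightarrow> set_integrable lborel K (\<lambda>x. f (uncoord c x)) \<and>
    (LINT x:K|lborel. \<bar>f (uncoord c x)\<bar>) \<le> B * (\<integral>p. \<bar>f p\<bar> \<partial>vol)"
proof -
  obtain B where B: "B > 0" "\<And>h. h \<in> borel_measurable vol \<Longrightarrow>
    (\<integral>\<^sup>+x. h (uncoord c x) * indicator K x \<partial>lborel) \<le> ennreal B * (\<integral>\<^sup>+p. h p \<partial>vol)"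
    using compact_chart_nn_integral_le[OF c K] by metis
  show ?thesis
  proof (intro exI[of _ B] allI impI)
    fix f :: "'a \<Rightarrow> real" assume f: "integrable vol f"
    have fm: "f \<in> borel_measurable vol" using f by simp
    have m: "(\<lambda>x. indicator K x *\<^sub>R f (uncoord c x)) \<in> borel_measurable borel"
      by (rule borel_measurable_restrict_indicator[OF borel_measurable_uncoord[OF
              borel_measurable_vol_restrict[OF fm c] c] codom_borel[OF c] _ K(2)])
        (use K(1) in \<open>simp add: borel_compact\<close>)
    have "(\<integral>\<^sup>+x. ennreal (norm (indicator K x *\<^sub>R f (uncoord c x))) \<partial>lborel)
        = (\<integral>\<^sup>+x. (\<lambda>p. ennreal \<bar>f p\<bar>) (uncoord c x) * indicator K x \<partial>lborel)"
      by (intro nn_integral_cong) (auto split: split_indicator)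
    also have "\<dots> \<le> ennreal B * (\<integral>\<^sup>+p. ennreal \<bar>f p\<bar> \<partial>vol)"
      using fm by (intro B(2)) simp
    also have "(\<integral>\<^sup>+p. ennreal \<bar>f p\<bar> \<partial>vol) = ennreal (\<integral>p. \<bar>f p\<bar> \<partial>vol)"
      by (rule nn_integral_eq_integral) (use f in auto)
    also have "ennreal B * \<dots> = ennreal (B * (\<integral>p. \<bar>f p\<bar> \<partial>vol))"
      using B(1) by (simp add: ennreal_mult)
    finally have le: "(\<integral>\<^sup>+x. ennreal (norm (indicator K x *\<^sub>R f (uncoord c x))) \<partial>lborel)
        \<le> ennreal (B * (\<integral>p. \<bar>f p\<bar> \<partial>vol))" .
    have i: "integrable lborel (\<lambda>x. indicator K x *\<^sub>R f (uncoord c x))"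
      using m le by (intro integrableI_bounded) (auto simp: less_top[symmetric] top_unique)
    have "ennreal (\<integral>x. norm (indicator K x *\<^sub>R f (uncoord c x)) \<partial>lborel) \<le> ennreal (B * (\<integral>p. \<bar>f p\<bar> \<partial>vol))"
      using le nn_integral_eq_integral[OF integrable_norm[OF i]] by simp
    then have "(\<integral>x. norm (indicator K x *\<^sub>R f (uncoord c x)) \<partial>lborel) \<le> B * (\<integral>p. \<bar>f p\<bar> \<partial>vol)"
      using B(1) by (subst (asm) ennreal_le_iff) (auto intro!: mult_nonneg_nonneg Bochner_Integration.integral_nonneg)
    also have "(\<lambda>x. norm (indicator K x *\<^sub>R f (uncoord c x))) = (\<lambda>x. indicator K x *\<^sub>R \<bar>f (uncoord c x)\<bar>)"
      by (auto simp: fun_eq_iff split: split_indicator)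
    finally show "set_integrable lborel K (\<lambda>x. f (uncoord c x)) \<and>
        (LINT x:K|lborel. \<bar>f (uncoord c x)\<bar>) \<le> B * (\<integral>p. \<bar>f p\<bar> \<partial>vol)"
      using i unfolding set_integrable_def set_lebesgue_integral_def by blast
  qed
qed

text \<open>By continuity the entries of the Gram matrix are bounded on \<open>K\<close>, which
  bounds the lowered field by its metric norm with one constant for all fields.\<close>

lemma covector_bound:
  assumes c: "c \<in> atlas M" and K: "compact K" "K \<subseteq> codom c"
  shows "\<exists>B. \<forall>X. vector_field M X \<longrightarrow> (\<forall>x\<in>K. norm (covector X c x) \<le> B * vnorm M X (uncoord c x))"
proof -
  have "continuous_on K (\<lambda>x. \<Sum>i\<in>UNIV. norm (gram M c x $ i))"
    by (intro continuous_intros continuous_on_subset[OF continuous_gram[OF c] K(2)])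
  then obtain L where L: "\<And>x. x \<in> K \<Longrightarrow> norm (\<Sum>i\<in>UNIV. norm (gram M c x $ i)) \<le> L"
    using continuous_on_compact_bound[OF K(1)] by metis
  show ?thesis
  proof (intro exI[of _ "sqrt L"] allI impI ballI)
    fix X x assume X: "vector_field M X" and x: "x \<in> K"
    have xc: "x \<in> codom c" using x K(2) by blast
    have "(\<Sum>i\<in>UNIV. norm (gram M c x $ i)) \<le> L" using L[OF x] by simp
    from norm_lower_le_gnorm[OF gram_posdef[OF c xc] this, of "X c (uncoord c x)"]
    show "norm (covector X c x) \<le> sqrt L * vnorm M X (uncoord c x)"
      unfolding covector_def vnorm_chart[OF X c uncoord_in_dom[OF xc]] coord_uncoord[OF xc] .
  qed
qed

lemma covector_integrable:
  assumes c: "c \<in> atlas M" and K: "compact K" "K \<subseteq> codom c"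
  shows "\<exists>B. \<forall>X. vector_field M X \<longrightarrow> integrable vol (vnorm M X) \<longrightarrow>
    set_integrable lborel K (covector X c) \<and>
    (LINT x:K|lborel. norm (covector X c x)) \<le> B * (\<integral>p. \<bar>vnorm M X p\<bar> \<partial>vol)"
proof -
  obtain B where B: "\<And>f::'a \<Rightarrow> real. integrable vol f \<Longrightarrow> set_integrable lborel K (\<lambda>x. f (uncoord c x)) \<and>
    (LINT x:K|lborel. \<bar>f (uncoord c x)\<bar>) \<le> B * (\<integral>p. \<bar>f p\<bar> \<partial>vol)"
    using chart_integrable[OF c K] by metis
  obtain L where L: "\<And>X x. vector_field M X \<Longrightarrow> x \<in> K \<Longrightarrow> norm (covector X c x) \<le> L * vnorm M X (uncoord c x)"
    using covector_bound[OF c K] by metis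
  show ?thesis
  proof (intro exI[of _ "\<bar>L\<bar> * B"] allI impI)
    fix X assume X: "vector_field M X" "integrable vol (vnorm M X)"
    let ?v = "\<lambda>x. \<bar>vnorm M X (uncoord c x)\<bar>"
    have L': "norm (covector X c x) \<le> \<bar>L\<bar> * ?v x" if "x \<in> K" for x
      using L[OF X(1) that] abs_ge_self[of "L * vnorm M X (uncoord c x)"] by (simp add: abs_mult)
    have v: "set_integrable lborel K (\<lambda>x. \<bar>L\<bar> * ?v x)"
      using B[OF X(2)] by (intro set_integrable_mult_right set_integrable_abs) blast
    have m: "(\<lambda>x. indicator K x *\<^sub>R covector X c x) \<in> borel_measurable borel"
      by (rule borel_measurable_restrict_indicator[OF covector_measurable[OF X(1) c] codom_borel[OF c] _ K(2)])
        (use K(1) in \<open>simp add: borel_compact\<close>)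
    have i: "set_integrable lborel K (covector X c)"
      unfolding set_integrable_def
    proof (rule Bochner_Integration.integrable_bound[OF v[unfolded set_integrable_def]])
      show "AE x in lborel. norm (indicator K x *\<^sub>R covector X c x) \<le> norm (indicator K x *\<^sub>R (\<bar>L\<bar> * ?v x))"
        using L' by (intro AE_I2) (auto split: split_indicator)
    qed (use m in simp)
    have "(LINT x:K|lborel. norm (covector X c x)) \<le> (LINT x:K|lborel. \<bar>L\<bar> * ?v x)"
      by (rule set_integral_mono[OF set_integrable_norm[OF i] v L'])
    also have "\<dots> = \<bar>L\<bar> * (LINT x:K|lborel. ?v x)" by (rule set_integral_mult_right)
    also have "\<dots> \<le> \<bar>L\<bar> * (B * (\<integral>p. \<bar>vnorm M X p\<bar> \<partial>vol))"
      using B[OF X(2)] by (intro mult_left_mono) auto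
    finally show "set_integrable lborel K (covector X c) \<and>
      (LINT x:K|lborel. norm (covector X c x)) \<le> \<bar>L\<bar> * B * (\<integral>p. \<bar>vnorm M X p\<bar> \<partial>vol)"
      using i by (simp add: mult.assoc)
  qed
qed

subsection \<open>Weak gradients\<close>

lemma weak_gradient_iff:
  "weak_gradient M f X \<longleftrightarrow> vector_field M X \<and>
     (\<forall>c\<in>atlas M.
        (\<forall>K. compact K \<and> K \<subseteq> interior (codom c) \<longrightarrow>
           set_integrable lborel K (\<lambda>x. f (uncoord c x)) \<and> set_integrable lborel K (covector X c)) \<and>
        (\<forall>\<psi> i. test_function (interior (codom c)) \<psi> \<longrightarrow>
           (LINT x:interior (codom c)|lborel. f (uncoord c x) * frechet_derivative \<psi> (at x) (axis i 1)) =
           - (LINT x:interior (codom c)|lborel. covector X c x $ i * \<psi> x)))"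
  unfolding weak_gradient_def Let_def covector_def[abs_def] ..

lemma weak_gradientD:
  assumes "weak_gradient M f X"
  shows "vector_field M X"
    and "\<And>c K. c \<in> atlas M \<Longrightarrow> compact K \<Longrightarrow> K \<subseteq> interior (codom c) \<Longrightarrow>
      set_integrable lborel K (\<lambda>x. f (uncoord c x))"
    and "\<And>c K. c \<in> atlas M \<Longrightarrow> compact K \<Longrightarrow> K \<subseteq> interior (codom c) \<Longrightarrow>
      set_integrable lborel K (covector X c)"
    and "\<And>c \<psi> i. c \<in> atlas M \<Longrightarrow> test_function (interior (codom c)) \<psi> \<Longrightarrow>
      (LINT x:interior (codom c)|lborel. f (uncoord c x) * frechet_derivative \<psi> (at x) (axis i 1)) =
       - (LINT x:interior (codom c)|lborel. covector X c x $ i * \<psi> x)"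
  using assms unfolding weak_gradient_iff by blast+

lemma vector_field_transition:
  assumes "vector_field M X" "c \<in> atlas M" "d \<in> atlas M" "p \<in> dom c \<inter> dom d"
    "(transition c d has_derivative D) (at (coord c p) within overlap c d)"
  shows "X d p = D (X c p)"
  using assms unfolding vector_field_def by metis

lemma vector_field_diff:
  assumes X: "vector_field M X" and Y: "vector_field M Y"
  shows "vector_field M (\<lambda>c p. X c p - Y c p)"
  unfolding vector_field_def
proof (intro conjI ballI allI impI)
  fix c assume c: "c \<in> atlas M"
  show "(\<lambda>p. X c p - Y c p) \<in> borel_measurable (restrict_space borel (dom c))"
    by (intro borel_measurable_diff vector_field_measurable X Y c)
next
  fix c d p D
  assume *: "c \<in> atlas M" "d \<in> atlas M" "p \<in> dom c \<inter> dom d"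
    "(transition c d has_derivative D) (at (coord c p) within overlap c d)"
  have "X d p = D (X c p)" "Y d p = D (Y c p)"
    using vector_field_transition[OF X *] vector_field_transition[OF Y *] .
  then show "X d p - Y d p = D (X c p - Y c p)"
    using linear_diff[OF has_derivative_linear[OF *(4)]] by simp
qed

lemma vector_field_scale:
  assumes X: "vector_field M X" and a: "a \<in> borel_measurable vol"
  shows "vector_field M (\<lambda>c p. a p *\<^sub>R X c p)"
  unfolding vector_field_def
proof (intro conjI ballI allI impI)
  fix c assume c: "c \<in> atlas M"
  show "(\<lambda>p. a p *\<^sub>R X c p) \<in> borel_measurable (restrict_space borel (dom c))"
    by (intro borel_measurable_scaleR borel_measurable_vol_restrict[OF a] vector_field_measurable X c)
next
  fix c d p D
  assume *: "c \<in> atlas M" "d \<in> atlas M" "p \<in> dom c \<inter> dom d"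
    "(transition c d has_derivative D) (at (coord c p) within overlap c d)"
  have "X d p = D (X c p)" by (rule vector_field_transition[OF X *])
  then show "a p *\<^sub>R X d p = D (a p *\<^sub>R X c p)"
    using linear_cmul[OF has_derivative_linear[OF *(4)]] by simp
qed

lemma vnorm_nonneg:
  assumes X: "vector_field M X" and p: "p \<in> points M"
  shows "0 \<le> vnorm M X p"
proof -
  obtain c where c: "c \<in> atlas M" "p \<in> dom c" using point_chart[OF p] by blast
  show ?thesis unfolding vnorm_chart[OF X c] using c by (intro gnorm_nonneg gram_posdef) auto
qed

lemma vnorm_scale:
  "vnorm M (\<lambda>c p. a p *\<^sub>R X c p) p = \<bar>a p\<bar> * vnorm M X p"
  by (simp only: vnorm_def Let_def gnorm_def[symmetric] gnorm_scaleR)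

lemma vnorm_add_le:
  assumes X: "vector_field M X" and Y: "vector_field M Y" and Z: "vector_field M Z"
    and p: "p \<in> points M" and eq: "\<And>c. c \<in> atlas M \<Longrightarrow> p \<in> dom c \<Longrightarrow> Z c p = X c p + Y c p"
  shows "vnorm M Z p \<le> vnorm M X p + vnorm M Y p"
proof -
  obtain c where c: "c \<in> atlas M" "p \<in> dom c" using point_chart[OF p] by blast
  have "posdef (gram M c (coord c p))" using c by (intro gram_posdef) auto
  from gnorm_triangle[OF this] show ?thesis
    unfolding vnorm_chart[OF X c] vnorm_chart[OF Y c] vnorm_chart[OF Z c] eq[OF c] .
qed

lemma covector_diff:
  "covector (\<lambda>c p. X c p - Y c p) c x = covector X c x - covector Y c x"
  by (simp add: covector_def matrix_vector_mult_diff_distrib)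

lemma weak_gradient_diff:
  assumes f: "weak_gradient M f X" and g: "weak_gradient M g Y"
  shows "weak_gradient M (\<lambda>p. f p - g p) (\<lambda>c p. X c p - Y c p)"
  unfolding weak_gradient_iff
proof (intro conjI ballI allI impI; (elim conjE)?)
  show "vector_field M (\<lambda>c p. X c p - Y c p)"
    by (rule vector_field_diff[OF weak_gradientD(1)[OF f] weak_gradientD(1)[OF g]])
  fix c assume c: "c \<in> atlas M"
  show "set_integrable lborel K (\<lambda>x. f (uncoord c x) - g (uncoord c x))"
    if "compact K" "K \<subseteq> interior (codom c)" for K
    using weak_gradientD(2)[OF f c that] weak_gradientD(2)[OF g c that] by (rule set_integral_diff)
  show "set_integrable lborel K (covector (\<lambda>c p. X c p - Y c p) c)"
    if "compact K" "K \<subseteq> interior (codom c)" for K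
    unfolding covector_diff[abs_def]
    using weak_gradientD(3)[OF f c that] weak_gradientD(3)[OF g c that] by (rule set_integral_diff)
  fix \<psi> i assume \<psi>: "test_function (interior (codom c)) \<psi>"
  then obtain K where K: "compact K" "K \<subseteq> interior (codom c)" "\<And>x. x \<notin> K \<Longrightarrow> \<psi> x = 0"
    "\<And>x. (\<psi> has_derivative frechet_derivative \<psi> (at x)) (at x)"
    "\<And>v. continuous_on UNIV (\<lambda>x. frechet_derivative \<psi> (at x) v)"
    "continuous_on UNIV \<psi>" "\<And>x v. x \<notin> K \<Longrightarrow> frechet_derivative \<psi> (at x) v = 0"
    by (rule test_function_support) (rule that; simp)
  let ?D = "\<lambda>x. frechet_derivative \<psi> (at x) (axis i 1)"
  \<comment> \<open>Integrability is known only on compact sets, so integrals over the open set are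
    first reduced to the support \<open>K\<close> of the test function.\<close>
  note s = set_integral_support[where N = lborel, OF K(2)]
  note fi = set_integrable_mult_continuous[OF K(1) weak_gradientD(2)[OF f c K(1,2)] K(5)]
  note gi = set_integrable_mult_continuous[OF K(1) weak_gradientD(2)[OF g c K(1,2)] K(5)]
  note Xi = set_integrable_mult_continuous[OF K(1) set_integrable_vec_nth[OF weak_gradientD(3)[OF f c K(1,2)]] K(6)]
  note Yi = set_integrable_mult_continuous[OF K(1) set_integrable_vec_nth[OF weak_gradientD(3)[OF g c K(1,2)]] K(6)]
  have f': "(LINT x:K|lborel. f (uncoord c x) * ?D x) = - (LINT x:K|lborel. covector X c x $ i * \<psi> x)"
    using weak_gradientD(4)[OF f c \<psi>, of i] s[of ?D] s[of \<psi>] K(3,7) by simp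
  have g': "(LINT x:K|lborel. g (uncoord c x) * ?D x) = - (LINT x:K|lborel. covector Y c x $ i * \<psi> x)"
    using weak_gradientD(4)[OF g c \<psi>, of i] s[of ?D] s[of \<psi>] K(3,7) by simp
  have "(LINT x:K|lborel. (f (uncoord c x) - g (uncoord c x)) * ?D x)
      = - (LINT x:K|lborel. covector (\<lambda>c p. X c p - Y c p) c x $ i * \<psi> x)"
    using f' g' set_integral_diff(2)[OF fi gi] set_integral_diff(2)[OF Xi Yi]
    by (simp add: covector_diff left_diff_distrib)
  then show "(LINT x:interior (codom c)|lborel. (f (uncoord c x) - g (uncoord c x)) * ?D x)
      = - (LINT x:interior (codom c)|lborel. covector (\<lambda>c p. X c p - Y c p) c x $ i * \<psi> x)"
    using s[of ?D] s[of \<psi>] K(3,7) by simp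
qed

text \<open>The difference of two weak gradients of \<open>f\<close> is a weak gradient of zero. The
  fundamental lemma annihilates its lowered components, and the Gram matrix is injective. Since
  \<open>wgrad\<close> is an arbitrary choice, this makes the norm of the gradient well defined up
  to null sets.\<close>

lemma weak_gradient_unique:
  assumes X: "weak_gradient M f X" and Y: "weak_gradient M f Y"
  shows "AE p in vol. vnorm M X p = vnorm M Y p"
proof (rule AE_vol_charts)
  fix c assume c: "c \<in> atlas M"
  let ?V = "interior (codom c)" and ?Z = "\<lambda>c p. X c p - Y c p"
  have Z: "weak_gradient M (\<lambda>p. f p - f p) ?Z" by (rule weak_gradient_diff[OF X Y])
  have comp: "AE x in lborel. x \<in> ?V \<longrightarrow> covector ?Z c x $ i = 0" for i
  proof (rule test_function_integrals_zero_imp_AE_zero)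
    show "set_integrable lborel K (\<lambda>x. covector ?Z c x $ i)" if "compact K" "K \<subseteq> ?V" for K
      by (rule set_integrable_vec_nth[OF weak_gradientD(3)[OF Z c that]])
    show "(LINT x:?V|lborel. covector ?Z c x $ i * \<psi> x) = 0" if "test_function ?V \<psi>" for \<psi>
      using weak_gradientD(4)[OF Z c that, of i] by (simp add: set_lebesgue_integral_def)
  qed simp
  have "AE x in lborel. \<forall>i\<in>UNIV. x \<in> ?V \<longrightarrow> covector ?Z c x $ i = 0"
    using comp by (subst AE_ball_countable) auto
  then show "AE x in lborel. x \<in> ?V \<longrightarrow> vnorm M X (uncoord c x) = vnorm M Y (uncoord c x)"
  proof eventually_elim
    case (elim x)
    show ?case
    proof
      assume "x \<in> ?V"
      then have x: "x \<in> codom c" using interior_subset by blast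
      have "covector X c x = covector Y c x"
        using elim \<open>x \<in> ?V\<close> unfolding covector_diff by (simp add: vec_eq_iff)
      then have "X c (uncoord c x) = Y c (uncoord c x)"
        unfolding covector_def by (rule posdef_injective[OF gram_posdef[OF c x]])
      then show "vnorm M X (uncoord c x) = vnorm M Y (uncoord c x)"
        using vnorm_chart[OF weak_gradientD(1)[OF X] c uncoord_in_dom[OF x]]
          vnorm_chart[OF weak_gradientD(1)[OF Y] c uncoord_in_dom[OF x]] by simp
    qed
  qed
qed

text \<open>The weak formulation is linear and its test functions are bounded with compact support,
  so it survives convergence in mean of the functions and of the gradients. Gradients are compared
  through the norm of their difference field.\<close>

lemma weak_gradient_limit:
  assumes f: "integrable vol f" and Y: "vector_field M Y" "integrable vol (vnorm M Y)"
    and v: "\<And>n. weak_gradient M (v n) (X n)" "\<And>n. integrable vol (v n)"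
      "\<And>n. integrable vol (vnorm M (X n))"
      "\<And>n. integrable vol (vnorm M (\<lambda>c p. Y c p - X n c p))"
    and lim: "(\<lambda>n. \<integral>p. \<bar>f p - v n p\<bar> \<partial>vol) \<longlonglongrightarrow> 0"
      "(\<lambda>n. \<integral>p. vnorm M (\<lambda>c p. Y c p - X n c p) p \<partial>vol) \<longlonglongrightarrow> 0"
  shows "weak_gradient M f Y"
  unfolding weak_gradient_iff
proof (intro conjI ballI allI impI; (elim conjE)?)
  show "vector_field M Y" by fact
  fix c assume c: "c \<in> atlas M"
  have int: "interior (codom c) \<subseteq> codom c" by (rule interior_subset)
  show fi: "set_integrable lborel K (\<lambda>x. f (uncoord c x))"
    if K: "compact K" "K \<subseteq> interior (codom c)" for K
    using chart_integrable[OF c K(1) order_trans[OF K(2) int]] f by blast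
  show Yi: "set_integrable lborel K (covector Y c)"
    if K: "compact K" "K \<subseteq> interior (codom c)" for K
    using covector_integrable[OF c K(1) order_trans[OF K(2) int]] Y by blast
  fix \<psi> i assume \<psi>: "test_function (interior (codom c)) \<psi>"
  then obtain K where K: "compact K" "K \<subseteq> interior (codom c)" "\<And>x. x \<notin> K \<Longrightarrow> \<psi> x = 0"
    "\<And>x. (\<psi> has_derivative frechet_derivative \<psi> (at x)) (at x)"
    "\<And>v. continuous_on UNIV (\<lambda>x. frechet_derivative \<psi> (at x) v)"
    "continuous_on UNIV \<psi>" "\<And>x v. x \<notin> K \<Longrightarrow> frechet_derivative \<psi> (at x) v = 0"
    by (rule test_function_support) (rule that; simp)
  have Kc: "K \<subseteq> codom c" using K(2) int by blast
  let ?D = "\<lambda>x. frechet_derivative \<psi> (at x) (axis i 1)"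
  note s = set_integral_support[where N = lborel, OF K(2)]
  have eq: "(LINT x:K|lborel. v n (uncoord c x) * ?D x) = - (LINT x:K|lborel. covector (X n) c x $ i * \<psi> x)" for n
    using weak_gradientD(4)[OF v(1) c \<psi>, of n i] s[of ?D] s[of \<psi>] K(3,7) by simp
  obtain B where B: "\<And>f::'a \<Rightarrow> real. integrable vol f \<Longrightarrow>
    (LINT x:K|lborel. \<bar>f (uncoord c x)\<bar>) \<le> B * (\<integral>p. \<bar>f p\<bar> \<partial>vol)"
    using chart_integrable[OF c K(1) Kc] by metis
  obtain L where L: "\<And>X. vector_field M X \<Longrightarrow> integrable vol (vnorm M X) \<Longrightarrow>
    set_integrable lborel K (covector X c) \<and>
    (LINT x:K|lborel. norm (covector X c x)) \<le> L * (\<integral>p. \<bar>vnorm M X p\<bar> \<partial>vol)"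
    using covector_integrable[OF c K(1) Kc] by metis
  have l1: "(\<lambda>n. LINT x:K|lborel. v n (uncoord c x) * ?D x) \<longlonglongrightarrow> (LINT x:K|lborel. f (uncoord c x) * ?D x)"
  proof (rule set_integral_mult_continuous_tendsto[OF K(1) fi[OF K(1,2)] weak_gradientD(2)[OF v(1) c K(1,2)] K(5)])
    have "(\<lambda>n. B * (\<integral>p. \<bar>f p - v n p\<bar> \<partial>vol)) \<longlonglongrightarrow> 0"
      using tendsto_mult_left[OF lim(1), of B] by simp
    then show "(\<lambda>n. LINT x:K|lborel. \<bar>f (uncoord c x) - v n (uncoord c x)\<bar>) \<longlonglongrightarrow> 0"
    proof (rule Lim_null_comparison[rotated], intro always_eventually allI)
      fix n
      have "0 \<le> (LINT x:K|lborel. \<bar>f (uncoord c x) - v n (uncoord c x)\<bar>)"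
        unfolding set_lebesgue_integral_def by (intro Bochner_Integration.integral_nonneg) simp
      then show "norm (LINT x:K|lborel. \<bar>f (uncoord c x) - v n (uncoord c x)\<bar>) \<le> B * (\<integral>p. \<bar>f p - v n p\<bar> \<partial>vol)"
        using B[of "\<lambda>p. f p - v n p"] f v(2) by simp
    qed
  qed
  have Xi: "set_integrable lborel K (\<lambda>x. covector (X n) c x $ i)" for n
    by (rule set_integrable_vec_nth[OF weak_gradientD(3)[OF v(1) c K(1,2)]])
  have l2: "(\<lambda>n. LINT x:K|lborel. covector (X n) c x $ i * \<psi> x) \<longlonglongrightarrow> (LINT x:K|lborel. covector Y c x $ i * \<psi> x)"
  proof (rule set_integral_mult_continuous_tendsto[OF K(1) set_integrable_vec_nth[OF Yi[OF K(1,2)]] Xi K(6)])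
    have "(\<lambda>n. L * (\<integral>p. vnorm M (\<lambda>c p. Y c p - X n c p) p \<partial>vol)) \<longlonglongrightarrow> 0"
      using tendsto_mult_left[OF lim(2), of L] by simp
    then show "(\<lambda>n. LINT x:K|lborel. \<bar>covector Y c x $ i - covector (X n) c x $ i\<bar>) \<longlonglongrightarrow> 0"
    proof (rule Lim_null_comparison[rotated], intro always_eventually allI)
      fix n
      let ?Z = "\<lambda>c p. Y c p - X n c p"
      have Z: "vector_field M ?Z" by (rule vector_field_diff[OF Y(1) weak_gradientD(1)[OF v(1)]])
      note L' = L[OF Z v(4)]
      have "(\<integral>p. \<bar>vnorm M ?Z p\<bar> \<partial>vol) = (\<integral>p. vnorm M ?Z p \<partial>vol)"
        by (rule Bochner_Integration.integral_cong[OF refl]) (use vnorm_nonneg[OF Z] in \<open>simp add: space_vol\<close>)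
      then have n: "(LINT x:K|lborel. norm (covector ?Z c x)) \<le> L * (\<integral>p. vnorm M ?Z p \<partial>vol)"
        using L' by simp
      have "(LINT x:K|lborel. \<bar>covector ?Z c x $ i\<bar>) \<le> (LINT x:K|lborel. norm (covector ?Z c x))"
        by (rule set_integral_mono)
          (use L' in \<open>auto intro: set_integrable_abs set_integrable_norm set_integrable_vec_nth component_le_norm_cart\<close>)
      moreover have "0 \<le> (LINT x:K|lborel. \<bar>covector ?Z c x $ i\<bar>)"
        unfolding set_lebesgue_integral_def by (intro Bochner_Integration.integral_nonneg) simp
      ultimately show "norm (LINT x:K|lborel. \<bar>covector Y c x $ i - covector (X n) c x $ i\<bar>)
          \<le> L * (\<integral>p. vnorm M ?Z p \<partial>vol)"
        using n by (simp add: covector_diff)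
    qed
  qed
  have "(LINT x:K|lborel. f (uncoord c x) * ?D x) = - (LINT x:K|lborel. covector Y c x $ i * \<psi> x)"
    using LIMSEQ_unique[OF l1] tendsto_minus[OF l2] eq by simp
  then show "(LINT x:interior (codom c)|lborel. f (uncoord c x) * ?D x)
      = - (LINT x:interior (codom c)|lborel. covector Y c x $ i * \<psi> x)"
    using s[of ?D] s[of \<psi>] K(3,7) by simp
qed

end

lemma linear_axis_expansion:
  fixes f :: "real^'n \<Rightarrow> real"
  assumes "linear f"
  shows "f v = v \<bullet> (\<chi> i. f (axis i 1))"
proof -
  have "f v = f (\<Sum>i\<in>UNIV. v $ i *s axis i 1)" by (simp only: basis_expansion)
  also have "\<dots> = (\<Sum>i\<in>UNIV. v $ i * f (axis i 1))"
    by (simp add: linear_sum[OF assms] linear_cmul[OF assms] scalar_mult_eq_scaleR)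
  finally show ?thesis by (simp add: inner_vec_def)
qed

lemma has_derivative_axis_expansion:
  fixes f :: "real^'n \<Rightarrow> real"
  assumes "(f has_derivative D) F"
  shows "(f has_derivative (\<lambda>v. v \<bullet> (\<chi> i. D (axis i 1)))) F"
proof -
  have "D = (\<lambda>v. v \<bullet> (\<chi> i. D (axis i 1)))"
    using linear_axis_expansion[OF has_derivative_linear[OF assms]] by (rule ext)
  with assms show ?thesis by (rule back_subst)
qed

context riemannian_space
begin

subsection \<open>Gradients of smooth functions\<close>

text \<open>Derivatives are taken within the whole chart range, where they are unique; boundary points
  then need no separate treatment. Cramer's formula makes the continuity of the gradient evident.\<close>

definition smooth_fun :: "('a \<Rightarrow> real) \<Rightarrow> bool" where
  "smooth_fun u \<longleftrightarrow> (\<forall>c\<in>atlas M. smooth_on (codom c) (u \<circ> uncoord c))"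

definition coord_grad :: "('a, 'n) chart \<Rightarrow> ('a \<Rightarrow> real) \<Rightarrow> real^'n \<Rightarrow> real^'n" where
  "coord_grad c u x = (\<chi> i. frechet_derivative (u \<circ> uncoord c) (at x within codom c) (axis i 1))"

definition smooth_grad :: "('a \<Rightarrow> real) \<Rightarrow> ('a, 'n) vfield" where
  "smooth_grad u c p = cramer_solution (gram M c (coord c p)) (coord_grad c u (coord c p))"

lemma smooth_funD: "smooth_fun u \<Longrightarrow> c \<in> atlas M \<Longrightarrow> smooth_on (codom c) (u \<circ> uncoord c)"
  by (simp add: smooth_fun_def)

lemma smooth_fun_has_derivative:
  assumes u: "smooth_fun u" and c: "c \<in> atlas M" and x: "x \<in> codom c"
  shows "(u \<circ> uncoord c has_derivative (\<lambda>v. v \<bullet> coord_grad c u x)) (at x within codom c)"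
proof -
  have "\<exists>D. (u \<circ> uncoord c has_derivative D) (at x within codom c)"
    by (rule smooth_on_has_derivative[OF smooth_funD[OF u c] x])
  then have "u \<circ> uncoord c differentiable (at x within codom c)" by (simp only: differentiable_def)
  then have d: "(u \<circ> uncoord c has_derivative frechet_derivative (u \<circ> uncoord c) (at x within codom c))
      (at x within codom c)"
    using frechet_derivative_works by blast
  show ?thesis
    unfolding coord_grad_def by (rule has_derivative_axis_expansion[OF d])
qed

lemma coord_grad_eqI:
  assumes u: "smooth_fun u" and c: "c \<in> atlas M" and x: "x \<in> codom c"
    and d: "(u \<circ> uncoord c has_derivative (\<lambda>v. v \<bullet> w)) (at x within codom c)"
  shows "coord_grad c u x = w"
proof -
  have "(\<lambda>v. v \<bullet> coord_grad c u x) = (\<lambda>v. v \<bullet> w)"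
    by (rule has_derivative_unique_half_open[OF chart_half_open[OF c] x smooth_fun_has_derivative[OF u c x] d])
  then show ?thesis by (metis vector_eq_ldot)
qed

lemma continuous_smooth_fun_chart:
  assumes "smooth_fun u" "c \<in> atlas M"
  shows "continuous_on (codom c) (\<lambda>x. u (uncoord c x))"
  using smooth_on_continuous_on[OF smooth_funD[OF assms]] by (simp add: comp_def)

text \<open>Near each point the derivative within the chart range agrees, by uniqueness, with that
  of a smooth local extension; continuity is glued over these neighbourhoods.\<close>

lemma continuous_coord_grad:
  assumes u: "smooth_fun u" and c: "c \<in> atlas M"
  shows "continuous_on (codom c) (coord_grad c u)"
proof (rule continuous_on_openin_cover[where
      F = "{T. openin (top_of_set (codom c)) T \<and> continuous_on T (coord_grad c u)}"])
  have "\<exists>T. openin (top_of_set (codom c)) T \<and> continuous_on T (coord_grad c u) \<and> x \<in> T"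
    if x: "x \<in> codom c" for x
  proof -
    obtain U F where U: "open U" "x \<in> U" "\<forall>k. Ck_on k U F"
      "\<forall>y\<in>codom c \<inter> U. (u \<circ> uncoord c has_derivative frechet_derivative F (at y)) (at y within codom c)"
      using smooth_on_differentiable[OF smooth_funD[OF u c] x] by (elim exE conjE)
    have eq: "coord_grad c u y = (\<chi> i. frechet_derivative F (at y) (axis i 1))" if "y \<in> codom c \<inter> U" for y
    proof -
      have d: "(u \<circ> uncoord c has_derivative frechet_derivative F (at y)) (at y within codom c)"
        using U(4) that by (rule bspec)
      show ?thesis
        by (rule coord_grad_eqI[OF u c IntD1[OF that] has_derivative_axis_expansion[OF d]])
    qed
    have "continuous_on (codom c \<inter> U) (\<lambda>y. \<chi> i. frechet_derivative F (at y) (axis i 1))"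
    proof (intro continuous_on_vec_lambda continuous_on_subset[OF _ Int_lower2])
      fix i
      have "Ck_on (Suc 0) U F" using U(3) by (rule spec)
      then have "Ck_on 0 U (\<lambda>x. frechet_derivative F (at x) (axis i 1))" by (rule Ck_on_SucE(2))
      then show "continuous_on U (\<lambda>y. frechet_derivative F (at y) (axis i 1))" by (simp only: Ck_on.simps)
    qed
    then have "continuous_on (codom c \<inter> U) (coord_grad c u)"
      by (rule continuous_on_cong[THEN iffD2, OF refl, rotated]) (rule eq)
    then show ?thesis using U(1,2) x by (intro exI[of _ "codom c \<inter> U"]) (simp add: openin_open_Int)
  qed
  then show "\<Union>{T. openin (top_of_set (codom c)) T \<and> continuous_on T (coord_grad c u)} = codom c"
    using openin_imp_subset by fastforce
qed auto

lemma covector_smooth_grad: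
  assumes c: "c \<in> atlas M" and x: "x \<in> codom c"
  shows "covector (smooth_grad u) c x = coord_grad c u x"
  unfolding covector_def smooth_grad_def coord_uncoord[OF x]
  by (subst posdef_cramer[OF gram_posdef[OF c x]]) simp

lemma gram_smooth_grad:
  assumes c: "c \<in> atlas M" and p: "p \<in> dom c"
  shows "gram M c (coord c p) *v smooth_grad u c p = coord_grad c u (coord c p)"
  unfolding smooth_grad_def using c p by (subst posdef_cramer) (auto intro: gram_posdef)

lemma continuous_smooth_grad:
  assumes u: "smooth_fun u" and c: "c \<in> atlas M"
  shows "continuous_on (dom c) (smooth_grad u c)"
proof -
  have "continuous_on (codom c) (\<lambda>x. cramer_solution (gram M c x) (coord_grad c u x))"
    by (intro continuous_on_cramer_solution continuous_gram continuous_coord_grad gram_posdef u c)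
  from continuous_on_compose2[OF this continuous_coord[OF c] subset_refl]
  show ?thesis unfolding smooth_grad_def[abs_def] .
qed

text \<open>On the overlap the two coordinate expressions of \<open>u\<close> differ by the
  transition map. The chain rule and the uniqueness of derivatives within the overlap compare their
  differentials.\<close>

lemma coord_grad_transition:
  assumes u: "smooth_fun u" and c: "c \<in> atlas M" and d: "d \<in> atlas M" and p: "p \<in> dom c \<inter> dom d"
    and D: "(transition c d has_derivative D) (at (coord c p) within overlap c d)"
  shows "w \<bullet> coord_grad c u (coord c p) = D w \<bullet> coord_grad d u (coord d p)"
proof -
  let ?x = "coord c p" and ?O = "overlap c d"
  have x: "?x \<in> ?O" "?x \<in> codom c" "coord d p \<in> codom d" using p by auto
  have tx: "transition c d ?x = coord d p" using c p by (simp add: transition_coord)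
  have "transition c d ` ?O \<subseteq> codom d" using c by auto
  then have "(u \<circ> uncoord d has_derivative (\<lambda>v. v \<bullet> coord_grad d u (coord d p)))
      (at (transition c d ?x) within transition c d ` ?O)"
    unfolding tx by (rule has_derivative_subset[OF smooth_fun_has_derivative[OF u d x(3)]])
  from diff_chain_within[OF D this]
  have 1: "((u \<circ> uncoord d) \<circ> transition c d has_derivative (\<lambda>v. v \<bullet> coord_grad d u (coord d p)) \<circ> D)
      (at ?x within ?O)" .
  have 2: "(u \<circ> uncoord c has_derivative (\<lambda>v. v \<bullet> coord_grad d u (coord d p)) \<circ> D) (at ?x within ?O)"
    by (rule has_derivative_transform[OF x(1) _ 1]) (use c d in auto)
  have 3: "(u \<circ> uncoord c has_derivative (\<lambda>v. v \<bullet> coord_grad c u ?x)) (at ?x within ?O)"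
    by (rule has_derivative_subset[OF smooth_fun_has_derivative[OF u c x(2)] overlap_subset])
  have "(\<lambda>v. v \<bullet> coord_grad c u ?x) = (\<lambda>v. v \<bullet> coord_grad d u (coord d p)) \<circ> D"
    by (rule has_derivative_unique_half_open[OF overlap_half_open[OF c d] x(1) 3 2])
  from fun_cong[OF this, of w] show ?thesis by simp
qed

text \<open>Differentials pull back under \<open>D\<close>, whereas a vector field must be pushed
  forward. Since \<open>D\<close> is isometric for the Gram matrices, hence invertible, duality
  turns one law into the other.\<close>

lemma vector_field_smooth_grad:
  assumes u: "smooth_fun u"
  shows "vector_field M (smooth_grad u)"
  unfolding vector_field_def
proof (intro conjI ballI allI impI)
  fix c assume c: "c \<in> atlas M"
  show "smooth_grad u c \<in> borel_measurable (restrict_space borel (dom c))"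
    by (rule borel_measurable_continuous_on_restrict[OF continuous_smooth_grad[OF u c]])
next
  fix c d p D
  assume c: "c \<in> atlas M" and d: "d \<in> atlas M" and p: "p \<in> dom c \<inter> dom d"
    and D: "(transition c d has_derivative D) (at (coord c p) within overlap c d)"
  let ?Gc = "gram M c (coord c p)" and ?Gd = "gram M d (coord d p)"
  note g = gram_transition[OF c d p D]
  have G: "posdef ?Gc" "posdef ?Gd" using c d p by (auto intro!: gram_posdef)
  have lin: "linear D" by (rule has_derivative_linear[OF D])
  have "inj D"
    unfolding linear_injective_0[OF lin]
  proof (intro allI impI)
    fix v assume "D v = 0"
    then have "v \<bullet> (?Gc *v v) = 0" using g[of v v] by simp
    then show "v = 0" using G(1) unfolding posdef_def by (metis less_irrefl)
  qed
  then have "surj D" by (rule linear_injective_imp_surjective[OF lin]) simp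
  \<comment> \<open>\<open>?z\<close> is the defect in the transformation law. As \<open>D\<close>
    is onto, the defect may be tested against itself, and positive definiteness forces it to
    vanish.\<close>
  let ?z = "smooth_grad u d p - D (smooth_grad u c p)"
  obtain w where w: "D w = ?z" using \<open>surj D\<close> by (metis surjD)
  have "D w \<bullet> (?Gd *v smooth_grad u d p) = D w \<bullet> (?Gd *v D (smooth_grad u c p))"
    using coord_grad_transition[OF u c d p D, of w] g[of w "smooth_grad u c p"] p
    by (simp add: gram_smooth_grad[OF c] gram_smooth_grad[OF d])
  then have "?z \<bullet> (?Gd *v ?z) = 0"
    by (simp add: w matrix_vector_mult_diff_distrib inner_diff_right)
  then have "?z = 0" using G(2) unfolding posdef_def by (metis less_irrefl)
  then show "smooth_grad u d p = D (smooth_grad u c p)" by simp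
qed

lemma continuous_on_points:
  fixes h :: "'a \<Rightarrow> 'b::topological_space"
  assumes "\<And>c. c \<in> atlas M \<Longrightarrow> continuous_on (dom c) h"
  shows "continuous_on (points M) h"
proof (rule continuous_on_openin_cover[where F = "dom ` atlas M"])
  show "openin (top_of_set (points M)) T" if "T \<in> dom ` atlas M" for T
    using that chart_openin by (metis (no_types, lifting) imageE)
  show "continuous_on T h" if "T \<in> dom ` atlas M" for T
    using that assms by (metis (no_types, lifting) imageE)
qed (rule atlas_cover)

lemma continuous_smooth_fun_dom:
  assumes u: "smooth_fun u" and c: "c \<in> atlas M"
  shows "continuous_on (dom c) u"
proof -
  have "continuous_on (dom c) (\<lambda>p. u (uncoord c (coord c p)))"
    using continuous_on_compose2[OF continuous_smooth_fun_chart[OF u c] continuous_coord[OF c]] by simp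
  then show ?thesis
    by (rule continuous_on_cong[THEN iffD1, OF refl, rotated]) (simp add: c)
qed

lemma continuous_smooth_fun: "smooth_fun u \<Longrightarrow> continuous_on (points M) u"
  by (rule continuous_on_points) (rule continuous_smooth_fun_dom)

lemma smooth_fun_measurable: "smooth_fun u \<Longrightarrow> u \<in> borel_measurable vol"
  by (intro borel_measurable_vol_charts borel_measurable_continuous_on_restrict continuous_smooth_fun_dom)

lemma continuous_vnorm_smooth_grad:
  assumes u: "smooth_fun u"
  shows "continuous_on (points M) (vnorm M (smooth_grad u))"
proof (rule continuous_on_points)
  fix c assume c: "c \<in> atlas M"
  have "continuous_on (dom c) (\<lambda>p. gram M c (coord c p))"
    by (rule continuous_on_compose2[OF continuous_gram[OF c] continuous_coord[OF c] subset_refl])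
  then have "continuous_on (dom c) (\<lambda>p. gnorm (gram M c (coord c p)) (smooth_grad u c p))"
    unfolding gnorm_def
    by (intro continuous_intros continuous_on_matrix_vector continuous_smooth_grad u c)
  then show "continuous_on (dom c) (vnorm M (smooth_grad u))"
    by (rule continuous_on_cong[THEN iffD2, OF refl, rotated])
      (rule vnorm_chart[OF vector_field_smooth_grad[OF u] c])
qed

text \<open>In the interior of a chart the derivative within the range is an ordinary one, so
  classical integration by parts applies.\<close>

lemma weak_gradient_smooth_grad:
  assumes u: "smooth_fun u"
  shows "weak_gradient M u (smooth_grad u)"
  unfolding weak_gradient_iff
proof (intro conjI ballI allI impI; (elim conjE)?)
  show "vector_field M (smooth_grad u)" by (rule vector_field_smooth_grad[OF u])
  fix c assume c: "c \<in> atlas M"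
  let ?V = "interior (codom c)"
  have V: "?V \<subseteq> codom c" by (rule interior_subset)
  show "set_integrable lborel K (\<lambda>x. u (uncoord c x))" if K: "compact K" "K \<subseteq> ?V" for K
    unfolding set_integrable_def
    using continuous_on_subset[OF continuous_smooth_fun_chart[OF u c]] K V
    by (intro borel_integrable_compact K(1)) blast
  show "set_integrable lborel K (covector (smooth_grad u) c)" if K: "compact K" "K \<subseteq> ?V" for K
  proof -
    have KV: "K \<subseteq> codom c" using K(2) V by (rule order_trans)
    have "continuous_on K (coord_grad c u)"
      by (rule continuous_on_subset[OF continuous_coord_grad[OF u c] KV])
    then have "continuous_on K (covector (smooth_grad u) c)"
      by (rule continuous_on_cong[THEN iffD2, OF refl, rotated]) (use KV in \<open>auto intro!: covector_smooth_grad[OF c]\<close>)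
    then show ?thesis unfolding set_integrable_def by (rule borel_integrable_compact[OF K(1)])
  qed
  fix \<psi> i assume \<psi>: "test_function ?V \<psi>"
  have "(LINT x:?V|lborel. (u \<circ> uncoord c) x * frechet_derivative \<psi> (at x) (axis i 1))
      = - (LINT x:?V|lborel. axis i 1 \<bullet> coord_grad c u x * \<psi> x)"
  proof (rule integration_by_parts_test_function[where F' = "\<lambda>x v. v \<bullet> coord_grad c u x"])
    show "(u \<circ> uncoord c has_derivative (\<lambda>v. v \<bullet> coord_grad c u x)) (at x)" if "x \<in> ?V" for x
      using smooth_fun_has_derivative[OF u c subsetD[OF V that]] at_within_interior[OF that] by simp
    show "continuous_on ?V (\<lambda>x. axis i 1 \<bullet> coord_grad c u x)"
      by (intro continuous_intros continuous_on_subset[OF continuous_coord_grad[OF u c] V])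
  qed (use \<psi> in auto)
  also have "(LINT x:?V|lborel. axis i 1 \<bullet> coord_grad c u x * \<psi> x)
      = (LINT x:?V|lborel. covector (smooth_grad u) c x $ i * \<psi> x)"
    by (rule set_lebesgue_integral_cong)
      (use covector_smooth_grad[OF c subsetD[OF V]] in \<open>auto simp: inner_axis'\<close>)
  finally show "(LINT x:?V|lborel. u (uncoord c x) * frechet_derivative \<psi> (at x) (axis i 1))
      = - (LINT x:?V|lborel. covector (smooth_grad u) c x $ i * \<psi> x)" by simp
qed

lemma smooth_grad_compose:
  assumes u: "smooth_fun u" and \<phi>: "smooth_fun (\<lambda>p. \<phi> (u p))"
    and d: "\<And>x. (\<phi> has_real_derivative \<phi>' x) (at x)"
    and c: "c \<in> atlas M" and p: "p \<in> dom c"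
  shows "smooth_grad (\<lambda>p. \<phi> (u p)) c p = \<phi>' (u p) *\<^sub>R smooth_grad u c p"
proof -
  let ?x = "coord c p"
  have x: "?x \<in> codom c" using p by simp
  have "coord_grad c (\<lambda>p. \<phi> (u p)) ?x = \<phi>' (u p) *\<^sub>R coord_grad c u ?x"
  proof (rule coord_grad_eqI[OF \<phi> c x])
    have "(\<phi> has_derivative (*) (\<phi>' (u p))) (at ((u \<circ> uncoord c) ?x))"
      using d[of "u p"] c p by (simp add: has_field_derivative_def)
    from has_derivative_compose[OF smooth_fun_has_derivative[OF u c x] this]
    show "((\<lambda>p. \<phi> (u p)) \<circ> uncoord c has_derivative (\<lambda>v. v \<bullet> \<phi>' (u p) *\<^sub>R coord_grad c u ?x))
        (at ?x within codom c)"
      by (simp add: comp_def)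
  qed
  then have "gram M c ?x *v (\<phi>' (u p) *\<^sub>R smooth_grad u c p) = coord_grad c (\<lambda>p. \<phi> (u p)) ?x"
    by (simp add: matrix_vector_mult_scaleR gram_smooth_grad[OF c p])
  then show ?thesis
    unfolding posdef_cramer[OF gram_posdef[OF c x]] smooth_grad_def by simp
qed

subsection \<open>Smooth functions with compact support in the interior\<close>

lemma sci_smooth_fun: "u \<in> smooth_compact_interior M \<Longrightarrow> smooth_fun u"
  by (simp add: smooth_compact_interior_def smooth_fun_def)

lemma sci_compose:
  assumes u: "u \<in> smooth_compact_interior M" and \<phi>: "\<And>k. Ck_on k UNIV \<phi>" "\<phi> 0 = 0"
  shows "(\<lambda>p. \<phi> (u p)) \<in> smooth_compact_interior M"
proof -
  have "smooth_on (codom c) ((\<lambda>p. \<phi> (u p)) \<circ> uncoord c)" if "c \<in> atlas M" for c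
    using smooth_on_compose_real[OF smooth_funD[OF sci_smooth_fun[OF u] that] \<phi>(1)]
    by (simp add: comp_def)
  then show ?thesis using u \<phi>(2) unfolding smooth_compact_interior_def by auto
qed

text \<open>The support is compact, hence closed, so each point off it has a relatively open
  neighbourhood in its chart where \<open>u\<close> is zero. Derivatives within that neighbourhood
  are unique, also at boundary points, and the gradient vanishes.\<close>

lemma sci_support:
  assumes u: "u \<in> smooth_compact_interior M"
  obtains K where "compact K" "K \<subseteq> points M" "\<And>p. p \<in> points M - K \<Longrightarrow> u p = 0"
    "\<And>p. p \<in> points M - K \<Longrightarrow> vnorm M (smooth_grad u) p = 0"
proof -
  note su = sci_smooth_fun[OF u]
  obtain K where K: "compact K" "K \<subseteq> manifold_interior M" "\<forall>p\<in>points M - K. u p = 0"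
    using u unfolding smooth_compact_interior_def by blast
  have "manifold_interior M \<subseteq> points M"
    unfolding manifold_interior_def using dom_subset by blast
  then have KM: "K \<subseteq> points M" using K(2) by blast
  have "vnorm M (smooth_grad u) p = 0" if p: "p \<in> points M - K" for p
  proof -
    obtain c where c: "c \<in> atlas M" "p \<in> dom c" using p point_chart by blast
    let ?x = "coord c p" and ?T = "coord c ` (dom c - K)"
    have x: "?x \<in> codom c" "?x \<in> ?T" using c p by auto
    have "openin (top_of_set (dom c)) (dom c - K)"
      using compact_imp_closed[OF K(1)] by (simp add: Diff_eq openin_open_Int open_Compl)
    then have "openin (top_of_set (codom c)) ?T"
      by (rule homeomorphism_imp_open_map[OF chart_homeomorphism[OF c(1)]])
    then have T: "half_open ?T" by (rule half_open_subset[OF chart_half_open[OF c(1)]])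
    have 1: "(u \<circ> uncoord c has_derivative (\<lambda>v. v \<bullet> coord_grad c u ?x)) (at ?x within ?T)"
      by (rule has_derivative_subset[OF smooth_fun_has_derivative[OF su c(1) x(1)]]) blast
    have "(u \<circ> uncoord c) y = 0" if "y \<in> ?T" for y
      using that K(3) c(1) dom_subset[OF c(1)] by auto
    then have "(u \<circ> uncoord c has_derivative (\<lambda>v. 0)) (at ?x within ?T)"
      by (rule has_derivative_transform[OF x(2) _ has_derivative_const])
    from has_derivative_unique_half_open[OF T x(2) 1 this]
    have "coord_grad c u ?x \<bullet> coord_grad c u ?x = 0" by (rule fun_cong)
    then have "coord_grad c u ?x = 0" by simp
    then have "gram M c ?x *v smooth_grad u c p = 0" using gram_smooth_grad[OF c] by simp
    then have "gram M c ?x *v smooth_grad u c p = gram M c ?x *v 0" by simp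
    then have "smooth_grad u c p = 0" by (rule posdef_injective[OF gram_posdef[OF c(1) x(1)]])
    then show ?thesis unfolding vnorm_chart[OF vector_field_smooth_grad[OF su] c] by simp
  qed
  then show ?thesis using that[OF K(1) KM] K(3) by blast
qed

lemma sci_bounded:
  assumes u: "u \<in> smooth_compact_interior M"
  obtains B where "\<And>p. p \<in> points M \<Longrightarrow> \<bar>u p\<bar> \<le> B"
    "\<And>p. p \<in> points M \<Longrightarrow> \<bar>vnorm M (smooth_grad u) p\<bar> \<le> B"
proof -
  obtain K where K: "compact K" "K \<subseteq> points M" "\<And>p. p \<in> points M - K \<Longrightarrow> u p = 0"
    "\<And>p. p \<in> points M - K \<Longrightarrow> vnorm M (smooth_grad u) p = 0"
    using sci_support[OF u] by metis
  have *: "\<exists>B\<ge>0. \<forall>p\<in>points M. \<bar>h p\<bar> \<le> B"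
    if h: "continuous_on (points M) h" "\<And>p. p \<in> points M - K \<Longrightarrow> h p = 0" for h :: "'a \<Rightarrow> real"
  proof -
    obtain B where B: "B \<ge> 0" "\<And>p. p \<in> K \<Longrightarrow> norm (h p) \<le> B"
      using continuous_on_compact_bound[OF K(1) continuous_on_subset[OF h(1) K(2)]] by metis
    have "\<bar>h p\<bar> \<le> B" if "p \<in> points M" for p
      using B h(2)[of p] that by (cases "p \<in> K") auto
    then show ?thesis using B(1) by blast
  qed
  obtain B1 where B1: "\<forall>p\<in>points M. \<bar>u p\<bar> \<le> B1"
    using *[OF continuous_smooth_fun[OF sci_smooth_fun[OF u]] K(3)] by blast
  obtain B2 where B2: "\<forall>p\<in>points M. \<bar>vnorm M (smooth_grad u) p\<bar> \<le> B2"
    using *[OF continuous_vnorm_smooth_grad[OF sci_smooth_fun[OF u]] K(4)] by blast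
  show ?thesis
    by (rule that[of "max B1 B2"]) (use B1 B2 in \<open>auto simp: le_max_iff_disj\<close>)
qed

end

subsection \<open>Integral inequalities\<close>

lemma powr_add_le:
  fixes a b p :: real
  assumes "0 \<le> a" "0 \<le> b" "0 \<le> p"
  shows "(a + b) powr p \<le> 2 powr p * (a powr p + b powr p)"
proof -
  have "(a + b) powr p \<le> (2 * max a b) powr p"
    using assms by (intro powr_mono2) auto
  also have "\<dots> = 2 powr p * max a b powr p" using assms by (simp add: powr_mult)
  also have "max a b powr p \<le> a powr p + b powr p" by (auto simp: max_def)
  finally show ?thesis by simp
qed

text \<open>Young's inequality is integrated after both functions are normalised to have integral
  1.\<close>

lemma Holder_weighted:
  fixes A B :: "'a \<Rightarrow> real"
  assumes A: "integrable \<mu> A" "\<And>x. 0 \<le> A x" and B: "integrable \<mu> B" "\<And>x. 0 \<le> B x"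
    and \<theta>: "0 < \<theta>" "\<theta> < 1"
  shows "integrable \<mu> (\<lambda>x. A x powr (1 - \<theta>) * B x powr \<theta>)"
    and "(\<integral>x. A x powr (1 - \<theta>) * B x powr \<theta> \<partial>\<mu>) \<le> (\<integral>x. A x \<partial>\<mu>) powr (1 - \<theta>) * (\<integral>x. B x \<partial>\<mu>) powr \<theta>"
proof -
  have [measurable]: "A \<in> borel_measurable \<mu>" "B \<in> borel_measurable \<mu>" using A B by auto
  have young: "a powr (1 - \<theta>) * b powr \<theta> \<le> (1 - \<theta>) * a + \<theta> * b" if "0 \<le> a" "0 \<le> b" for a b
  proof (cases "a = 0 \<or> b = 0")
    case True
    then show ?thesis using that \<theta> by auto
  next
    case False
    then show ?thesis using that \<theta> by (intro Youngs_inequality_0) auto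
  qed
  show int: "integrable \<mu> (\<lambda>x. A x powr (1 - \<theta>) * B x powr \<theta>)"
  proof (rule Bochner_Integration.integrable_bound)
    show "integrable \<mu> (\<lambda>x. (1 - \<theta>) * A x + \<theta> * B x)" using A B by simp
    show "AE x in \<mu>. norm (A x powr (1 - \<theta>) * B x powr \<theta>) \<le> norm ((1 - \<theta>) * A x + \<theta> * B x)"
      using young[OF A(2) B(2)] by (intro AE_I2) (auto intro: order_trans[OF _ abs_ge_self])
  qed measurable
  define a where "a = (\<integral>x. A x \<partial>\<mu>)"
  define b where "b = (\<integral>x. B x \<partial>\<mu>)"
  have ab: "0 \<le> a" "0 \<le> b" using A(2) B(2) by (simp_all add: a_def b_def)
  show "(\<integral>x. A x powr (1 - \<theta>) * B x powr \<theta> \<partial>\<mu>) \<le> (\<integral>x. A x \<partial>\<mu>) powr (1 - \<theta>) * (\<integral>x. B x \<partial>\<mu>) powr \<theta>"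
  proof (cases "a = 0 \<or> b = 0")
    \<comment> \<open>Normalisation is impossible when an integral vanishes; then one factor is zero
      almost everywhere.\<close>
    case True
    have "AE x in \<mu>. A x powr (1 - \<theta>) * B x powr \<theta> = 0"
    proof (cases "a = 0")
      case True
      then have "AE x in \<mu>. A x = 0"
        using integral_nonneg_eq_0_iff_AE[OF A(1)] A(2) by (simp add: a_def)
      then show ?thesis by eventually_elim simp
    next
      case False
      then have "AE x in \<mu>. B x = 0"
        using integral_nonneg_eq_0_iff_AE[OF B(1)] B(2) True by (simp add: b_def)
      then show ?thesis by eventually_elim simp
    qed
    then have "(\<integral>x. A x powr (1 - \<theta>) * B x powr \<theta> \<partial>\<mu>) = 0" by (rule integral_eq_zero_AE)
    then show ?thesis by simp
  next
    case False
    with ab have pos: "a > 0" "b > 0" by auto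
    have "(\<integral>x. A x powr (1 - \<theta>) * B x powr \<theta> \<partial>\<mu>)
        \<le> (\<integral>x. a powr (1 - \<theta>) * b powr \<theta> * ((1 - \<theta>) * (A x / a) + \<theta> * (B x / b)) \<partial>\<mu>)"
    proof (rule integral_mono[OF int])
      show "integrable \<mu> (\<lambda>x. a powr (1 - \<theta>) * b powr \<theta> * ((1 - \<theta>) * (A x / a) + \<theta> * (B x / b)))"
        using A B by simp
      fix x
      have "(A x / a) powr (1 - \<theta>) * (B x / b) powr \<theta> \<le> (1 - \<theta>) * (A x / a) + \<theta> * (B x / b)"
        using A(2)[of x] B(2)[of x] pos by (intro young) auto
      then have "a powr (1 - \<theta>) * b powr \<theta> * ((A x / a) powr (1 - \<theta>) * (B x / b) powr \<theta>)
          \<le> a powr (1 - \<theta>) * b powr \<theta> * ((1 - \<theta>) * (A x / a) + \<theta> * (B x / b))"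
        by (intro mult_left_mono) auto
      also have "a powr (1 - \<theta>) * b powr \<theta> * ((A x / a) powr (1 - \<theta>) * (B x / b) powr \<theta>)
          = A x powr (1 - \<theta>) * B x powr \<theta>"
        using A(2)[of x] B(2)[of x] pos by (simp add: powr_divide)
      finally show "A x powr (1 - \<theta>) * B x powr \<theta>
          \<le> a powr (1 - \<theta>) * b powr \<theta> * ((1 - \<theta>) * (A x / a) + \<theta> * (B x / b))" .
    qed
    also have "\<dots> = a powr (1 - \<theta>) * b powr \<theta> * ((1 - \<theta>) * (a / a) + \<theta> * (b / b))"
      using A B by (simp add: a_def b_def)
    also have "\<dots> = a powr (1 - \<theta>) * b powr \<theta>" using pos by simp
    finally show ?thesis by (simp only: a_def b_def)
  qed
qed

text \<open>Hoelder against the constant function 1, with weight \<open>p / q\<close>; the finite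
  total mass makes that constant integrable.\<close>

lemma (in finite_measure) Lp_decreasing:
  fixes f :: "'a \<Rightarrow> real"
  assumes f: "f \<in> Lp M q" and pq: "0 < p" "p < q"
  shows "f \<in> Lp M p"
    and "(\<integral>x. \<bar>f x\<bar> powr p \<partial>M) \<le> measure M (space M) powr (1 - p / q) * (\<integral>x. \<bar>f x\<bar> powr q \<partial>M) powr (p / q)"
proof -
  have fm: "f \<in> borel_measurable M" and fi: "integrable M (\<lambda>x. \<bar>f x\<bar> powr q)" using f by (auto simp: Lp_def)
  have e: "1 powr (1 - p/q) * (\<bar>f x\<bar> powr q) powr (p/q) = \<bar>f x\<bar> powr p" for x
    using pq by (simp add: powr_powr)
  note H = Holder_weighted[of M "\<lambda>_. 1" "\<lambda>x. \<bar>f x\<bar> powr q" "p/q", unfolded e]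
  show "f \<in> Lp M p" using H(1) fm fi pq by (simp add: Lp_def)
  show "(\<integral>x. \<bar>f x\<bar> powr p \<partial>M) \<le> measure M (space M) powr (1 - p / q) * (\<integral>x. \<bar>f x\<bar> powr q \<partial>M) powr (p / q)"
    using H(2) fi pq by simp
qed

lemma (in finite_measure) Lp_tendsto_decreasing:
  fixes f :: "nat \<Rightarrow> 'a \<Rightarrow> real"
  assumes f: "\<And>n. f n \<in> Lp M q" and pq: "0 < p" "p \<le> q"
    and lim: "(\<lambda>n. \<integral>x. \<bar>f n x\<bar> powr q \<partial>M) \<longlonglongrightarrow> 0"
  shows "(\<lambda>n. \<integral>x. \<bar>f n x\<bar> powr p \<partial>M) \<longlonglongrightarrow> 0"
proof (cases "p = q")
  case False
  then have pq: "0 < p" "p < q" using assms by auto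
  have "(\<lambda>n. (\<integral>x. \<bar>f n x\<bar> powr q \<partial>M) powr (p/q)) \<longlonglongrightarrow> 0 powr (p/q)"
    by (rule tendsto_powr'[OF lim tendsto_const]) (use pq in \<open>auto intro!: always_eventually\<close>)
  then have "(\<lambda>n. measure M (space M) powr (1 - p / q) * (\<integral>x. \<bar>f n x\<bar> powr q \<partial>M) powr (p / q)) \<longlonglongrightarrow> 0"
    using tendsto_mult_left by fastforce
  then show ?thesis
    by (rule Lim_null_comparison[rotated])
      (use Lp_decreasing(2)[OF f pq] in \<open>auto intro!: always_eventually\<close>)
qed (use lim in simp)

lemma Lp_1_iff: "f \<in> Lp \<mu> 1 \<longleftrightarrow> integrable \<mu> f"
proof -
  have "f \<in> Lp \<mu> 1 \<longleftrightarrow> f \<in> borel_measurable \<mu> \<and> integrable \<mu> (\<lambda>x. \<bar>f x\<bar>)"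
    by (simp add: Lp_def cong: if_cong)
  then show ?thesis using integrable_abs_iff by (metis borel_measurable_integrable)
qed

lemma (in finite_measure) Lp_imp_integrable:
  assumes "f \<in> Lp M p" "1 \<le> p"
  shows "integrable M f"
  using Lp_decreasing(1)[OF assms(1), of 1] assms Lp_1_iff[of f M] by (cases "p = 1") auto

lemma (in finite_measure) bounded_Lp:
  assumes "f \<in> borel_measurable M" "AE x in M. \<bar>f x\<bar> \<le> B" "0 \<le> p"
  shows "f \<in> Lp M p"
proof -
  have "integrable M (\<lambda>x. \<bar>f x\<bar> powr p)"
  proof (rule integrable_const_bound[of _ "B powr p"])
    show "AE x in M. norm (\<bar>f x\<bar> powr p) \<le> B powr p"
      using assms(2) by eventually_elim (use assms(3) in \<open>auto intro: powr_mono2\<close>)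
  qed (use assms(1) in measurable)
  with assms show ?thesis by (simp add: Lp_def)
qed

lemma Lp_bound:
  assumes g: "g \<in> Lp \<mu> p" and f: "f \<in> borel_measurable \<mu>"
    and le: "AE x in \<mu>. \<bar>f x\<bar> \<le> a * \<bar>g x\<bar>" and "0 \<le> a" "0 \<le> p"
  shows "f \<in> Lp \<mu> p"
proof -
  have "integrable \<mu> (\<lambda>x. \<bar>f x\<bar> powr p)"
  proof (rule Bochner_Integration.integrable_bound)
    show "integrable \<mu> (\<lambda>x. a powr p * \<bar>g x\<bar> powr p)" using g by (simp add: Lp_def)
    show "AE x in \<mu>. norm (\<bar>f x\<bar> powr p) \<le> norm (a powr p * \<bar>g x\<bar> powr p)"
      using le
    proof eventually_elim
      case (elim x)
      then have "\<bar>f x\<bar> powr p \<le> (a * \<bar>g x\<bar>) powr p" using assms by (intro powr_mono2) auto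
      then show ?case using assms by (simp add: powr_mult)
    qed
  qed (use f in measurable)
  with f show ?thesis by (simp add: Lp_def)
qed

lemma Lp_add:
  assumes f: "f \<in> Lp \<mu> p" and g: "g \<in> Lp \<mu> p" and "0 \<le> p"
    and h: "h \<in> borel_measurable \<mu>" "AE x in \<mu>. \<bar>h x\<bar> \<le> \<bar>f x\<bar> + \<bar>g x\<bar>"
  shows "h \<in> Lp \<mu> p"
    and "(\<integral>x. \<bar>h x\<bar> powr p \<partial>\<mu>) \<le> 2 powr p * ((\<integral>x. \<bar>f x\<bar> powr p \<partial>\<mu>) + (\<integral>x. \<bar>g x\<bar> powr p \<partial>\<mu>))"
proof -
  have fi: "integrable \<mu> (\<lambda>x. \<bar>f x\<bar> powr p)" and gi: "integrable \<mu> (\<lambda>x. \<bar>g x\<bar> powr p)"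
    using f g by (auto simp: Lp_def)
  have le: "AE x in \<mu>. \<bar>h x\<bar> powr p \<le> 2 powr p * (\<bar>f x\<bar> powr p + \<bar>g x\<bar> powr p)"
    using h(2)
  proof eventually_elim
    case (elim x)
    then have "\<bar>h x\<bar> powr p \<le> (\<bar>f x\<bar> + \<bar>g x\<bar>) powr p" using assms by (intro powr_mono2) auto
    also have "\<dots> \<le> 2 powr p * (\<bar>f x\<bar> powr p + \<bar>g x\<bar> powr p)" using assms by (intro powr_add_le) auto
    finally show ?case .
  qed
  have i: "integrable \<mu> (\<lambda>x. 2 powr p * (\<bar>f x\<bar> powr p + \<bar>g x\<bar> powr p))" using fi gi by simp
  have hi: "integrable \<mu> (\<lambda>x. \<bar>h x\<bar> powr p)"
    by (rule Bochner_Integration.integrable_bound[OF i]) (use le h(1) in auto)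
  then show "h \<in> Lp \<mu> p" using h(1) by (simp add: Lp_def)
  show "(\<integral>x. \<bar>h x\<bar> powr p \<partial>\<mu>) \<le> 2 powr p * ((\<integral>x. \<bar>f x\<bar> powr p \<partial>\<mu>) + (\<integral>x. \<bar>g x\<bar> powr p \<partial>\<mu>))"
    using integral_mono_AE[OF hi i le] fi gi by simp
qed

lemma Lp_norm_nonneg: "0 \<le> Lp_norm \<mu> p f"
  by (simp add: Lp_norm_def)

lemma Lp_norm_powr: "0 < p \<Longrightarrow> Lp_norm \<mu> p f powr p = (\<integral>x. \<bar>f x\<bar> powr p \<partial>\<mu>)"
  by (simp add: Lp_norm_def powr_powr)

lemma Lp_cong_AE:
  assumes "f \<in> Lp \<mu> p" "g \<in> borel_measurable \<mu>" "AE x in \<mu>. f x = g x"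
  shows "g \<in> Lp \<mu> p" "Lp_norm \<mu> p g = Lp_norm \<mu> p f"
proof -
  have m: "f \<in> borel_measurable \<mu>" using assms(1) by (simp add: Lp_def)
  have ae: "AE x in \<mu>. \<bar>f x\<bar> powr p = \<bar>g x\<bar> powr p" using assms(3) by eventually_elim simp
  have "integrable \<mu> (\<lambda>x. \<bar>g x\<bar> powr p)"
    using assms(1) integrable_cong_AE[OF _ _ ae] m assms(2) by (simp add: Lp_def)
  then show "g \<in> Lp \<mu> p" using assms(2) by (simp add: Lp_def)
  show "Lp_norm \<mu> p g = Lp_norm \<mu> p f"
    using integral_cong_AE[OF _ _ ae] m assms(2) by (simp add: Lp_norm_def)
qed

lemma Lp_norm_tendsto_0:
  assumes "0 < p" "(\<lambda>n. \<integral>x. \<bar>f n x\<bar> powr p \<partial>\<mu>) \<longlonglongrightarrow> 0"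
  shows "(\<lambda>n. Lp_norm \<mu> p (f n)) \<longlonglongrightarrow> 0"
proof -
  have "(\<lambda>n. (\<integral>x. \<bar>f n x\<bar> powr p \<partial>\<mu>) powr (1 / p)) \<longlonglongrightarrow> 0 powr (1 / p)"
    by (rule tendsto_powr'[OF assms(2) tendsto_const]) (use assms(1) in \<open>auto intro!: always_eventually\<close>)
  then show ?thesis by (simp add: Lp_norm_def)
qed

subsection \<open>The signed power\<close>

definition spow :: "real \<Rightarrow> real \<Rightarrow> real" where
  "spow s x = sgn x * \<bar>x\<bar> powr s"

lemma spow_0 [simp]: "spow s 0 = 0"
  by (simp add: spow_def)

lemma spow_minus: "spow s (- x) = - spow s x"
  by (simp add: spow_def)

lemma abs_spow: "\<bar>spow s x\<bar> = \<bar>x\<bar> powr s"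
  by (simp add: spow_def abs_mult abs_sgn_eq)

lemma spow_spow:
  assumes "s \<noteq> 0"
  shows "spow (1 / s) (spow s x) = x"
proof -
  have "sgn (spow s x) = sgn x" by (cases "x = 0") (simp_all add: spow_def sgn_mult)
  then have "spow (1 / s) (spow s x) = sgn x * (\<bar>x\<bar> powr s) powr (1 / s)"
    by (simp add: spow_def[of "1 / s"] abs_spow)
  also have "\<dots> = sgn x * \<bar>x\<bar>" using assms by (simp add: powr_powr)
  finally show ?thesis by (simp add: mult.commute abs_mult_sgn)
qed

lemma spow_measurable [measurable]: "spow s \<in> borel_measurable borel"
  unfolding spow_def[abs_def] by measurable

lemma DERIV_spow:
  assumes s: "1 < s"
  shows "(spow s has_real_derivative s * \<bar>x\<bar> powr (s - 1)) (at x)"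
proof -
  consider "x > 0" | "x < 0" | "x = 0" by linarith
  then show ?thesis
  proof cases
    case 1
    have "((\<lambda>x. x powr s) has_real_derivative s * x powr (s - 1)) (at x)"
      using 1 by (rule has_real_derivative_powr)
    then have "(spow s has_real_derivative s * x powr (s - 1)) (at x)"
      by (rule has_field_derivative_transform_within_open[where S = "{0<..}"])
        (use 1 in \<open>auto simp: spow_def\<close>)
    then show ?thesis using 1 by simp
  next
    case 2
    have "((\<lambda>x. - ((- x) powr s)) has_real_derivative s * (- x) powr (s - 1)) (at x)"
      using 2 by (auto intro!: derivative_eq_intros DERIV_chain2[OF has_real_derivative_powr])
    then have "(spow s has_real_derivative s * (- x) powr (s - 1)) (at x)"
      by (rule has_field_derivative_transform_within_open[where S = "{..<0}"])
        (use 2 in \<open>auto simp: spow_def\<close>)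
    then show ?thesis using 2 by simp
  next
    case 3
    \<comment> \<open>The difference quotient of \<open>spow s\<close> at 0 is this function, whose
      exponent is positive.\<close>
    have "((\<lambda>h::real. \<bar>h\<bar> powr (s - 1)) \<longlongrightarrow> \<bar>0\<bar> powr (s - 1)) (at 0)"
      by (rule tendsto_powr'[OF tendsto_rabs[OF tendsto_ident_at] tendsto_const])
        (use s in \<open>auto intro!: always_eventually\<close>)
    then have "((\<lambda>h::real. \<bar>h\<bar> powr (s - 1)) \<longlongrightarrow> 0) (at 0)" by simp
    moreover have "eventually (\<lambda>h::real. \<bar>h\<bar> powr (s - 1) = (spow s h - spow s 0) / (h - 0)) (at 0)"
      unfolding eventually_at
    proof (intro exI[of _ 1] conjI ballI impI)
      fix h :: real assume "h \<noteq> 0 \<and> dist h 0 < 1"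
      then show "\<bar>h\<bar> powr (s - 1) = (spow s h - spow s 0) / (h - 0)"
        by (cases "h > 0") (auto simp: spow_def powr_diff)
    qed simp
    ultimately have "((\<lambda>h. (spow s h - spow s 0) / (h - 0)) \<longlongrightarrow> 0) (at 0)"
      by (rule Lim_transform_eventually)
    then show ?thesis unfolding 3 has_field_derivative_iff by simp
  qed
qed

lemma real_lipschitz:
  fixes f :: "real \<Rightarrow> real"
  assumes "convex S" "\<And>x. x \<in> S \<Longrightarrow> (f has_real_derivative f' x) (at x)" "\<And>x. x \<in> S \<Longrightarrow> \<bar>f' x\<bar> \<le> B"
    and "x \<in> S" "y \<in> S"
  shows "\<bar>f x - f y\<bar> \<le> B * \<bar>x - y\<bar>"
  using field_differentiable_bound[OF assms(1), of f f' B x y] assms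
  by (auto intro: has_field_derivative_at_within)

section \<open>The chain rule for signed powers in Sobolev spaces\<close>

context riemannian_space
begin

sublocale vol: finite_measure vol
  by (rule finite_measure_vol)

lemma wgrad_weak_gradient: "weak_gradient M f X \<Longrightarrow> weak_gradient M f (wgrad M f)"
  unfolding wgrad_def by (rule someI[of "weak_gradient M f"])

lemma vnorm_wgrad:
  assumes "weak_gradient M f X"
  shows "AE p in vol. vnorm M (wgrad M f) p = vnorm M X p"
  by (rule weak_gradient_unique[OF wgrad_weak_gradient[OF assms] assms])

text \<open>The chosen gradient is traded for an explicitly known one, which makes membership in
  \<open>W1p\<close> and the value of \<open>W1p_norm\<close> accessible.\<close>

lemma Lp_norm_wgrad:
  assumes X: "weak_gradient M f X" and "vnorm M X \<in> Lp vol p"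
  shows "vnorm M (wgrad M f) \<in> Lp vol p"
    and "Lp_norm vol p (vnorm M (wgrad M f)) = Lp_norm vol p (vnorm M X)"
proof -
  note m = vnorm_measurable[OF weak_gradientD(1)[OF wgrad_weak_gradient[OF X]]]
  have "AE p in vol. vnorm M X p = vnorm M (wgrad M f) p"
    using vnorm_wgrad[OF X] by eventually_elim simp
  from Lp_cong_AE[OF assms(2) m this]
  show "vnorm M (wgrad M f) \<in> Lp vol p"
    and "Lp_norm vol p (vnorm M (wgrad M f)) = Lp_norm vol p (vnorm M X)" .
qed

lemma sci_Lp:
  assumes u: "u \<in> smooth_compact_interior M" and p: "0 \<le> p"
  shows "u \<in> Lp vol p" "vnorm M (smooth_grad u) \<in> Lp vol p"
proof -
  obtain B where B: "\<And>p. p \<in> points M \<Longrightarrow> \<bar>u p\<bar> \<le> B"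
    "\<And>p. p \<in> points M \<Longrightarrow> \<bar>vnorm M (smooth_grad u) p\<bar> \<le> B"
    using sci_bounded[OF u] by metis
  note s = sci_smooth_fun[OF u]
  show "u \<in> Lp vol p"
    by (rule vol.bounded_Lp[OF smooth_fun_measurable[OF s] _ p, of B]) (use B in \<open>auto simp: space_vol\<close>)
  show "vnorm M (smooth_grad u) \<in> Lp vol p"
    by (rule vol.bounded_Lp[OF vnorm_measurable[OF vector_field_smooth_grad[OF s]] _ p, of B])
      (use B in \<open>auto simp: space_vol\<close>)
qed

lemma vnorm_diff_le:
  assumes X: "vector_field M X" and Y: "vector_field M Y" and p: "p \<in> points M"
  shows "vnorm M (\<lambda>c p. X c p - Y c p) p \<le> vnorm M X p + vnorm M Y p"
proof -
  have Y': "vector_field M (\<lambda>c p. (-1) *\<^sub>R Y c p)" by (rule vector_field_scale[OF Y]) simp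
  have "vnorm M (\<lambda>c p. X c p - Y c p) p \<le> vnorm M X p + vnorm M (\<lambda>c p. (-1) *\<^sub>R Y c p) p"
    by (rule vnorm_add_le[OF X Y' vector_field_diff[OF X Y] p]) simp
  also have "vnorm M (\<lambda>c p. (-1) *\<^sub>R Y c p) p = vnorm M Y p"
    using vnorm_scale[of "\<lambda>_. -1" Y p] by simp
  finally show ?thesis .
qed

lemma abs_vnorm_diff_le:
  assumes X: "vector_field M X" and Y: "vector_field M Y"
  shows "AE p in vol. \<bar>vnorm M (\<lambda>c p. X c p - Y c p) p\<bar> \<le> \<bar>vnorm M X p\<bar> + \<bar>vnorm M Y p\<bar>"
proof (rule AE_I2)
  fix p assume "p \<in> space vol"
  then have p: "p \<in> points M" by (simp add: space_vol)
  show "\<bar>vnorm M (\<lambda>c p. X c p - Y c p) p\<bar> \<le> \<bar>vnorm M X p\<bar> + \<bar>vnorm M Y p\<bar>"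
    using vnorm_nonneg[OF vector_field_diff[OF X Y] p] vnorm_diff_le[OF X Y p] by linarith
qed

text \<open>Approximation in \<open>W1p_norm\<close> at order \<open>q\<close> splits, by uniqueness
  of gradients, into convergence of functions and of gradients. Finite volume lowers the order to
  \<open>p\<close>, and convergence in mean yields a subsequence that converges almost
  everywhere.\<close>

lemma W1p0_approx:
  assumes f: "f \<in> W1p0 M vol q" and pq: "1 \<le> p" "p < q"
  shows "\<exists>u. (\<forall>n. u n \<in> smooth_compact_interior M) \<and>
    (\<lambda>n. \<integral>x. \<bar>f x - u n x\<bar> powr p \<partial>vol) \<longlonglongrightarrow> 0 \<and>
    (\<lambda>n. \<integral>x. \<bar>vnorm M (\<lambda>c p. wgrad M f c p - smooth_grad (u n) c p) x\<bar> powr p \<partial>vol) \<longlonglongrightarrow> 0 \<and>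
    (AE x in vol. (\<lambda>n. u n x) \<longlonglongrightarrow> f x)"
proof -
  have q: "0 < q" "1 \<le> q" and p: "0 < p" "0 \<le> p" using pq by auto
  have fq: "f \<in> Lp vol q" and Nq: "vnorm M (wgrad M f) \<in> Lp vol q"
    and "\<exists>X. weak_gradient M f X"
    and ap: "\<forall>\<epsilon>>0. \<exists>u\<in>smooth_compact_interior M. W1p_norm M vol q (\<lambda>x. f x - u x) < \<epsilon>"
    using f by (auto simp: W1p0_def W1p_def)
  then have wf: "weak_gradient M f (wgrad M f)" using wgrad_weak_gradient by blast
  have "\<forall>n. \<exists>u. u \<in> smooth_compact_interior M \<and> W1p_norm M vol q (\<lambda>x. f x - u x) < 1 / real (Suc n)"
    using ap by (metis of_nat_0_less_iff zero_less_Suc zero_less_divide_1_iff)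
  then obtain u where u: "\<And>n. u n \<in> smooth_compact_interior M"
    and un: "\<And>n. W1p_norm M vol q (\<lambda>x. f x - u n x) < 1 / real (Suc n)" by metis
  define Z where "Z n = vnorm M (\<lambda>c p. wgrad M f c p - smooth_grad (u n) c p)" for n
  have wu: "weak_gradient M (\<lambda>x. f x - u n x) (\<lambda>c p. wgrad M f c p - smooth_grad (u n) c p)" for n
    by (rule weak_gradient_diff[OF wf weak_gradient_smooth_grad[OF sci_smooth_fun[OF u]]])
  have Zq: "Z n \<in> Lp vol q" for n
  proof (rule Lp_add(1)[OF Nq sci_Lp(2)[OF u, of q n]])
    show "Z n \<in> borel_measurable vol" unfolding Z_def by (rule vnorm_measurable[OF weak_gradientD(1)[OF wu]])
    show "AE x in vol. \<bar>Z n x\<bar> \<le> \<bar>vnorm M (wgrad M f) x\<bar> + \<bar>vnorm M (smooth_grad (u n)) x\<bar>"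
      unfolding Z_def
      by (rule abs_vnorm_diff_le[OF weak_gradientD(1)[OF wf] vector_field_smooth_grad[OF sci_smooth_fun[OF u]]])
  qed (use q in auto)
  have fuq: "(\<lambda>x. f x - u n x) \<in> Lp vol q" for n
    by (rule Lp_add(1)[OF fq sci_Lp(1)[OF u, of q n]])
      (use q fq smooth_fun_measurable[OF sci_smooth_fun[OF u]] in \<open>auto simp: Lp_def\<close>)
  have norm: "W1p_norm M vol q (\<lambda>x. f x - u n x) = Lp_norm vol q (\<lambda>x. f x - u n x) + Lp_norm vol q (Z n)" for n
    unfolding W1p_norm_def Z_def using Lp_norm_wgrad(2)[OF wu Zq[unfolded Z_def]] by simp
  have small: "(\<lambda>n. \<integral>x. \<bar>h n x\<bar> powr q \<partial>vol) \<longlonglongrightarrow> 0"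
    if "\<And>n. Lp_norm vol q (h n) < 1 / real (Suc n)" for h :: "nat \<Rightarrow> 'a \<Rightarrow> real"
  proof -
    have "(\<lambda>n. 1 / real (Suc n)) \<longlonglongrightarrow> 0" using LIMSEQ_inverse_real_of_nat by (simp add: inverse_eq_divide)
    then have "(\<lambda>n. Lp_norm vol q (h n)) \<longlonglongrightarrow> 0"
      by (rule Lim_null_comparison[rotated])
        (use that Lp_norm_nonneg[of vol q] in \<open>auto intro!: always_eventually less_imp_le\<close>)
    then have "(\<lambda>n. Lp_norm vol q (h n) powr q) \<longlonglongrightarrow> 0 powr q"
      by (rule tendsto_powr'[OF _ tendsto_const]) (use q in \<open>auto intro!: always_eventually Lp_norm_nonneg\<close>)
    then show ?thesis using q by (simp add: Lp_norm_powr)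
  qed
  \<comment> \<open>Both summands of \<open>W1p_norm\<close> are nonnegative, so each of them is
    below \<open>1 / (n + 1)\<close>.\<close>
  have lu: "(\<lambda>n. \<integral>x. \<bar>f x - u n x\<bar> powr q \<partial>vol) \<longlonglongrightarrow> 0"
    by (rule small) (use un norm Lp_norm_nonneg[of vol q "Z _"] in \<open>smt (verit)\<close>)
  have lZ: "(\<lambda>n. \<integral>x. \<bar>Z n x\<bar> powr q \<partial>vol) \<longlonglongrightarrow> 0"
    by (rule small) (use un norm Lp_norm_nonneg[of vol q "\<lambda>x. f x - u _ x"] in \<open>smt (verit)\<close>)
  have lu': "(\<lambda>n. \<integral>x. \<bar>f x - u n x\<bar> powr p \<partial>vol) \<longlonglongrightarrow> 0"
    using vol.Lp_tendsto_decreasing[OF fuq p(1) less_imp_le[OF pq(2)] lu] .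
  have lZ': "(\<lambda>n. \<integral>x. \<bar>Z n x\<bar> powr p \<partial>vol) \<longlonglongrightarrow> 0"
    using vol.Lp_tendsto_decreasing[OF Zq p(1) less_imp_le[OF pq(2)] lZ] .
  have "integrable vol (\<lambda>x. \<bar>f x - u n x\<bar> powr p)" for n
    using vol.Lp_decreasing(1)[OF fuq p(1) pq(2)] by (simp add: Lp_def)
  then obtain r where r: "strict_mono r" "AE x in vol. (\<lambda>n. \<bar>f x - u (r n) x\<bar> powr p) \<longlonglongrightarrow> 0"
    using tendsto_L1_AE_subseq[of vol "\<lambda>n x. \<bar>f x - u n x\<bar> powr p"] lu' by auto
  have ae: "AE x in vol. (\<lambda>n. u (r n) x) \<longlonglongrightarrow> f x"
    using r(2)
  proof eventually_elim
    case (elim x)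
    have "(\<lambda>n. (\<bar>f x - u (r n) x\<bar> powr p) powr (1/p)) \<longlonglongrightarrow> 0 powr (1/p)"
      by (rule tendsto_powr'[OF elim tendsto_const]) (use p in \<open>auto intro!: always_eventually\<close>)
    then have "(\<lambda>n. \<bar>f x - u (r n) x\<bar>) \<longlonglongrightarrow> 0" using p by (simp add: powr_powr)
    then have "(\<lambda>n. f x - u (r n) x) \<longlonglongrightarrow> 0" by (simp add: tendsto_rabs_zero_iff)
    from tendsto_diff[OF tendsto_const[of "f x"] this] show ?case by simp
  qed
  show ?thesis
    using u ae LIMSEQ_subseq_LIMSEQ[OF lu' r(1)] LIMSEQ_subseq_LIMSEQ[OF lZ' r(1)]
    by (intro exI[of _ "\<lambda>n. u (r n)"]) (simp add: comp_def Z_def)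
qed

text \<open>Here \<open>\<theta>\<close> is a bounded continuous function that agrees with the derivative of \<open>spow s\<close> on the
  essential range of \<open>f\<close>; the error in the gradient splits into a part controlled by that of
  \<open>f - u n\<close> and a part \<open>W n\<close> that vanishes by dominated convergence.\<close>

theorem spow_W1p0:
  assumes f: "f \<in> W1p0 M vol q" and C: "AE x in vol. \<bar>f x\<bar> \<le> C" and pq: "1 \<le> p" "p < q"
    and s: "1 < s"
  shows "(\<lambda>x. spow s (f x)) \<in> W1p0 M vol p"
    and "AE x in vol. vnorm M (wgrad M (\<lambda>x. spow s (f x))) x = s * \<bar>f x\<bar> powr (s - 1) * vnorm M (wgrad M f) x"
proof -
  have p: "0 < p" "0 \<le> p" using pq by auto
  \<comment> \<open>The interval \<open>{0..C'}\<close> must have positive length for the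
    approximation lemma.\<close>
  define C' where "C' = max C 1"
  have C': "C' > 0" "AE x in vol. \<bar>f x\<bar> \<le> C'"
    using C unfolding C'_def by (auto elim!: eventually_mono)
  have fq: "f \<in> Lp vol q" and Nq: "vnorm M (wgrad M f) \<in> Lp vol q" and "\<exists>X. weak_gradient M f X"
    using f by (auto simp: W1p0_def W1p_def)
  then have wf: "weak_gradient M f (wgrad M f)" using wgrad_weak_gradient by blast
  define X where "X = wgrad M f"
  define N where "N = vnorm M X"
  note vX = weak_gradientD(1)[OF wf, folded X_def]
  have [measurable]: "f \<in> borel_measurable vol" using fq by (simp add: Lp_def)
  have Np: "N \<in> Lp vol p" using vol.Lp_decreasing(1)[OF Nq p(1) pq(2)] by (simp add: N_def X_def)
  then have [measurable]: "N \<in> borel_measurable vol" by (simp add: Lp_def)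
  have N0: "0 \<le> N x" if "x \<in> points M" for x using vnorm_nonneg[OF vX that] by (simp add: N_def)
  obtain u where u': "\<forall>n. u n \<in> smooth_compact_interior M"
    and lu: "(\<lambda>n. \<integral>x. \<bar>f x - u n x\<bar> powr p \<partial>vol) \<longlonglongrightarrow> 0"
    and lZ: "(\<lambda>n. \<integral>x. \<bar>vnorm M (\<lambda>c p. X c p - smooth_grad (u n) c p) x\<bar> powr p \<partial>vol) \<longlonglongrightarrow> 0"
    and ae: "AE x in vol. (\<lambda>n. u n x) \<longlonglongrightarrow> f x"
    using W1p0_approx[OF f pq] unfolding X_def by (elim exE conjE)
  have u: "u n \<in> smooth_compact_interior M" for n using u' by (rule spec)
  define g where "g t = s * t powr (s - 1)" for t
  have "continuous_on {0..C'} g"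
    unfolding g_def using s by (intro continuous_intros continuous_on_powr') auto
  from smooth_bounded_derivative_approx[OF C'(1) this]
  obtain \<theta> L where \<theta>': "continuous_on UNIV \<theta>" "\<forall>x. \<bar>\<theta> x\<bar> \<le> L" "\<forall>x. \<bar>x\<bar> \<le> C' \<longrightarrow> \<theta> x = g \<bar>x\<bar>"
    and \<phi>ex: "\<forall>\<epsilon>>0. \<exists>\<phi> \<phi>'. (\<forall>k. Ck_on k UNIV \<phi>) \<and> \<phi> 0 = (0::real) \<and>
       (\<forall>x. (\<phi> has_real_derivative \<phi>' x) (at x)) \<and> continuous_on UNIV \<phi>' \<and> (\<forall>x. \<bar>\<phi>' x - \<theta> x\<bar> < \<epsilon>)"
    by (elim exE conjE)
  have \<theta>: "continuous_on UNIV \<theta>" "\<And>x. \<bar>\<theta> x\<bar> \<le> L" "\<And>x. \<bar>x\<bar> \<le> C' \<Longrightarrow> \<theta> x = g \<bar>x\<bar>"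
    using \<theta>' by simp_all
  define e where "e n = 1 / real (Suc n)" for n
  have e: "0 < e n" "e n \<le> 1" for n by (auto simp: e_def)
  have le: "e \<longlonglongrightarrow> 0" using LIMSEQ_inverse_real_of_nat by (simp add: inverse_eq_divide e_def[abs_def])
  define P where "P n \<phi> \<phi>' \<longleftrightarrow> (\<forall>k. Ck_on k UNIV \<phi>) \<and> \<phi> 0 = (0::real) \<and>
       (\<forall>x. (\<phi> has_real_derivative \<phi>' x) (at x)) \<and> continuous_on UNIV \<phi>' \<and> (\<forall>x. \<bar>\<phi>' x - \<theta> x\<bar> < e n)"
    for n \<phi> \<phi>'
  have "\<forall>n. \<exists>\<phi> \<phi>'. P n \<phi> \<phi>'" unfolding P_def using \<phi>ex e(1) by simp
  then obtain \<phi> \<phi>' where "\<And>n. P n (\<phi> n) (\<phi>' n)" by metis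
  then have \<phi>: "\<And>n k. Ck_on k UNIV (\<phi> n)" "\<And>n. \<phi> n 0 = (0::real)"
    "\<And>n x. (\<phi> n has_real_derivative \<phi>' n x) (at x)" "\<And>n. continuous_on UNIV (\<phi>' n)"
    "\<And>n x. \<bar>\<phi>' n x - \<theta> x\<bar> < e n"
    unfolding P_def by simp_all
  have L0: "0 \<le> L" using \<theta>(2)[of 0] by linarith
  \<comment> \<open>\<open>\<theta>\<close> is bounded by \<open>L\<close> and the error
    \<open>e n\<close> is at most 1, so the functions \<open>\<phi> n\<close> share the Lipschitz
    constant \<open>L + 1\<close>.\<close>
  have \<phi>'L: "\<bar>\<phi>' n x\<bar> \<le> L + 1" for n x using \<phi>(5)[of n x] \<theta>(2)[of x] e(2)[of n] by linarith
  have [measurable]: "\<theta> \<in> borel_measurable borel" "\<phi>' n \<in> borel_measurable borel" for n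
    using \<theta>(1) \<phi>(4) by (auto intro: borel_measurable_continuous_onI)
  have [measurable]: "u n \<in> borel_measurable vol" for n
    by (rule smooth_fun_measurable[OF sci_smooth_fun[OF u]])
  define v where "v n x = \<phi> n (u n x)" for n x
  have v: "v n \<in> smooth_compact_interior M" for n
    unfolding v_def[abs_def] by (rule sci_compose[OF u \<phi>(1,2)])
  have [measurable]: "v n \<in> borel_measurable vol" for n
    by (rule smooth_fun_measurable[OF sci_smooth_fun[OF v]])
  define h where "h x = spow s (f x)" for x
  have [measurable]: "h \<in> borel_measurable vol" unfolding h_def[abs_def] by measurable
  \<comment> \<open>The gradient predicted by the chain rule; the gradients of \<open>v n\<close>
    are shown to converge to it.\<close>
  define Y where "Y c x = (s * \<bar>f x\<bar> powr (s - 1)) *\<^sub>R X c x" for c x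
  have vY: "vector_field M Y"
    unfolding Y_def[abs_def] by (rule vector_field_scale[OF vX]) measurable
  have Yn: "vnorm M Y x = s * \<bar>f x\<bar> powr (s - 1) * N x" for x
    unfolding Y_def[abs_def] using vnorm_scale[of "\<lambda>x. s * \<bar>f x\<bar> powr (s - 1)" X x] s by (simp add: N_def)
  have hp: "h \<in> Lp vol p"
  proof (rule vol.bounded_Lp)
    show "AE x in vol. \<bar>h x\<bar> \<le> C' powr s"
      using C'(2) by eventually_elim (use s in \<open>auto simp: h_def abs_spow intro: powr_mono2\<close>)
  qed (use p in auto)
  have Yp: "vnorm M Y \<in> Lp vol p"
  proof (rule Lp_bound[OF Np vnorm_measurable[OF vY]])
    show "AE x in vol. \<bar>vnorm M Y x\<bar> \<le> s * C' powr (s - 1) * \<bar>N x\<bar>"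
      using C'(2)
    proof eventually_elim
      case (elim x)
      then have "\<bar>f x\<bar> powr (s - 1) \<le> C' powr (s - 1)" using s by (intro powr_mono2) auto
      then have "s * \<bar>f x\<bar> powr (s - 1) * \<bar>N x\<bar> \<le> s * C' powr (s - 1) * \<bar>N x\<bar>"
        using s by (intro mult_right_mono mult_left_mono) auto
      then show ?case using s by (simp add: Yn abs_mult)
    qed
  qed (use s p in auto)
  have wv: "weak_gradient M (v n) (smooth_grad (v n))" for n
    by (rule weak_gradient_smooth_grad[OF sci_smooth_fun[OF v]])
  define R where "R n = vnorm M (\<lambda>c x. Y c x - smooth_grad (v n) c x)" for n
  have vR: "vector_field M (\<lambda>c x. Y c x - smooth_grad (v n) c x)" for n
    by (rule vector_field_diff[OF vY weak_gradientD(1)[OF wv]])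
  have [measurable]: "R n \<in> borel_measurable vol" for n unfolding R_def by (rule vnorm_measurable[OF vR])
  define Z where "Z n = vnorm M (\<lambda>c x. X c x - smooth_grad (u n) c x)" for n
  have vZ: "vector_field M (\<lambda>c x. X c x - smooth_grad (u n) c x)" for n
    by (rule vector_field_diff[OF vX vector_field_smooth_grad[OF sci_smooth_fun[OF u]]])
  have [measurable]: "Z n \<in> borel_measurable vol" for n unfolding Z_def by (rule vnorm_measurable[OF vZ])
  have Zp: "Z n \<in> Lp vol p" for n
  proof (rule Lp_add(1)[OF Np sci_Lp(2)[OF u p(2), of n] p(2)])
    show "AE x in vol. \<bar>Z n x\<bar> \<le> \<bar>N x\<bar> + \<bar>vnorm M (smooth_grad (u n)) x\<bar>"
      unfolding Z_def N_def
      by (rule abs_vnorm_diff_le[OF vX vector_field_smooth_grad[OF sci_smooth_fun[OF u]]])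
  qed measurable
  have fup: "(\<lambda>x. f x - u n x) \<in> Lp vol p" for n
    by (rule Lp_add(1)[OF vol.Lp_decreasing(1)[OF fq p(1) pq(2)] sci_Lp(1)[OF u, of p n] p(2)])
      (use p in auto)
  \<comment> \<open>On the essential range of \<open>f\<close> the derivatives of
    \<open>spow s\<close> and \<open>\<phi> n\<close> differ by at most \<open>e n\<close>, and both
    functions vanish at 0; this gives the first term. Replacing \<open>f\<close> by
    \<open>u n\<close> inside \<open>\<phi> n\<close> costs the second.\<close>
  have hv: "AE x in vol. \<bar>h x - v n x\<bar> \<le> \<bar>C' * e n\<bar> + \<bar>(L + 1) * (f x - u n x)\<bar>" for n
    using C'(2)
  proof eventually_elim
    case (elim x)
    have "\<bar>(spow s (f x) - \<phi> n (f x)) - (spow s 0 - \<phi> n 0)\<bar> \<le> e n * \<bar>f x - 0\<bar>"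
    proof (rule real_lipschitz[where f' = "\<lambda>y. s * \<bar>y\<bar> powr (s - 1) - \<phi>' n y" and S = "{-C'..C'}"])
      show "((\<lambda>x. spow s x - \<phi> n x) has_real_derivative s * \<bar>y\<bar> powr (s - 1) - \<phi>' n y) (at y)" for y
        by (intro DERIV_diff DERIV_spow[OF s] \<phi>(3))
      show "\<bar>s * \<bar>y\<bar> powr (s - 1) - \<phi>' n y\<bar> \<le> e n" if "y \<in> {-C'..C'}" for y
        using \<phi>(5)[of n y] \<theta>(3)[of y] that by (auto simp: g_def abs_minus_commute)
    qed (use elim C'(1) in auto)
    then have "\<bar>spow s (f x) - \<phi> n (f x)\<bar> \<le> e n * \<bar>f x\<bar>" by (simp add: \<phi>(2))
    also have "\<dots> \<le> e n * C'" using elim e(1)[of n] by (intro mult_left_mono) auto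
    finally have 1: "\<bar>spow s (f x) - \<phi> n (f x)\<bar> \<le> C' * e n" by (simp add: mult.commute)
    have "\<bar>\<phi> n (f x) - \<phi> n (u n x)\<bar> \<le> (L + 1) * \<bar>f x - u n x\<bar>"
      by (rule real_lipschitz[where f' = "\<phi>' n" and S = UNIV]) (use \<phi>(3) \<phi>'L in auto)
    then show ?case using 1 L0 C'(1) e(1)[of n] by (simp add: h_def v_def abs_mult)
  qed
  have lhv: "(\<lambda>n. \<integral>x. \<bar>h x - v n x\<bar> powr p \<partial>vol) \<longlonglongrightarrow> 0"
  proof (rule Lim_null_comparison)
    let ?r = "\<lambda>n. 2 powr p * ((\<integral>x. \<bar>C' * e n\<bar> powr p \<partial>vol) + (\<integral>x. \<bar>(L + 1) * (f x - u n x)\<bar> powr p \<partial>vol))"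
    have c: "(\<lambda>x. C' * e n) \<in> Lp vol p" for n
      by (rule vol.bounded_Lp[of _ "\<bar>C' * e n\<bar>"]) (use p in auto)
    have d: "(\<lambda>x. (L + 1) * (f x - u n x)) \<in> Lp vol p" for n
      by (rule Lp_bound[OF fup[of n], of _ "L + 1"]) (use p L0 in \<open>auto simp: abs_mult\<close>)
    have "norm (\<integral>x. \<bar>h x - v n x\<bar> powr p \<partial>vol) \<le> ?r n" for n
      using Lp_add(2)[OF c d p(2) _ hv[of n]] by simp
    then show "eventually (\<lambda>n. norm (\<integral>x. \<bar>h x - v n x\<bar> powr p \<partial>vol) \<le> ?r n) sequentially" by simp
    have "(\<lambda>n. (C' * e n) powr p) \<longlonglongrightarrow> (C' * 0) powr p"
      by (rule tendsto_powr'[OF tendsto_mult_left[OF le] tendsto_const])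
        (use p C'(1) e(1) in \<open>auto intro!: always_eventually mult_nonneg_nonneg less_imp_le\<close>)
    then have "(\<lambda>n. (\<integral>x. \<bar>C' * e n\<bar> powr p \<partial>vol)) \<longlonglongrightarrow> 0"
      using tendsto_mult_left[of "\<lambda>n. (C' * e n) powr p" 0 _ "measure vol (space vol)"] C'(1) e(1)
      by (simp add: abs_mult less_imp_le)
    moreover have "(\<lambda>n. (L + 1) powr p * (\<integral>x. \<bar>f x - u n x\<bar> powr p \<partial>vol)) \<longlonglongrightarrow> 0"
      using tendsto_mult_left[OF lu, of "(L + 1) powr p"] by simp
    then have "(\<lambda>n. (\<integral>x. \<bar>(L + 1) * (f x - u n x)\<bar> powr p \<partial>vol)) \<longlonglongrightarrow> 0"
      using L0 by (simp add: abs_mult powr_mult)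
    ultimately have "(\<lambda>n. (\<integral>x. \<bar>C' * e n\<bar> powr p \<partial>vol) + (\<integral>x. \<bar>(L + 1) * (f x - u n x)\<bar> powr p \<partial>vol)) \<longlonglongrightarrow> 0 + 0"
      by (rule tendsto_add)
    from tendsto_mult_left[OF this, of "2 powr p"] show "?r \<longlonglongrightarrow> 0" by simp
  qed
  \<comment> \<open>The approximation error \<open>e n\<close> plus the oscillation of
    \<open>\<theta>\<close> between \<open>u n x\<close> and \<open>f x\<close>, times the gradient
    norm of \<open>f\<close>. Boundedness of \<open>\<theta>\<close> dominates it by a fixed
    multiple of \<open>N\<close>, and convergence almost everywhere of \<open>u n\<close> sends it
    to 0.\<close>
  define W where "W n x = (e n + \<bar>\<theta> (u n x) - \<theta> (f x)\<bar>) * N x" for n x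
  have [measurable]: "W n \<in> borel_measurable vol" for n unfolding W_def[abs_def] by measurable
  have Wle: "\<bar>W n x\<bar> \<le> (1 + 2 * L) * \<bar>N x\<bar>" for n x
  proof -
    have "\<bar>e n + \<bar>\<theta> (u n x) - \<theta> (f x)\<bar>\<bar> \<le> 1 + 2 * L"
      using e[of n] \<theta>(2)[of "u n x"] \<theta>(2)[of "f x"] by linarith
    then show ?thesis unfolding W_def abs_mult by (rule mult_right_mono) simp
  qed
  have Wp: "W n \<in> Lp vol p" for n
    by (rule Lp_bound[OF Np, of _ "1 + 2 * L"]) (use Wle L0 p in auto)
  have lW: "(\<lambda>n. \<integral>x. \<bar>W n x\<bar> powr p \<partial>vol) \<longlonglongrightarrow> 0"
  proof -
    have "(\<lambda>n. \<integral>x. \<bar>W n x\<bar> powr p \<partial>vol) \<longlonglongrightarrow> (\<integral>x. 0 \<partial>vol)"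
    proof (rule integral_dominated_convergence[where w = "\<lambda>x. (1 + 2 * L) powr p * \<bar>N x\<bar> powr p"])
      show "integrable vol (\<lambda>x. (1 + 2 * L) powr p * \<bar>N x\<bar> powr p)" using Np by (simp add: Lp_def)
      show "AE x in vol. norm (\<bar>W n x\<bar> powr p) \<le> (1 + 2 * L) powr p * \<bar>N x\<bar> powr p" for n
      proof (rule AE_I2)
        fix x
        have "\<bar>W n x\<bar> powr p \<le> ((1 + 2 * L) * \<bar>N x\<bar>) powr p"
          using Wle p by (intro powr_mono2) auto
        then show "norm (\<bar>W n x\<bar> powr p) \<le> (1 + 2 * L) powr p * \<bar>N x\<bar> powr p"
          using L0 by (simp add: powr_mult)
      qed
      show "AE x in vol. (\<lambda>n. \<bar>W n x\<bar> powr p) \<longlonglongrightarrow> 0"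
        using ae
      proof eventually_elim
        case (elim x)
        have "isCont \<theta> (f x)" using \<theta>(1) by (simp add: continuous_on_eq_continuous_at)
        from isCont_tendsto_compose[OF this elim] have "(\<lambda>n. \<theta> (u n x)) \<longlonglongrightarrow> \<theta> (f x)" .
        then have "(\<lambda>n. \<bar>(e n + \<bar>\<theta> (u n x) - \<theta> (f x)\<bar>) * N x\<bar>) \<longlonglongrightarrow> \<bar>(0 + \<bar>\<theta> (f x) - \<theta> (f x)\<bar>) * N x\<bar>"
          by (intro tendsto_intros le)
        then have "(\<lambda>n. \<bar>W n x\<bar>) \<longlonglongrightarrow> 0" by (simp add: W_def)
        then have "(\<lambda>n. \<bar>W n x\<bar> powr p) \<longlonglongrightarrow> 0 powr p"
          by (rule tendsto_powr'[OF _ tendsto_const]) (use p in \<open>auto intro!: always_eventually\<close>)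
        then show ?case by simp
      qed
    qed measurable
    then show ?thesis by simp
  qed
  have ZLp: "(\<lambda>x. (L + 1) * Z n x) \<in> Lp vol p" for n
    by (rule Lp_bound[OF Zp[of n], of _ "L + 1"]) (use p L0 in \<open>auto simp: abs_mult\<close>)
  have Rle: "AE x in vol. \<bar>R n x\<bar> \<le> \<bar>(L + 1) * Z n x\<bar> + \<bar>W n x\<bar>" for n
  proof -
    have "AE x in vol. x \<in> points M" using AE_space[of vol] by (simp add: space_vol)
    then show ?thesis
      using C'(2)
    proof eventually_elim
      case (elim x)
      define a where "a x = \<phi>' n (u n x)" for x
      define b where "b x = s * \<bar>f x\<bar> powr (s - 1) - \<phi>' n (u n x)" for x
      have am: "a \<in> borel_measurable vol" "b \<in> borel_measurable vol"
        unfolding a_def[abs_def] b_def[abs_def] by measurable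
      note vZ' = vector_field_scale[OF vZ[of n] am(1)]
      note vX' = vector_field_scale[OF vX am(2)]
      \<comment> \<open>The difference of gradients is split so that the error
        \<open>X - smooth_grad (u n)\<close> is multiplied by the bounded coefficient
        \<open>\<phi>' n (u n x)\<close>, while the mismatch \<open>b\<close> of the two derivatives
        multiplies the fixed field \<open>X\<close>.\<close>
      have "vnorm M (\<lambda>c x. Y c x - smooth_grad (v n) c x) x
          \<le> vnorm M (\<lambda>c x. a x *\<^sub>R (X c x - smooth_grad (u n) c x)) x + vnorm M (\<lambda>c x. b x *\<^sub>R X c x) x"
      proof (rule vnorm_add_le[OF vZ' vX' vR[of n] elim(1)])
        fix c assume c: "c \<in> atlas M" "x \<in> dom c"
        have "smooth_grad (v n) c x = \<phi>' n (u n x) *\<^sub>R smooth_grad (u n) c x"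
          unfolding v_def[abs_def]
          by (rule smooth_grad_compose[OF sci_smooth_fun[OF u] sci_smooth_fun[OF v[unfolded v_def[abs_def]]] \<phi>(3) c])
        then show "Y c x - smooth_grad (v n) c x = a x *\<^sub>R (X c x - smooth_grad (u n) c x) + b x *\<^sub>R X c x"
          by (simp add: Y_def a_def b_def algebra_simps)
      qed
      then have "R n x \<le> \<bar>a x\<bar> * Z n x + \<bar>b x\<bar> * N x"
        unfolding R_def Z_def N_def by (simp only: vnorm_scale)
      moreover have Z0: "0 \<le> Z n x" unfolding Z_def by (rule vnorm_nonneg[OF vZ elim(1)])
      moreover have "0 \<le> R n x" unfolding R_def by (rule vnorm_nonneg[OF vR elim(1)])
      moreover have "\<bar>a x\<bar> * Z n x \<le> (L + 1) * Z n x"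
        using \<phi>'L Z0 by (intro mult_right_mono) (auto simp: a_def)
      moreover have "\<bar>b x\<bar> * N x \<le> W n x"
      proof -
        \<comment> \<open>On the essential range of \<open>f\<close> the true derivative equals
          \<open>\<theta> (f x)\<close>; inserting \<open>\<theta> (u n x)\<close> separates the
          oscillation from the approximation error.\<close>
        have "\<bar>b x\<bar> \<le> e n + \<bar>\<theta> (u n x) - \<theta> (f x)\<bar>"
          using \<phi>(5)[of n "u n x"] \<theta>(3)[OF elim(2)] by (simp add: b_def g_def)
        then show ?thesis unfolding W_def by (rule mult_right_mono) (rule N0[OF elim(1)])
      qed
      ultimately show ?case using L0 by linarith
    qed
  qed
  have Rp: "R n \<in> Lp vol p" for n by (rule Lp_add(1)[OF ZLp Wp p(2) _ Rle]) measurable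
  have lR: "(\<lambda>n. \<integral>x. \<bar>R n x\<bar> powr p \<partial>vol) \<longlonglongrightarrow> 0"
  proof (rule Lim_null_comparison)
    let ?r = "\<lambda>n. 2 powr p * ((\<integral>x. \<bar>(L + 1) * Z n x\<bar> powr p \<partial>vol) + (\<integral>x. \<bar>W n x\<bar> powr p \<partial>vol))"
    have "norm (\<integral>x. \<bar>R n x\<bar> powr p \<partial>vol) \<le> ?r n" for n
      using Lp_add(2)[OF ZLp Wp p(2) _ Rle[of n]] by simp
    then show "eventually (\<lambda>n. norm (\<integral>x. \<bar>R n x\<bar> powr p \<partial>vol) \<le> ?r n) sequentially" by simp
    have "(\<lambda>n. (L + 1) powr p * (\<integral>x. \<bar>Z n x\<bar> powr p \<partial>vol)) \<longlonglongrightarrow> 0"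
      using tendsto_mult_left[OF lZ[folded Z_def], of "(L + 1) powr p"] by simp
    then have "(\<lambda>n. (\<integral>x. \<bar>(L + 1) * Z n x\<bar> powr p \<partial>vol)) \<longlonglongrightarrow> 0"
      using L0 by (simp add: abs_mult powr_mult)
    from tendsto_mult_left[OF tendsto_add[OF this lW], of "2 powr p"] show "?r \<longlonglongrightarrow> 0" by simp
  qed
  have hvp: "(\<lambda>x. h x - v n x) \<in> Lp vol p" for n
    by (rule Lp_add(1)[OF hp sci_Lp(1)[OF v, of p n] p(2)]) (use p in auto)
  \<comment> \<open>The limit lemma works with convergence in mean, which follows from convergence
    at order \<open>p \<ge> 1\<close> by finite volume.\<close>
  have wh: "weak_gradient M h Y"
  proof (rule weak_gradient_limit[where v = v and X = "\<lambda>n. smooth_grad (v n)"])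
    show "integrable vol h" by (rule vol.Lp_imp_integrable[OF hp pq(1)])
    show "vector_field M Y" by (rule vY)
    show "integrable vol (vnorm M Y)" by (rule vol.Lp_imp_integrable[OF Yp pq(1)])
    show "weak_gradient M (v n) (smooth_grad (v n))" for n by (rule wv)
    show "integrable vol (v n)" for n by (rule vol.Lp_imp_integrable[OF sci_Lp(1)[OF v p(2)] pq(1)])
    show "integrable vol (vnorm M (smooth_grad (v n)))" for n
      by (rule vol.Lp_imp_integrable[OF sci_Lp(2)[OF v p(2)] pq(1)])
    show "integrable vol (vnorm M (\<lambda>c p. Y c p - smooth_grad (v n) c p))" for n
      using vol.Lp_imp_integrable[OF Rp pq(1)] by (simp add: R_def)
    show "(\<lambda>n. \<integral>p. \<bar>h p - v n p\<bar> \<partial>vol) \<longlonglongrightarrow> 0"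
      using vol.Lp_tendsto_decreasing[OF hvp zero_less_one pq(1) lhv] by simp
    have "(\<integral>x. \<bar>R n x\<bar> \<partial>vol) = (\<integral>x. R n x \<partial>vol)" for n
      by (rule Bochner_Integration.integral_cong[OF refl])
        (use vnorm_nonneg[OF vR] in \<open>simp add: space_vol R_def\<close>)
    then show "(\<lambda>n. \<integral>p. vnorm M (\<lambda>c p. Y c p - smooth_grad (v n) c p) p \<partial>vol) \<longlonglongrightarrow> 0"
      using vol.Lp_tendsto_decreasing[OF Rp zero_less_one pq(1) lR] by (simp add: R_def)
  qed
  have hW: "h \<in> W1p M vol p"
    unfolding W1p_def using hp wh Lp_norm_wgrad(1)[OF wh Yp] by blast
  have norm: "W1p_norm M vol p (\<lambda>x. h x - v n x) = Lp_norm vol p (\<lambda>x. h x - v n x) + Lp_norm vol p (R n)" for n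
    unfolding W1p_norm_def
    using Lp_norm_wgrad(2)[OF weak_gradient_diff[OF wh wv] Rp[unfolded R_def]] by (simp add: R_def)
  have "(\<lambda>n. W1p_norm M vol p (\<lambda>x. h x - v n x)) \<longlonglongrightarrow> 0 + 0"
    unfolding norm by (intro tendsto_add Lp_norm_tendsto_0 p lhv lR)
  then have lim: "(\<lambda>n. W1p_norm M vol p (\<lambda>x. h x - v n x)) \<longlonglongrightarrow> 0" by simp
  have "\<exists>w\<in>smooth_compact_interior M. W1p_norm M vol p (\<lambda>x. h x - w x) < \<epsilon>" if "\<epsilon> > 0" for \<epsilon>
  proof -
    have "eventually (\<lambda>n. W1p_norm M vol p (\<lambda>x. h x - v n x) < \<epsilon>) sequentially"
      using lim that by (rule order_tendstoD)
    then obtain n where "W1p_norm M vol p (\<lambda>x. h x - v n x) < \<epsilon>" by (auto simp: eventually_sequentially)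
    then show ?thesis using v by blast
  qed
  then show "(\<lambda>x. spow s (f x)) \<in> W1p0 M vol p"
    using hW unfolding W1p0_def h_def[abs_def] by blast
  show "AE x in vol. vnorm M (wgrad M (\<lambda>x. spow s (f x))) x = s * \<bar>f x\<bar> powr (s - 1) * vnorm M (wgrad M f) x"
    using vnorm_wgrad[OF wh] unfolding Yn N_def X_def h_def[abs_def] .
qed

section \<open>Comparison of Rayleigh quotients\<close>

theorem rayleigh_quotient_spow:
  assumes fm: "f \<in> borel_measurable vol" and C: "AE x in vol. \<bar>f x\<bar> \<le> C" and pq: "1 \<le> p" "p < q"
    and f0: "\<not> (AE x in vol. f x = 0)"
  shows "grad_norm M vol p (\<lambda>x. spow (q / p) (f x)) / ennreal (Lp_norm vol p (\<lambda>x. spow (q / p) (f x)))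
    \<le> ennreal (q / p) * (grad_norm M vol q f / ennreal (Lp_norm vol q f))"
proof -
  define s where "s = q / p"
  have p: "0 < p" and q: "0 < q" and s: "1 < s" "0 < s" using pq by (auto simp: s_def field_simps)
  have fq: "f \<in> Lp vol q" by (rule vol.bounded_Lp[OF fm C]) (use q in simp)
  \<comment> \<open>This keeps both denominators positive, since the norm of the signed power is a
    power of the norm of \<open>f\<close>.\<close>
  have "Lp_norm vol q f \<noteq> 0"
  proof
    assume "Lp_norm vol q f = 0"
    then have "(\<integral>x. \<bar>f x\<bar> powr q \<partial>vol) = 0" by (simp add: Lp_norm_def)
    then have "AE x in vol. \<bar>f x\<bar> powr q = 0"
      using integral_nonneg_eq_0_iff_AE[of vol "\<lambda>x. \<bar>f x\<bar> powr q"] fq by (simp add: Lp_def)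
    then show False using f0 by simp
  qed
  then have fpos: "0 < Lp_norm vol q f" using Lp_norm_nonneg[of vol q f] by linarith
  have sn: "Lp_norm vol p (\<lambda>x. spow s (f x)) = Lp_norm vol q f powr s"
    using p q by (simp add: Lp_norm_def abs_spow powr_powr s_def)
  show ?thesis
  proof (cases "f \<in> W1p0 M vol q")
    \<comment> \<open>Outside the Sobolev space the right-hand side is infinite.\<close>
    case False
    then have "grad_norm M vol q f / ennreal (Lp_norm vol q f) = \<infinity>"
      by (simp add: grad_norm_def ennreal_top_divide)
    then have "ennreal (q / p) * (grad_norm M vol q f / ennreal (Lp_norm vol q f)) = \<infinity>"
      using p q by (simp add: ennreal_mult_top)
    then show ?thesis by simp
  next
    case True
    let ?N = "vnorm M (wgrad M f)"
    note S = spow_W1p0[OF True C pq s(1)]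
    have Nq: "?N \<in> Lp vol q" using True by (simp add: W1p0_def W1p_def)
    then have Nm: "?N \<in> borel_measurable vol" by (simp add: Lp_def)
    have hW: "(\<lambda>x. spow s (f x)) \<in> W1p M vol p" using S(1) by (simp add: W1p0_def)
    then have hm: "vnorm M (wgrad M (\<lambda>x. spow s (f x))) \<in> borel_measurable vol" by (simp add: W1p_def Lp_def)
    let ?A = "\<integral>x. \<bar>f x\<bar> powr q \<partial>vol" and ?B = "\<integral>x. \<bar>?N x\<bar> powr q \<partial>vol"
    have th: "0 < p / q" "p / q < 1" using p q pq by auto
    note H = Holder_weighted(2)[of vol "\<lambda>x. \<bar>f x\<bar> powr q" "\<lambda>x. \<bar>?N x\<bar> powr q" "p / q"]
    have pt: "\<bar>s * \<bar>f x\<bar> powr (s - 1) * ?N x\<bar> powr p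
        = s powr p * ((\<bar>f x\<bar> powr q) powr (1 - p / q) * (\<bar>?N x\<bar> powr q) powr (p / q))" for x
    proof -
      have "(s - 1) * p = q * (1 - p / q)" using p q by (simp add: s_def field_simps)
      then show ?thesis using s p q by (simp add: abs_mult powr_mult powr_powr)
    qed
    have "(\<integral>x. \<bar>vnorm M (wgrad M (\<lambda>x. spow s (f x))) x\<bar> powr p \<partial>vol)
        = (\<integral>x. s powr p * ((\<bar>f x\<bar> powr q) powr (1 - p / q) * (\<bar>?N x\<bar> powr q) powr (p / q)) \<partial>vol)"
    proof (rule integral_cong_AE)
      show "AE x in vol. \<bar>vnorm M (wgrad M (\<lambda>x. spow s (f x))) x\<bar> powr p
          = s powr p * ((\<bar>f x\<bar> powr q) powr (1 - p / q) * (\<bar>?N x\<bar> powr q) powr (p / q))"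
        using S(2) by eventually_elim (simp only: pt)
    qed (use hm fm Nm in measurable)
    also have "\<dots> \<le> s powr p * (?A powr (1 - p / q) * ?B powr (p / q))"
      using H fq Nq th by (simp add: Lp_def mult_left_mono)
    finally have "Lp_norm vol p (vnorm M (wgrad M (\<lambda>x. spow s (f x))))
        \<le> (s powr p * (?A powr (1 - p / q) * ?B powr (p / q))) powr (1 / p)"
      unfolding Lp_norm_def by (intro powr_mono2) (use p in auto)
    also have "\<dots> = s * (Lp_norm vol q f powr (s - 1) * Lp_norm vol q ?N)"
    proof -
      \<comment> \<open>The root turns the first Hoelder factor into
        \<open>Lp_norm vol q f powr (s - 1)\<close>. Divided by
        \<open>Lp_norm vol q f powr s\<close>, it leaves exactly one norm in the
        denominator.\<close>
      have "(1 - p / q) * (1 / p) = 1 / q * (s - 1)" using p q by (simp add: s_def field_simps)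
      then show ?thesis using p q s by (simp add: Lp_norm_def powr_mult powr_powr)
    qed
    finally have le: "Lp_norm vol p (vnorm M (wgrad M (\<lambda>x. spow s (f x))))
        \<le> s * (Lp_norm vol q f powr (s - 1) * Lp_norm vol q ?N)" .
    have "Lp_norm vol p (vnorm M (wgrad M (\<lambda>x. spow s (f x)))) / Lp_norm vol q f powr s
        \<le> s * (Lp_norm vol q f powr (s - 1) * Lp_norm vol q ?N) / Lp_norm vol q f powr s"
      using le by (intro divide_right_mono) auto
    also have "\<dots> = s * (Lp_norm vol q ?N / Lp_norm vol q f)"
      using fpos by (simp add: powr_diff)
    finally have *: "Lp_norm vol p (vnorm M (wgrad M (\<lambda>x. spow s (f x)))) / Lp_norm vol q f powr s
        \<le> s * (Lp_norm vol q ?N / Lp_norm vol q f)" .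
    have "ennreal (Lp_norm vol p (vnorm M (wgrad M (\<lambda>x. spow s (f x))))) / ennreal (Lp_norm vol q f powr s)
        = ennreal (Lp_norm vol p (vnorm M (wgrad M (\<lambda>x. spow s (f x)))) / Lp_norm vol q f powr s)"
      using fpos by (intro divide_ennreal) (auto simp: Lp_norm_nonneg)
    also have "\<dots> \<le> ennreal (s * (Lp_norm vol q ?N / Lp_norm vol q f))" using * by (rule ennreal_leI)
    also have "\<dots> = ennreal s * (ennreal (Lp_norm vol q ?N) / ennreal (Lp_norm vol q f))"
      using fpos s by (subst ennreal_mult) (auto simp: divide_ennreal Lp_norm_nonneg)
    finally show ?thesis
      using S(1) True sn by (simp add: grad_norm_def s_def)
  qed
qed

end

subsection \<open>Signed powers of classes and the genus\<close>

definition pow_class :: "real \<Rightarrow> ('a \<Rightarrow> real) set \<Rightarrow> ('a \<Rightarrow> real) set" where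
  "pow_class s F = (\<lambda>f x. spow s (f x)) ` F"

lemma pow_class_inverse:
  assumes "s \<noteq> 0"
  shows "pow_class (1 / s) (pow_class s F) = F"
  using spow_spow[OF assms] by (auto simp: pow_class_def image_image)

text \<open>\<open>spow (1 / s)\<close> inverts \<open>spow s\<close>, and both respect equality
  almost everywhere; hence the image of a full class is all of a class.\<close>

lemma pow_class_ae_class:
  assumes s: "s \<noteq> 0" and f: "f \<in> borel_measurable \<mu>"
  shows "pow_class s (ae_class \<mu> f) = ae_class \<mu> (\<lambda>x. spow s (f x))"
proof -
  have sub: "pow_class t (ae_class \<mu> g) \<subseteq> ae_class \<mu> (\<lambda>x. spow t (g x))" for t and g :: "'a \<Rightarrow> real"
    unfolding pow_class_def ae_class_def by (auto elim!: eventually_mono)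
  show ?thesis
  proof
    show "ae_class \<mu> (\<lambda>x. spow s (f x)) \<subseteq> pow_class s (ae_class \<mu> f)"
    proof
      fix g assume g: "g \<in> ae_class \<mu> (\<lambda>x. spow s (f x))"
      then have "(\<lambda>x. spow (1/s) (g x)) \<in> ae_class \<mu> (\<lambda>x. spow (1/s) (spow s (f x)))"
        using sub[of "1/s" "\<lambda>x. spow s (f x)"] by (auto simp: pow_class_def)
      then have "(\<lambda>x. spow (1/s) (g x)) \<in> ae_class \<mu> f" using spow_spow[OF s] by simp
      then have "(\<lambda>x. spow s (spow (1/s) (g x))) \<in> pow_class s (ae_class \<mu> f)"
        unfolding pow_class_def by (rule imageI)
      then show "g \<in> pow_class s (ae_class \<mu> f)" using spow_spow[of "1/s"] s by simp
    qed
  qed (rule sub)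
qed

lemma ae_class_eqI: "AE x in \<mu>. f x = g x \<Longrightarrow> ae_class \<mu> f = ae_class \<mu> g"
  unfolding ae_class_def by (intro Collect_cong conj_cong refl eventually_cong) (auto elim: eventually_mono)

lemma BdE:
  assumes "F \<in> Bd \<mu>"
  obtains f C where "F = ae_class \<mu> f" "f \<in> borel_measurable \<mu>" "\<And>x. x \<in> space \<mu> \<Longrightarrow> \<bar>f x\<bar> \<le> C" "0 \<le> C"
proof -
  obtain f C where *: "F = ae_class \<mu> f" "f \<in> borel_measurable \<mu>" "\<forall>x\<in>space \<mu>. \<bar>f x\<bar> \<le> C"
    using assms by (auto simp: Bd_def)
  have "\<bar>f x\<bar> \<le> max C 0" if "x \<in> space \<mu>" for x using *(3) that by (auto simp: le_max_iff_disj)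
  then show ?thesis using that[OF *(1,2)] by (metis max.cobounded2)
qed

lemma Bd_bounded:
  assumes "F \<in> Bd \<mu>"
  shows "\<exists>C\<ge>0. \<forall>f\<in>F. f \<in> borel_measurable \<mu> \<and> (AE x in \<mu>. \<bar>f x\<bar> \<le> C)"
proof -
  obtain f C where *: "F = ae_class \<mu> f" "f \<in> borel_measurable \<mu>" "\<And>x. x \<in> space \<mu> \<Longrightarrow> \<bar>f x\<bar> \<le> C" "0 \<le> C"
    using BdE[OF assms] by metis
  have "AE x in \<mu>. \<bar>g x\<bar> \<le> C" if "g \<in> F" for g
  proof -
    have "AE x in \<mu>. g x = f x" "AE x in \<mu>. \<bar>f x\<bar> \<le> C" using that * by (auto simp: ae_class_def)
    then show ?thesis by eventually_elim simp
  qed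
  then show ?thesis using * by (auto simp: ae_class_def)
qed

lemma pow_class_Bd:
  assumes F: "F \<in> Bd \<mu>" and s: "0 < s"
  shows "pow_class s F \<in> Bd \<mu>"
proof -
  obtain f C where *: "F = ae_class \<mu> f" "f \<in> borel_measurable \<mu>" "\<And>x. x \<in> space \<mu> \<Longrightarrow> \<bar>f x\<bar> \<le> C" "0 \<le> C"
    using BdE[OF F] by metis
  have "pow_class s F = ae_class \<mu> (\<lambda>x. spow s (f x))"
    using pow_class_ae_class[of s f \<mu>] * s by simp
  moreover have "(\<lambda>x. spow s (f x)) \<in> borel_measurable \<mu>" using *(2) by measurable
  moreover have "\<forall>x\<in>space \<mu>. \<bar>spow s (f x)\<bar> \<le> C powr s"
    using *(3) s by (auto simp: abs_spow intro: powr_mono2)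
  ultimately show ?thesis unfolding Bd_def by blast
qed

lemma pow_class_zero: "s \<noteq> 0 \<Longrightarrow> pow_class s (ae_class \<mu> (\<lambda>_. 0)) = ae_class \<mu> (\<lambda>_. 0)"
  by (simp add: pow_class_ae_class)

lemma pow_class_eq_zero_iff:
  assumes "s \<noteq> 0"
  shows "pow_class s F = ae_class \<mu> (\<lambda>_. 0) \<longleftrightarrow> F = ae_class \<mu> (\<lambda>_. 0)"
  using pow_class_inverse[OF assms, of F] pow_class_zero[of "1/s" \<mu>] pow_class_zero[of s \<mu>] assms by auto

lemma neg_pow_class: "neg_class (pow_class s F) = pow_class s (neg_class F)"
  by (simp add: neg_class_def pow_class_def image_image spow_minus)

lemma Bd_dist_AE:
  assumes F: "F \<in> Bd \<mu>" and G: "G \<in> Bd \<mu>" and fg: "f \<in> F" "g \<in> G"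
  shows "AE x in \<mu>. \<bar>f x - g x\<bar> \<le> Bd_dist \<mu> F G"
proof -
  define S where "S = (SUP f\<in>F. SUP g\<in>G. esssup \<mu> (\<lambda>x. ereal \<bar>f x - g x\<bar>))"
  obtain C where C: "\<forall>f\<in>F. f \<in> borel_measurable \<mu> \<and> (AE x in \<mu>. \<bar>f x\<bar> \<le> C)" using Bd_bounded[OF F] by auto
  obtain C' where C': "\<forall>f\<in>G. f \<in> borel_measurable \<mu> \<and> (AE x in \<mu>. \<bar>f x\<bar> \<le> C')" using Bd_bounded[OF G] by auto
  have "S \<le> ereal (C + C')"
    unfolding S_def
  proof (intro SUP_least)
    fix f g assume "f \<in> F" "g \<in> G"
    then have *: "f \<in> borel_measurable \<mu>" "g \<in> borel_measurable \<mu>"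
      "AE x in \<mu>. \<bar>f x\<bar> \<le> C" "AE x in \<mu>. \<bar>g x\<bar> \<le> C'" using C C' by auto
    show "esssup \<mu> (\<lambda>x. ereal \<bar>f x - g x\<bar>) \<le> ereal (C + C')"
    proof (rule esssup_I)
      show "AE x in \<mu>. ereal \<bar>f x - g x\<bar> \<le> ereal (C + C')"
        using *(3,4) by eventually_elim simp
    qed (use *(1,2) in measurable)
  qed
  \<comment> \<open>\<open>real_of_ereal\<close> sends infinity to 0, so an infinite supremum would
    not be reflected in \<open>Bd_dist\<close>; boundedness of the classes excludes it.\<close>
  then have Sinf: "S \<noteq> \<infinity>" by auto
  have "esssup \<mu> (\<lambda>x. ereal \<bar>f x - g x\<bar>) \<le> S"
    unfolding S_def using fg by (meson SUP_upper SUP_upper2)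
  then have "AE x in \<mu>. ereal \<bar>f x - g x\<bar> \<le> S"
    using esssup_AE[of "\<lambda>x. ereal \<bar>f x - g x\<bar>" \<mu>] by (auto elim!: eventually_mono)
  then show ?thesis
  proof eventually_elim
    case (elim x)
    then show ?case using Sinf unfolding Bd_dist_def S_def[symmetric] by (cases S) auto
  qed
qed

lemma Bd_dist_le:
  assumes "0 \<le> e" "\<And>f g. f \<in> F \<Longrightarrow> g \<in> G \<Longrightarrow> f \<in> borel_measurable \<mu> \<and> g \<in> borel_measurable \<mu> \<and> (AE x in \<mu>. \<bar>f x - g x\<bar> \<le> e)"
  shows "Bd_dist \<mu> F G \<le> e"
proof -
  define S where "S = (SUP f\<in>F. SUP g\<in>G. esssup \<mu> (\<lambda>x. ereal \<bar>f x - g x\<bar>))"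
  have "S \<le> ereal e"
    unfolding S_def
  proof (intro SUP_least)
    fix f g assume "f \<in> F" "g \<in> G"
    then have *: "f \<in> borel_measurable \<mu>" "g \<in> borel_measurable \<mu>" "AE x in \<mu>. \<bar>f x - g x\<bar> \<le> e"
      using assms(2) by auto
    show "esssup \<mu> (\<lambda>x. ereal \<bar>f x - g x\<bar>) \<le> ereal e"
      by (rule esssup_I) (use * in simp_all)
  qed
  \<comment> \<open>Nonnegativity of \<open>e\<close> covers the value \<open>-\<infinity>\<close>,
    which \<open>real_of_ereal\<close> sends to 0.\<close>
  then show ?thesis using assms(1) unfolding Bd_dist_def S_def[symmetric] by (cases S) auto
qed

text \<open>\<open>spow s\<close> is uniformly continuous on compact intervals, and near a bounded
  class all representatives take values in one such interval almost everywhere.\<close>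

lemma continuous_map_pow_class:
  assumes s: "1 < s"
  shows "continuous_map (Bd_topology \<mu>) (Bd_topology \<mu>) (pow_class s)"
proof -
  have "\<exists>\<delta>>0. \<forall>G. G \<in> Bd \<mu> \<and> Bd_dist \<mu> F G < \<delta> \<longrightarrow> Bd_dist \<mu> (pow_class s F) (pow_class s G) < \<epsilon>"
    if F: "F \<in> Bd \<mu>" and \<epsilon>: "0 < \<epsilon>" for F \<epsilon>
  proof -
    obtain C where C: "\<forall>f\<in>F. f \<in> borel_measurable \<mu> \<and> (AE x in \<mu>. \<bar>f x\<bar> \<le> C)"
      using Bd_bounded[OF F] by auto
    have "continuous_on {-(C+1)..C+1} (spow s)"
      using DERIV_spow[OF s] by (auto intro!: continuous_at_imp_continuous_on DERIV_isCont)
    then have "uniformly_continuous_on {-(C+1)..C+1} (spow s)"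
      by (rule compact_uniformly_continuous) simp
    then obtain d where d: "d > 0"
      "\<And>x y. \<lbrakk>x \<in> {-(C+1)..C+1}; y \<in> {-(C+1)..C+1}; dist y x < d\<rbrakk> \<Longrightarrow> dist (spow s y) (spow s x) < \<epsilon> / 2"
      unfolding uniformly_continuous_on_def using \<epsilon> by (metis half_gt_zero)
    \<comment> \<open>Distance below 1 keeps the representatives of \<open>G\<close> within
      \<open>C + 1\<close>. Half of \<open>\<epsilon>\<close> is aimed at because the supremum over
      representatives may turn a strict bound into a weak one.\<close>
    have "Bd_dist \<mu> (pow_class s F) (pow_class s G) < \<epsilon>"
      if G: "G \<in> Bd \<mu>" "Bd_dist \<mu> F G < min d 1" for G
    proof -
      obtain C' where C': "\<forall>f\<in>G. f \<in> borel_measurable \<mu> \<and> (AE x in \<mu>. \<bar>f x\<bar> \<le> C')"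
        using Bd_bounded[OF G(1)] by auto
      have "Bd_dist \<mu> (pow_class s F) (pow_class s G) \<le> \<epsilon> / 2"
      proof (rule Bd_dist_le)
        fix f' g' assume "f' \<in> pow_class s F" "g' \<in> pow_class s G"
        then obtain f g where fg: "f \<in> F" "g \<in> G" "f' = (\<lambda>x. spow s (f x))" "g' = (\<lambda>x. spow s (g x))"
          by (auto simp: pow_class_def)
        have [measurable]: "f \<in> borel_measurable \<mu>" "g \<in> borel_measurable \<mu>" using C C' fg by auto
        have "AE x in \<mu>. \<bar>f x\<bar> \<le> C" using C fg by auto
        then have "AE x in \<mu>. \<bar>f' x - g' x\<bar> \<le> \<epsilon> / 2"
          using Bd_dist_AE[OF F G(1) fg(1,2)]
        proof eventually_elim
          case (elim x)
          have "dist (spow s (f x)) (spow s (g x)) < \<epsilon> / 2"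
            by (rule d(2)) (use elim G(2) in \<open>auto simp: dist_real_def\<close>)
          then show ?case by (simp add: fg dist_real_def)
        qed
        moreover have "f' \<in> borel_measurable \<mu>" "g' \<in> borel_measurable \<mu>" unfolding fg by measurable
        ultimately show "f' \<in> borel_measurable \<mu> \<and> g' \<in> borel_measurable \<mu> \<and> (AE x in \<mu>. \<bar>f' x - g' x\<bar> \<le> \<epsilon> / 2)"
          by blast
      qed (use \<epsilon> in simp)
      then show ?thesis using \<epsilon> by simp
    qed
    then show ?thesis using d(1) by (intro exI[of _ "min d 1"]) simp
  qed
  then show ?thesis
    unfolding Bd_topology_def Metric_space.metric_continuous_map[OF Metric_space_Bd Metric_space_Bd]
    using pow_class_Bd[of _ \<mu> s] s by auto
qed

text \<open>Precomposition with the odd continuous map \<open>pow_class s\<close> turns an odd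
  sphere map on the image into one on \<open>A\<close>. Every \<open>m\<close> admissible for the
  image is thus admissible for \<open>A\<close>, and the infimum over the larger set is
  smaller.\<close>

lemma genus_pow_class:
  assumes s: "1 < s"
  shows "genus \<mu> A \<le> genus \<mu> (pow_class s ` A)"
  unfolding genus_def
proof (rule Inf_superset_mono, rule subsetI)
  fix n
  assume "n \<in> {enat m |m. \<exists>\<zeta>. continuous_map (subtopology (Bd_topology \<mu>) (pow_class s ` A)) (unit_sphere m) \<zeta> \<and>
      (\<forall>F\<in>pow_class s ` A. \<zeta> F = (\<lambda>i. - \<zeta> (neg_class F) i))}"
  then obtain m \<zeta> where n: "n = enat m"
    and \<zeta>: "continuous_map (subtopology (Bd_topology \<mu>) (pow_class s ` A)) (unit_sphere m) \<zeta>"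
    and odd: "\<And>F. F \<in> A \<Longrightarrow> \<zeta> (pow_class s F) = (\<lambda>i. - \<zeta> (neg_class (pow_class s F)) i)" by blast
  have "continuous_map (subtopology (Bd_topology \<mu>) A) (subtopology (Bd_topology \<mu>) (pow_class s ` A)) (pow_class s)"
    by (rule continuous_map_into_subtopology[OF continuous_map_from_subtopology[OF continuous_map_pow_class[OF s]]]) auto
  from continuous_map_compose[OF this \<zeta>]
  have "continuous_map (subtopology (Bd_topology \<mu>) A) (unit_sphere m) (\<zeta> \<circ> pow_class s)" .
  moreover have "\<forall>F\<in>A. (\<zeta> \<circ> pow_class s) F = (\<lambda>i. - (\<zeta> \<circ> pow_class s) (neg_class F) i)"
    using odd by (simp add: neg_pow_class)
  ultimately show "n \<in> {enat m |m. \<exists>\<zeta>. continuous_map (subtopology (Bd_topology \<mu>) A) (unit_sphere m) \<zeta> \<and>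
      (\<forall>F\<in>A. \<zeta> F = (\<lambda>i. - \<zeta> (neg_class F) i))}"
    unfolding n by blast
qed

section \<open>Monotonicity of the min-max values\<close>

context riemannian_space
begin

text \<open>Each representative on the left is the signed power of one on the right, so the
  quotients are compared termwise. Excluding the zero class excludes functions that vanish almost
  everywhere.\<close>

lemma SUP_rayleigh_pow_class:
  assumes A: "A \<subseteq> Bd vol - {ae_class vol (\<lambda>_. 0)}" and pq: "1 \<le> p" "p < q"
  shows "(SUP f\<in>\<Union>(pow_class (q / p) ` A). grad_norm M vol p f / ennreal (Lp_norm vol p f))
    \<le> ennreal (q / p) * (SUP f\<in>\<Union>A. grad_norm M vol q f / ennreal (Lp_norm vol q f))"
proof (rule SUP_least)
  fix h assume "h \<in> \<Union>(pow_class (q / p) ` A)"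
  then obtain F f where F: "F \<in> A" "f \<in> F" and h: "h = (\<lambda>x. spow (q / p) (f x))"
    by (auto simp: pow_class_def)
  have FB: "F \<in> Bd vol" "F \<noteq> ae_class vol (\<lambda>_. 0)" using A F(1) by auto
  obtain C where C: "f \<in> borel_measurable vol" "AE x in vol. \<bar>f x\<bar> \<le> C" using Bd_bounded[OF FB(1)] F(2) by auto
  have "\<not> (AE x in vol. f x = 0)"
  proof
    assume z: "AE x in vol. f x = 0"
    obtain g where g: "F = ae_class vol g" using FB(1) by (auto simp: Bd_def)
    then have "AE x in vol. f x = g x" using F(2) by (simp add: ae_class_def)
    with z have "AE x in vol. g x = 0" by eventually_elim simp
    then show False using FB(2) ae_class_eqI[of g "\<lambda>_. 0" vol] g by simp
  qed
  from rayleigh_quotient_spow[OF C pq this]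
  have "grad_norm M vol p h / ennreal (Lp_norm vol p h)
      \<le> ennreal (q / p) * (grad_norm M vol q f / ennreal (Lp_norm vol q f))" by (simp add: h)
  also have "\<dots> \<le> ennreal (q / p) * (SUP f\<in>\<Union>A. grad_norm M vol q f / ennreal (Lp_norm vol q f))"
    using F by (intro mult_left_mono SUP_upper) auto
  finally show "grad_norm M vol p h / ennreal (Lp_norm vol p h)
      \<le> ennreal (q / p) * (SUP f\<in>\<Union>A. grad_norm M vol q f / ennreal (Lp_norm vol q f))" .
qed

lemma minmax_value_mono:
  assumes pq: "1 \<le> p" "p < q"
  shows "ennreal p * minmax_value M vol k p \<le> ennreal q * minmax_value M vol k q"
proof -
  have p: "0 < p" and q: "0 < q" and s: "1 < q / p" using pq by (auto simp: field_simps)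
  let ?x = "ennreal p * minmax_value M vol k p"
  \<comment> \<open>The factor \<open>q\<close> is moved to the left so that the infimum at
    \<open>q\<close> stands alone and can be bounded below competitor by competitor.\<close>
  have "ennreal (1 / q) * ?x \<le> minmax_value M vol k q"
    unfolding minmax_value_def[of M vol k q]
  proof (rule INF_greatest)
    fix A assume "A \<in> {A. A \<subseteq> Bd vol - {ae_class vol (\<lambda>_. 0)} \<and> symmetric_classes A \<and> enat k \<le> genus vol A}"
    then have A: "A \<subseteq> Bd vol - {ae_class vol (\<lambda>_. 0)}" "symmetric_classes A" "enat k \<le> genus vol A" by auto
    let ?A = "pow_class (q / p) ` A"
    let ?S = "SUP f\<in>\<Union>A. grad_norm M vol q f / ennreal (Lp_norm vol q f)"
    have "?A \<subseteq> Bd vol - {ae_class vol (\<lambda>_. 0)}"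
      using A(1) pow_class_Bd[of _ vol "q / p"] pow_class_eq_zero_iff[of "q / p" _ vol] s by fastforce
    moreover have "symmetric_classes ?A"
      using A(2) unfolding symmetric_classes_def by (auto simp: neg_pow_class)
    moreover have "enat k \<le> genus vol ?A"
      using A(3) genus_pow_class[OF s] by (rule order_trans)
    ultimately have "minmax_value M vol k p \<le> (SUP f\<in>\<Union>?A. grad_norm M vol p f / ennreal (Lp_norm vol p f))"
      unfolding minmax_value_def by (intro INF_lower) simp
    also have "\<dots> \<le> ennreal (q / p) * ?S" by (rule SUP_rayleigh_pow_class[OF A(1) pq])
    finally have "ennreal (1 / q) * ?x \<le> ennreal (1 / q) * (ennreal p * (ennreal (q / p) * ?S))"
      by (intro mult_left_mono) auto
    also have "\<dots> = ennreal (1 / q * (p * (q / p))) * ?S"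
    proof -
      have "ennreal (1 / q * (p * (q / p))) = ennreal (1 / q) * (ennreal p * ennreal (q / p))"
        using p q by (subst ennreal_mult, simp, simp, subst ennreal_mult, simp_all)
      then show ?thesis by (simp only: mult.assoc)
    qed
    also have "1 / q * (p * (q / p)) = 1" using p q by simp
    finally show "ennreal (1 / q) * ?x \<le> ?S" by simp
  qed
  then have "ennreal q * (ennreal (1 / q) * ?x) \<le> ennreal q * minmax_value M vol k q"
    by (intro mult_left_mono) auto
  moreover have "ennreal q * ennreal (1 / q) = 1"
    using q by (simp add: ennreal_mult[symmetric])
  ultimately show ?thesis by (simp add: mult.assoc[symmetric])
qed

end

theorem theorem5p17:
  fixes M :: "('a::{t2_space,second_countable_topology}, 'n::finite) riemannian"
    and vol :: "'a measure"
    and k :: nat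
  assumes "riemannian_manifold M"
    and "riemannian_volume M vol"
    and "0 < emeasure vol (points M)" and "emeasure vol (points M) < \<infinity>"
    and "k \<ge> 1"
  shows "mono_on {1..} (\<lambda>p::real. ennreal p * minmax_value M vol k p)"
proof (rule mono_onI)
  interpret riemannian_space M vol
    by unfold_locales (fact assms)+
  fix p q :: real
  assume "p \<in> {1..}" "q \<in> {1..}" "p \<le> q"
  then show "ennreal p * minmax_value M vol k p \<le> ennreal q * minmax_value M vol k q"
    \<comment> \<open>The comparison rests on \<open>q / p > 1\<close>; equal exponents give an
      equality.\<close>
    using minmax_value_mono[of p q k] by (cases "p = q") auto
qed

end
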